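(* Let $\boldsymbol e\in\mathbb{L}^2_{\# s}$. Then there exists $v\in LP$ such that $\boldsymbol e=\nabla_s v$ in $\mathbb{L}^2_{\# s}$ if and only if $$\frac1{|Y|}\int_Y\langle\boldsymbol e,\boldsymbol s\rangle\,dy=\Bigl\langle\frac1{|Y|}\int_Y\boldsymbol e\,dy,\ \frac1{|Y|}\int_Y\boldsymbol s\,dy\Bigr\rangle\quad\text{for all }\boldsymbol s\in\mathbb{L}^2_{\# s}\text{ such that }\operatorname{div}\boldsymbol s=0.$$
   Context: Let $\vec g_1,\vec g_2,\vec g_3$ be linearly independent vectors in $\mathbb{R}^3$, let $\mathcal G$ be the additive group (lattice) they generate, and let $Y=\{s_1\vec g_1+s_2\vec g_2+s_3\vec g_3 : s_1,s_2,s_3\in[0,1]\}$ be the periodicity cell. A function on $\mathbb{R}^3$ is $\mathcal G$-periodic if it is invariant under translations by vectors of $\mathcal G$. $\mathbb{L}^2_{\# s}$ is the space of $\mathcal G$-periodic fields of real symmetric $3\times3$ matrices in $L^2_{\rm loc}(\mathbb{R}^3)$, with the $L^2(Y)$ norm. $H^1_\#$ is the space of $\mathcal G$-periodic vector fields in $H^1_{\rm loc}(\mathbb{R}^3,\mathbb{R}^3)$. $\nabla_s v=\frac12(\nabla v+(\nabla v)^T)$, $\langle A,B\rangle=\sum_{i,j}A_{ij}B_{ij}$ for $3\times3$ matrices, and $\operatorname{div}\boldsymbol s=(\sum_j\partial_j s_{ij})_{1\le i\le3}$ in the sense of distributions. $LP=\{u:\mathbb{R}^3\to\mathbb{R}^3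 : u(y)=Ay+\varphi(y),\ A \text{ a real symmetric } 3\times3 \text{ matrix},\ \varphi\in H^1_\#\}$ (linear plus periodic displacements). *)

theory Defs
  imports "HOL-Analysis.Analysis" "HOL-Computational_Algebra.Group_Closure"
begin

text \<open>
  Elements of \<open>L\<^sup>2\<close>-type spaces are represented by Lebesgue measurable functions on the whole
  space, not by equivalence classes. Consequently every pointwise condition on them (periodicity,
  symmetry, equality) is imposed almost everywhere, and all the spaces below are closed under
  modification on null sets.

  The scalar product of \<open>3 \<times> 3\<close> matrices is the library inner product \<open>\<bullet>\<close> on \<open>real^3^3\<close>,
  and the norm on \<open>real^3^3\<close> is accordingly the Frobenius norm:
\<close>

lemma matrix_inner_eq_sum:
  fixes A B :: "real^3^3"
  shows "A \<bullet> B = (\<Sum>i\<in>UNIV. \<Sum>j\<in>UNIV. A $ i $ j * B $ i $ j)"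
  by (simp add: inner_vec_def)


subsection \<open>The lattice and its periodicity cell\<close>

definition lattice :: "(3 \<Rightarrow> real^3) \<Rightarrow> (real^3) set" where
  "lattice g = group_closure (range g)"

definition cell :: "(3 \<Rightarrow> real^3) \<Rightarrow> (real^3) set" where
  "cell g = {(\<Sum>i\<in>UNIV. s i *\<^sub>R g i) | s. \<forall>i. s i \<in> {0..1}}"

definition periodic :: "(3 \<Rightarrow> real^3) \<Rightarrow> (real^3 \<Rightarrow> 'a) \<Rightarrow> bool" where
  "periodic g f \<longleftrightarrow> (\<forall>t\<in>lattice g. AE y in lebesgue. f (y + t) = f y)"

definition cell_mean :: "(3 \<Rightarrow> real^3) \<Rightarrow> (real^3 \<Rightarrow> 'a::euclidean_space) \<Rightarrow> 'a" where
  "cell_mean g f = (1 / measure lebesgue (cell g)) *\<^sub>R (LINT y:cell g|lebesgue. f y)"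


subsection \<open>Test functions and distributional derivatives\<close>

definition partial :: "3 \<Rightarrow> (real^3 \<Rightarrow> real) \<Rightarrow> real^3 \<Rightarrow> real" where
  "partial j f x = frechet_derivative f (at x) (axis j 1)"

primrec C_k :: "nat \<Rightarrow> (real^3 \<Rightarrow> real) \<Rightarrow> bool" where
  "C_k 0 f \<longleftrightarrow> continuous_on UNIV f"
| "C_k (Suc k) f \<longleftrightarrow> f differentiable_on UNIV \<and> (\<forall>j. C_k k (partial j f))"

definition test_functions :: "(real^3 \<Rightarrow> real) set" where
  "test_functions = {\<phi>. (\<forall>k. C_k k \<phi>) \<and> compact (closure {x. \<phi> x \<noteq> 0})}"

text \<open>
  The distribution \<open>\<partial>\<^sub>j f\<close> and the vector-valued distribution \<open>div s\<close>, evaluated at a test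
  function; \<open>f\<close> and the entries of \<open>s\<close> have to be locally integrable.
\<close>

definition distr_partial :: "3 \<Rightarrow> (real^3 \<Rightarrow> real) \<Rightarrow> (real^3 \<Rightarrow> real) \<Rightarrow> real" where
  "distr_partial j f \<phi> = - (LINT y|lebesgue. f y * partial j \<phi> y)"

definition distr_div :: "(real^3 \<Rightarrow> real^3^3) \<Rightarrow> (real^3 \<Rightarrow> real) \<Rightarrow> real^3" where
  "distr_div s \<phi> = (\<chi> i. \<Sum>j\<in>UNIV. distr_partial j (\<lambda>y. s y $ i $ j) \<phi>)"

definition div_free :: "(real^3 \<Rightarrow> real^3^3) \<Rightarrow> bool" where
  "div_free s \<longleftrightarrow> (\<forall>\<phi>\<in>test_functions. distr_div s \<phi> = 0)"


subsection \<open>Function spaces\<close>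

definition L2_loc :: "(real^3 \<Rightarrow> 'a::euclidean_space) set" where
  "L2_loc = {f \<in> borel_measurable lebesgue.
     \<forall>K. compact K \<longrightarrow> set_integrable lebesgue K (\<lambda>y. (norm (f y))\<^sup>2)}"

definition L2_per_sym :: "(3 \<Rightarrow> real^3) \<Rightarrow> (real^3 \<Rightarrow> real^3^3) set" where
  "L2_per_sym g =
     {s \<in> L2_loc. periodic g s \<and> (AE y in lebesgue. transpose (s y) = s y)}"

text \<open>\<open>G y $ i $ j\<close> is the weak derivative \<open>\<partial>\<^sub>j v\<^sub>i\<close>; such a \<open>G\<close> is unique up to null sets.\<close>

definition has_weak_gradient :: "(real^3 \<Rightarrow> real^3) \<Rightarrow> (real^3 \<Rightarrow> real^3^3) \<Rightarrow> bool" where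
  "has_weak_gradient v G \<longleftrightarrow> v \<in> L2_loc \<and> G \<in> L2_loc \<and>
     (\<forall>\<phi>\<in>test_functions. \<forall>i j.
        distr_partial j (\<lambda>y. v y $ i) \<phi> = (LINT y|lebesgue. G y $ i $ j * \<phi> y))"

definition H1_loc :: "(real^3 \<Rightarrow> real^3) set" where
  "H1_loc = {v. \<exists>G. has_weak_gradient v G}"

definition H1_per :: "(3 \<Rightarrow> real^3) \<Rightarrow> (real^3 \<Rightarrow> real^3) set" where
  "H1_per g = {v \<in> H1_loc. periodic g v}"

definition has_sym_gradient :: "(real^3 \<Rightarrow> real^3) \<Rightarrow> (real^3 \<Rightarrow> real^3^3) \<Rightarrow> bool" where
  "has_sym_gradient v e \<longleftrightarrow> (\<exists>G. has_weak_gradient v G \<and>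
     (AE y in lebesgue. e y = (1/2) *\<^sub>R (G y + transpose (G y))))"

definition LP :: "(3 \<Rightarrow> real^3) \<Rightarrow> (real^3 \<Rightarrow> real^3) set" where
  "LP g = {(\<lambda>y. A *v y + \<phi> y) | A \<phi>. transpose A = A \<and> \<phi> \<in> H1_per g}"

end

theory Submission
  imports Defs "HOL-Probability.Probability_Measure"
begin

text \<open>
  Write \<open>A\<close> for the mean of \<open>e\<close> over the cell and \<open>f = e - A\<close>. Pairing the constant \<open>A\<close> with
  \<open>s\<close> gives \<open>A \<bullet> mean s\<close>, so the integral condition says that \<open>f\<close> is orthogonal, in \<open>L\<^sup>2\<close> of the
  cell, to every divergence-free field; and \<open>e = \<nabla>\<^sub>s v\<close> with \<open>v = A y + \<phi>\<close> says that \<open>f = \<nabla>\<^sub>s \<phi>\<close>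
  with \<open>\<phi>\<close> periodic. The theorem is therefore an orthogonal decomposition: the periodic symmetrised
  gradients are exactly the fields orthogonal to the divergence-free ones.

  All fields are replaced by Borel representatives that are periodic at every point, and integrals
  over the cell are taken with respect to the uniform probability measure \<open>\<mu>\<close> on the half-open cell,
  a fundamental domain of the lattice; \<open>\<mu>\<close> is invariant under translations modulo the lattice. An
  integral over the whole space against a function \<open>\<psi>\<close> with bounded support then becomes a cell integral against the periodization
  of \<open>\<psi>\<close> (\<open>per_integral_unfold\<close>). This links test functions, which have bounded support, to
  periodic fields.

  \<^bold>\<open>Gradients are orthogonal to divergence-free fields\<close> (\<open>sym_gradient_orthogonal\<close>). For a bump
  function \<open>\<rho>\<close> consider the pairing of \<open>s\<close> with the convolution \<open>\<rho> * f\<close>. Because \<open>s\<close> is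
  symmetric, \<open>f\<close> may be replaced by the full weak gradient of \<open>\<phi>\<close>, and the derivative then moves to
  \<open>\<rho>\<close>. After interchanging the two integrations (\<open>periodic_kernel_Fubini\<close>) the inner integral is the
  distributional divergence of \<open>s\<close> tested with a translate of \<open>\<rho>\<close>, hence zero
  (\<open>mollified_orthogonality\<close>). When the support of \<open>\<rho>\<close> shrinks to the origin, the pairing converges
  to \<open>\<integral> f \<bullet> s\<close>, because translations are continuous in \<open>L\<^sup>2\<close>. Here \<open>A\<close> is the
  matrix of a given \<open>v\<close>; constant symmetric fields \<open>s\<close> are divergence-free, and testing with them
  shows that \<open>f = e - A\<close> has mean zero, so that \<open>A\<close> is indeed the mean of \<open>e\<close>.

  \<^bold>\<open>Fields orthogonal to the divergence-free ones are gradients\<close>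
  (\<open>projection_on_sym_gradients\<close>). Minimise \<open>\<integral> |f - \<nabla>\<^sub>s p|\<^sup>2\<close> over periodic \<open>C\<^sup>1\<close> displacements
  \<open>p\<close>, normalised to mean zero. The parallelogram identity makes the symmetrised gradients of a
  minimising sequence a Cauchy sequence, Korn's inequality passes this on to the full gradients, and Poincare's inequality
  to the displacements; by completeness of \<open>L\<^sup>2\<close> the limits are some \<open>\<phi>\<close> and its weak gradient \<open>H\<close>.
  The residual \<open>r = f - sym H\<close> is orthogonal to all \<open>\<nabla>\<^sub>s p\<close>, in particular to those of periodized test
  functions, and so \<open>r\<close> is divergence-free. The hypothesis makes \<open>r\<close> orthogonal to \<open>f\<close>, minimality
  makes it orthogonal to \<open>sym H\<close>; hence \<open>r = 0\<close>.

  Both inequalities are proved with difference quotients and translation invariance. Korn's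
  inequality rests on \<open>\<integral> \<partial>\<^sub>i P \<partial>\<^sub>j Q = \<integral> \<partial>\<^sub>j P \<partial>\<^sub>i Q\<close> for periodic \<open>P\<close>, \<open>Q\<close> (\<open>exchange_derivatives\<close>), and
  Poincare's inequality on \<open>\<integral> |P(x + z) - P(x)|\<^sup>2 \<le> |z|\<^sup>2 \<integral> |\<nabla>P|\<^sup>2\<close> (\<open>poincare_translation\<close>).
\<close>

section \<open>Calculus of test functions\<close>

lemma partial_eq:
  assumes "(f has_derivative f') (at x)"
  shows "partial j f x = f' (axis j 1)"
  unfolding partial_def using frechet_derivative_at[OF assms] by simp

lemma has_derivative_partial:
  assumes "f differentiable (at x)"
  shows "(f has_derivative (\<lambda>h. \<Sum>j\<in>UNIV. h $ j * partial j f x)) (at x)"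
proof -
  obtain f' where f': "(f has_derivative f') (at x)"
    using assms by (auto simp: differentiable_def)
  interpret f': bounded_linear f' by (rule has_derivative_bounded_linear[OF f'])
  have "f' h = (\<Sum>j\<in>UNIV. h $ j * partial j f x)" for h
  proof -
    have "f' h = f' (\<Sum>j\<in>UNIV. h $ j *\<^sub>R axis j 1)"
      by (simp add: basis_expansion flip: scalar_mult_eq_scaleR)
    also have "\<dots> = (\<Sum>j\<in>UNIV. h $ j * partial j f x)"
      by (simp add: f'.sum f'.scaleR partial_eq[OF f'])
    finally show ?thesis .
  qed
  then have "f' = (\<lambda>h. \<Sum>j\<in>UNIV. h $ j * partial j f x)" by blast
  with f' show ?thesis by simp
qed

lemma C_k_imp_continuous: "C_k k f \<Longrightarrow> continuous_on UNIV f"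
  by (cases k) (auto intro: differentiable_imp_continuous_on)

lemma C_k_Suc_imp: "C_k (Suc k) f \<Longrightarrow> C_k k f"
  by (induction k arbitrary: f) (auto intro: differentiable_imp_continuous_on)

lemma C_k_differentiable: "C_k (Suc k) f \<Longrightarrow> f differentiable (at x)"
  by (simp add: differentiable_on_def)

lemma C_k_add: "C_k k f \<Longrightarrow> C_k k g \<Longrightarrow> C_k k (\<lambda>x. f x + g x)"
proof (induction k arbitrary: f g)
  case 0
  then show ?case by (auto intro: continuous_on_add)
next
  case (Suc k)
  have "partial j (\<lambda>x. f x + g x) = (\<lambda>x. partial j f x + partial j g x)" for j
  proof
    fix x
    show "partial j (\<lambda>x. f x + g x) x = partial j f x + partial j g x"
      using has_derivative_add[OF has_derivative_partial[OF C_k_differentiable[OF Suc.prems(1), of x]]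
          has_derivative_partial[OF C_k_differentiable[OF Suc.prems(2), of x]]]
      by (simp add: partial_eq axis_def if_distrib[of "\<lambda>a. a * _"] cong: if_cong)
  qed
  with Suc show ?case by auto
qed

lemma C_k_mult: "C_k k f \<Longrightarrow> C_k k g \<Longrightarrow> C_k k (\<lambda>x. f x * g x)"
proof (induction k arbitrary: f g)
  case 0
  then show ?case by (auto intro: continuous_on_mult)
next
  case (Suc k)
  have "partial j (\<lambda>x. f x * g x) = (\<lambda>x. f x * partial j g x + partial j f x * g x)" for j
  proof
    fix x
    show "partial j (\<lambda>x. f x * g x) x = f x * partial j g x + partial j f x * g x"
      using has_derivative_mult[OF has_derivative_partial[OF C_k_differentiable[OF Suc.prems(1), of x]]
          has_derivative_partial[OF C_k_differentiable[OF Suc.prems(2), of x]]]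
      by (simp add: partial_eq axis_def if_distrib[of "\<lambda>a. a * _"] cong: if_cong)
  qed
  moreover have "C_k k (\<lambda>x. f x * partial j g x + partial j f x * g x)" for j
    using Suc.prems C_k_Suc_imp[OF Suc.prems(1)] C_k_Suc_imp[OF Suc.prems(2)]
    by (auto intro!: C_k_add Suc.IH)
  moreover have "(\<lambda>x. f x * g x) differentiable_on UNIV"
    using Suc.prems by (auto intro: differentiable_on_mult)
  ultimately show ?case by simp
qed

lemma C_k_const: "C_k k (\<lambda>x. c)"
proof (induction k arbitrary: c)
  case (Suc k)
  have "partial j (\<lambda>x. c) = (\<lambda>x. 0)" for j
    by (auto simp: partial_eq[OF has_derivative_const])
  with Suc show ?case by auto
qed auto

lemma C_k_prod: "finite I \<Longrightarrow> (\<And>i. i \<in> I \<Longrightarrow> C_k k (f i)) \<Longrightarrow> C_k k (\<lambda>x. \<Prod>i\<in>I. f i x)"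
  by (induction I rule: finite_induct) (auto intro: C_k_const C_k_mult)

lemma partial_affine:
  assumes "f differentiable (at (a + c *\<^sub>R x))"
  shows "partial j (\<lambda>x. f (a + c *\<^sub>R x)) x = c * partial j f (a + c *\<^sub>R x)"
    and "(\<lambda>x. f (a + c *\<^sub>R x)) differentiable (at x)"
proof -
  have "((\<lambda>x. a + c *\<^sub>R x) has_derivative (\<lambda>h. c *\<^sub>R h)) (at x)"
    by (auto intro!: derivative_eq_intros)
  from has_derivative_compose[OF this has_derivative_partial[OF assms]]
  have *: "((\<lambda>x. f (a + c *\<^sub>R x)) has_derivative (\<lambda>h. \<Sum>j\<in>UNIV. (c *\<^sub>R h) $ j * partial j f (a + c *\<^sub>R x))) (at x)" .
  show "partial j (\<lambda>x. f (a + c *\<^sub>R x)) x = c * partial j f (a + c *\<^sub>R x)"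
    by (simp add: partial_eq[OF *] axis_def if_distrib[of "\<lambda>a. c * a * _"] cong: if_cong)
  show "(\<lambda>x. f (a + c *\<^sub>R x)) differentiable (at x)"
    using * by (auto simp: differentiable_def)
qed

lemma C_k_affine: "C_k k f \<Longrightarrow> C_k k (\<lambda>x. f (a + c *\<^sub>R x))"
proof (induction k arbitrary: f)
  case 0
  then show ?case
    by (auto intro!: continuous_intros intro: continuous_on_compose2)
next
  case (Suc k)
  have "partial j (\<lambda>x. f (a + c *\<^sub>R x)) = (\<lambda>x. c * partial j f (a + c *\<^sub>R x))" for j
    using partial_affine(1)[OF C_k_differentiable[OF Suc.prems]] by auto
  moreover have "(\<lambda>x. f (a + c *\<^sub>R x)) differentiable_on UNIV"
    using partial_affine(2)[OF C_k_differentiable[OF Suc.prems]] by (auto simp: differentiable_on_def)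
  ultimately show ?case
    using Suc by (auto intro!: C_k_mult[OF C_k_const])
qed

text \<open>
  Reflections and translations of a mollifier, \<open>\<rho> (w - \<cdot>)\<close> and \<open>\<rho> (\<cdot> - y)\<close>, may be used as test functions.
\<close>

lemma test_functions_affine:
  assumes f: "f \<in> test_functions" and c: "c \<noteq> 0"
  shows "(\<lambda>x. f (a + c *\<^sub>R x)) \<in> test_functions"
proof -
  have "bounded {x. f x \<noteq> 0}"
    using f by (auto simp: test_functions_def intro: bounded_subset[OF compact_imp_bounded closure_subset])
  then obtain R where R: "\<And>x. f x \<noteq> 0 \<Longrightarrow> norm x \<le> R"
    by (auto simp: bounded_iff)
  have "norm x \<le> (R + norm a) / \<bar>c\<bar>" if "f (a + c *\<^sub>R x) \<noteq> 0" for x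
  proof -
    have "norm (a + c *\<^sub>R x) \<le> R" using R that by blast
    moreover have "norm (c *\<^sub>R x) \<le> norm (a + c *\<^sub>R x) + norm a"
      by (metis add.commute add_diff_cancel_left' norm_triangle_ineq4)
    ultimately show ?thesis using c by (simp add: field_simps)
  qed
  then have "bounded {x. f (a + c *\<^sub>R x) \<noteq> 0}" by (auto simp: bounded_iff)
  then show ?thesis
    using f by (auto simp: test_functions_def C_k_affine)
qed

lemma test_function_C_k: "f \<in> test_functions \<Longrightarrow> C_k k f"
  by (simp add: test_functions_def)

lemma test_function_differentiable: "f \<in> test_functions \<Longrightarrow> f differentiable (at x)"
  using C_k_differentiable test_function_C_k by blast

lemma test_function_continuous: "f \<in> test_functions \<Longrightarrow> continuous_on UNIV f"
  using C_k_imp_continuous test_function_C_k by blast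

lemma test_function_partial_continuous:
  "f \<in> test_functions \<Longrightarrow> continuous_on UNIV (partial j f)"
  using test_function_C_k[of f "Suc 0"] by simp

lemma derivative_eq_0_outside_support:
  fixes u :: "'a::euclidean_space \<Rightarrow> real"
  assumes R: "\<And>x. norm x > R \<Longrightarrow> u x = 0" and x: "norm x > R"
    and u': "(u has_derivative u') (at x)"
  shows "u' = (\<lambda>_. 0)"
proof -
  have "open {x::'a. norm x > R}" by (intro open_Collect_less continuous_intros)
  then have "\<forall>\<^sub>F y in nhds x. norm y > R" using x by (auto simp: eventually_nhds)
  then have "\<forall>\<^sub>F y in at x. (0::real) = u y"
    using R by (auto simp: eventually_at_filter elim: eventually_mono)
  then have "(u has_derivative (\<lambda>_. 0)) (at x)"
    using R[OF x] by (intro has_derivative_transform_eventually[OF has_derivative_const[of 0]]) auto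
  with u' show ?thesis by (rule has_derivative_unique)
qed

lemma test_function_support:
  assumes f: "f \<in> test_functions"
  obtains R where "R > 0" "\<And>x. norm x > R \<Longrightarrow> f x = 0" "\<And>x j. norm x > R \<Longrightarrow> partial j f x = 0"
proof -
  have "bounded {x. f x \<noteq> 0}"
    using f by (auto simp: test_functions_def intro: bounded_subset[OF compact_imp_bounded closure_subset])
  then obtain R where R: "R > 0" "\<And>x. f x \<noteq> 0 \<Longrightarrow> norm x \<le> R"
    by (auto simp: bounded_pos)
  show ?thesis
  proof (rule that[OF R(1)])
    show z: "f x = 0" if "norm x > R" for x using R(2)[of x] that by force
    fix x :: "real^3" and j
    assume x: "norm x > R"
    obtain f' where f': "(f has_derivative f') (at x)"
      using test_function_differentiable[OF f] by (auto simp: differentiable_def)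
    show "partial j f x = 0"
      using derivative_eq_0_outside_support[OF z x f'] by (simp add: partial_eq[OF f'])
  qed
qed

lemma continuous_bounded_support_bound:
  fixes u :: "'a::euclidean_space \<Rightarrow> 'b::real_normed_vector"
  assumes u: "continuous_on UNIV u" and R: "\<And>x. norm x > R \<Longrightarrow> u x = 0"
  obtains B where "B > 0" "\<And>x. norm (u x) \<le> B"
proof -
  have "compact (u ` cball 0 R)"
    by (intro compact_continuous_image continuous_on_subset[OF u]) auto
  then obtain B where B: "B > 0" "\<And>x. x \<in> cball 0 R \<Longrightarrow> norm (u x) \<le> B"
    by (auto dest!: compact_imp_bounded simp: bounded_pos)
  have "norm (u x) \<le> B" for x
    using B R[of x] by (cases "norm x > R") auto
  with B(1) that show ?thesis by blast
qed

section \<open>Integration by parts\<close>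

lemma integrable_continuous_bounded_support:
  fixes u :: "'a::euclidean_space \<Rightarrow> 'b::{banach,second_countable_topology}"
  assumes u: "continuous_on UNIV u" and R: "\<And>x. norm x > R \<Longrightarrow> u x = 0"
  shows "integrable lborel u"
proof -
  have "integrable lborel (\<lambda>x. indicator (cball 0 R) x *\<^sub>R u x)"
    using borel_integrable_compact[of "cball 0 R" u] continuous_on_subset[OF u] by auto
  also have "(\<lambda>x. indicator (cball 0 R) x *\<^sub>R u x) = u"
    using R by (auto simp: fun_eq_iff indicator_def not_le)
  finally show ?thesis .
qed

lemma lborel_integral_translation:
  fixes f :: "'a::euclidean_space \<Rightarrow> 'b::{banach,second_countable_topology}"
  shows "(LINT x|lborel. f (x + a)) = (LINT x|lborel. f x)"
proof (cases "f \<in> borel_measurable borel")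
  case True
  have "(LINT x|lborel. f x) = (LINT x|distr lborel borel ((+) a). f x)"
    by (simp add: lborel_distr_plus)
  also have "\<dots> = (LINT x|lborel. f (x + a))"
    using True by (subst integral_distr) (auto simp: add.commute)
  finally show ?thesis ..
next
  case False
  have "\<not> integrable lborel f" using False borel_measurable_integrable by auto
  moreover have "\<not> integrable lborel (\<lambda>x. f (x + a))"
  proof
    assume "integrable lborel (\<lambda>x. f (x + a))"
    then have "(\<lambda>x. f (x + a)) \<in> borel_measurable borel"
      using borel_measurable_integrable by force
    then have "(\<lambda>x. f ((x - a) + a)) \<in> borel_measurable borel"
      by (rule measurable_compose[rotated]) auto
    with False show False by simp
  qed
  ultimately show ?thesis by (simp add: not_integrable_integral_eq)
qed

lemma difference_quotient_tendsto:
  fixes u :: "'a::real_normed_vector \<Rightarrow> real"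
  assumes u': "(u has_derivative u') (at x)" and h: "h \<longlonglongrightarrow> 0" "\<And>n. h n \<noteq> 0"
  shows "(\<lambda>n. (u (x + h n *\<^sub>R a) - u x) / h n) \<longlonglongrightarrow> u' a"
proof -
  have "((\<lambda>t. x + t *\<^sub>R a) has_derivative (\<lambda>s. s *\<^sub>R a)) (at 0)"
    by (auto intro!: derivative_eq_intros)
  from has_derivative_compose[OF this, of u u'] u'
  have "((\<lambda>t. u (x + t *\<^sub>R a)) has_real_derivative u' a) (at 0)"
    by (simp add: has_field_derivative_def mult_commute_abs linear_scale[OF has_derivative_linear[OF u']])
  then have "((\<lambda>s. (u (x + s *\<^sub>R a) - u x) / s) \<longlongrightarrow> u' a) (at 0)"
    by (simp add: DERIV_def)
  moreover have "filterlim h (at 0) sequentially"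
    using h by (auto simp: filterlim_at)
  ultimately show ?thesis by (rule filterlim_compose)
qed

lemma difference_quotient_bound:
  fixes u :: "'a::real_normed_vector \<Rightarrow> real"
  assumes u': "\<And>x. (u has_derivative u' x) (at x)" and B: "\<And>x. \<bar>u' x a\<bar> \<le> B"
  shows "\<bar>(u (x + h *\<^sub>R a) - u x) / h\<bar> \<le> B"
proof -
  have pos: "\<bar>(u (x + h *\<^sub>R a) - u x) / h\<bar> \<le> B" if hp: "h > 0" for x h
  proof -
    have d: "((\<lambda>t. u (x + t *\<^sub>R a)) has_real_derivative u' (x + t *\<^sub>R a) a) (at t)" for t
    proof -
      have "((\<lambda>t. x + t *\<^sub>R a) has_derivative (\<lambda>s. s *\<^sub>R a)) (at t)"
        by (auto intro!: derivative_eq_intros)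
      from has_derivative_compose[OF this u'[of "x + t *\<^sub>R a"]]
      show ?thesis
        by (simp add: has_field_derivative_def mult_commute_abs linear_scale[OF has_derivative_linear[OF u']])
    qed
    obtain z where "u (x + h *\<^sub>R a) - u (x + 0 *\<^sub>R a) = (h - 0) * u' (x + z *\<^sub>R a) a"
      using MVT2[OF hp, of "\<lambda>t. u (x + t *\<^sub>R a)" "\<lambda>t. u' (x + t *\<^sub>R a) a", OF d] by blast
    then show ?thesis using hp B by simp
  qed
  consider "h > 0" | "h = 0" | "h < 0" by linarith
  then show ?thesis
  proof cases
    case 3
    have "(u (x + h *\<^sub>R a) - u x) / h = (u ((x + h *\<^sub>R a) + (- h) *\<^sub>R a) - u (x + h *\<^sub>R a)) / (- h)"
      by (simp add: minus_divide_left[symmetric] minus_divide_right[symmetric] diff_divide_distrib)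
    with pos[of "- h" "x + h *\<^sub>R a"] 3 show ?thesis by simp
  next
    case 2
    have "0 \<le> B" using B[of x] by linarith
    with 2 show ?thesis by simp
  qed (use pos in blast)
qed

text \<open>
  The integral of a difference quotient vanishes by translation invariance; pass to the limit by
  dominated convergence.
\<close>

lemma integral_directional_derivative_eq_0:
  fixes u :: "'a::euclidean_space \<Rightarrow> real"
  assumes u': "\<And>x. (u has_derivative u' x) (at x)"
    and cont: "continuous_on UNIV (\<lambda>x. u' x a)"
    and R: "\<And>x. norm x > R \<Longrightarrow> u x = 0"
  shows "(LINT x|lborel. u' x a) = 0"
proof -
  have contu: "continuous_on UNIV u"
    by (intro continuous_at_imp_continuous_on ballI has_derivative_continuous[OF u'])
  have R': "u' x a = 0" if "norm x > R" for x
    using derivative_eq_0_outside_support[OF R that u'] by simp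
  obtain B where B: "B > 0" "\<And>x. norm (u' x a) \<le> B"
    using continuous_bounded_support_bound[OF cont R'] by blast
  define h where "h n = 1 / real (Suc n)" for n
  have h: "h n \<noteq> 0" "\<bar>h n\<bar> \<le> 1" for n by (auto simp: h_def)
  have h0: "h \<longlonglongrightarrow> 0" unfolding h_def by (rule LIMSEQ_Suc[OF lim_1_over_n])
  define q where "q n x = (u (x + h n *\<^sub>R a) - u x) / h n" for n x
  have far: "u (x + h n *\<^sub>R a) = 0" if "norm x > R + norm a" for n x
  proof -
    have "norm (h n *\<^sub>R a) \<le> norm a" using h(2)[of n] by (simp add: mult_left_le_one_le)
    then have "norm (x + h n *\<^sub>R a) > R" using that norm_diff_ineq[of x "h n *\<^sub>R a"] by linarith
    then show ?thesis by (rule R)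
  qed
  have qz: "q n x = 0" if "norm x > R + norm a" for n x
  proof -
    have "norm x > R" using that norm_ge_zero[of a] by linarith
    then show ?thesis by (simp add: q_def R far[OF that])
  qed
  have [measurable]: "u \<in> borel_measurable borel" using contu by (rule borel_measurable_continuous_onI)
  have [measurable]: "(\<lambda>x. u' x a) \<in> borel_measurable borel"
    using cont by (rule borel_measurable_continuous_onI)
  have iu: "integrable lborel u" using integrable_continuous_bounded_support[OF contu R] .
  have "(\<lambda>n. LINT x|lborel. q n x) \<longlonglongrightarrow> (LINT x|lborel. u' x a)"
  proof (rule integral_dominated_convergence[where w = "\<lambda>x. B * indicator (cball 0 (R + norm a)) x"])
    have "emeasure lborel (cball (0::'a) (R + norm a)) < \<infinity>"
      by (rule emeasure_bounded_finite) simp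
    then show "integrable lborel (\<lambda>x. B * indicator (cball (0::'a) (R + norm a)) x)" by simp
    have "\<bar>q n x\<bar> \<le> B" for n x
      unfolding q_def using B(2) by (intro difference_quotient_bound[OF u']) simp
    then show "AE x in lborel. norm (q n x) \<le> B * indicator (cball 0 (R + norm a)) x" for n
      using qz by (auto simp: indicator_def not_le)
    show "q n \<in> borel_measurable lborel" for n unfolding q_def by measurable
    show "AE x in lborel. (\<lambda>n. q n x) \<longlonglongrightarrow> u' x a"
      unfolding q_def using difference_quotient_tendsto[OF u' h0 h(1)] by simp
  qed measurable
  moreover have "(LINT x|lborel. q n x) = 0" for n
  proof -
    have "integrable lborel (\<lambda>x. u (x + h n *\<^sub>R a))"
      by (rule integrable_continuous_bounded_support[where R = "R + norm a"])
        (auto simp: far intro!: continuous_on_compose2[OF contu] continuous_intros)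
    then have "(LINT x|lborel. u (x + h n *\<^sub>R a) - u x) = 0"
      by (simp add: Bochner_Integration.integral_diff[OF _ iu] lborel_integral_translation)
    then show ?thesis by (simp add: q_def)
  qed
  ultimately show ?thesis by (simp add: LIMSEQ_const_iff)
qed

lemma integration_by_parts:
  assumes q': "\<And>x. (q has_derivative q' x) (at x)"
    and cont: "continuous_on UNIV (\<lambda>x. q' x (axis j 1))"
    and \<psi>: "\<psi> \<in> test_functions"
  shows "(LINT x|lborel. q x * partial j \<psi> x) = - (LINT x|lborel. q' x (axis j 1) * \<psi> x)"
proof -
  obtain R where R: "\<And>x. norm x > R \<Longrightarrow> \<psi> x = 0" "\<And>x. norm x > R \<Longrightarrow> partial j \<psi> x = 0"
    using test_function_support[OF \<psi>] by metis
  have contq: "continuous_on UNIV q"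
    by (intro continuous_at_imp_continuous_on ballI has_derivative_continuous[OF q'])
  note c = test_function_continuous[OF \<psi>] test_function_partial_continuous[OF \<psi>, of j]
  define u' where "u' x h = q x * (\<Sum>j\<in>UNIV. h $ j * partial j \<psi> x) + q' x h * \<psi> x" for x h
  have u': "((\<lambda>x. q x * \<psi> x) has_derivative u' x) (at x)" for x
    unfolding u'_def
    by (intro has_derivative_mult q' has_derivative_partial test_function_differentiable \<psi>)
  have eq: "u' x (axis j 1) = q x * partial j \<psi> x + q' x (axis j 1) * \<psi> x" for x
    by (simp add: u'_def axis_def if_distrib[of "\<lambda>a. a * _"] cong: if_cong)
  have "(LINT x|lborel. u' x (axis j 1)) = 0"
    by (rule integral_directional_derivative_eq_0[OF u', where R=R])
      (auto simp: eq R intro!: continuous_intros contq c cont)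
  moreover have "integrable lborel (\<lambda>x. q x * partial j \<psi> x)"
    by (rule integrable_continuous_bounded_support[where R=R])
      (auto simp: R intro!: continuous_intros contq c)
  moreover have "integrable lborel (\<lambda>x. q' x (axis j 1) * \<psi> x)"
    by (rule integrable_continuous_bounded_support[where R=R])
      (auto simp: R intro!: continuous_intros cont c)
  ultimately show ?thesis by (simp add: eq)
qed

section \<open>Bump functions\<close>

text \<open>
  For \<open>m = 0\<close> this is the standard function that is smooth and flat at 0. The powers of \<open>1 / t\<close> are
  included because the span of the family is then closed under differentiation, which turns
  smoothness into a plain induction.
\<close>

definition flat_exp :: "nat \<Rightarrow> real \<Rightarrow> real" where
  "flat_exp m t = (if t > 0 then (1 / t) ^ m * exp (- (1 / t)) else 0)"

lemma flat_exp_tendsto_0: "(flat_exp m \<longlongrightarrow> 0) (at_right 0)"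
proof -
  have "((\<lambda>u. u ^ m / exp u) \<longlongrightarrow> (0::real)) at_top" by (rule tendsto_power_div_exp_0)
  then have "((\<lambda>t. inverse t ^ m / exp (inverse t)) \<longlongrightarrow> (0::real)) (at_right 0)"
    by (rule filterlim_compose[OF _ filterlim_inverse_at_top_right])
  moreover have "\<forall>\<^sub>F t in at_right 0. inverse t ^ m / exp (inverse t) = flat_exp m t"
    unfolding eventually_at_right_field
    by (rule exI[of _ 1]) (auto simp: flat_exp_def exp_minus divide_simps)
  ultimately show ?thesis by (rule Lim_transform_eventually)
qed

lemma flat_exp_has_derivative:
  "(flat_exp m has_real_derivative (flat_exp (m + 2) t - of_nat m * flat_exp (m + 1) t)) (at t)"
proof (cases t "0::real" rule: linorder_cases)
  case less
  have "((\<lambda>_. 0) has_real_derivative 0) (at t)" by simp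
  then have "(flat_exp m has_real_derivative 0) (at t)"
    by (rule has_field_derivative_transform_within_open[of _ _ _ "{..<0}"])
      (use less in \<open>auto simp: flat_exp_def\<close>)
  with less show ?thesis by (simp add: flat_exp_def)
next
  case equal
  have "((\<lambda>h. flat_exp m h / h) \<longlongrightarrow> 0) (at_right 0)"
  proof (rule Lim_transform_eventually[OF flat_exp_tendsto_0[of "m+1"]])
    show "\<forall>\<^sub>F t in at_right 0. flat_exp (m + 1) t = flat_exp m t / t"
      unfolding eventually_at_right_field
      by (rule exI[of _ 1]) (auto simp: flat_exp_def)
  qed
  moreover have "((\<lambda>h. flat_exp m h / h) \<longlongrightarrow> 0) (at_left 0)"
  proof (rule Lim_transform_eventually[OF tendsto_const])
    show "\<forall>\<^sub>F t in at_left 0. 0 = flat_exp m t / t"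
      unfolding eventually_at_left_field
      by (rule exI[of _ "-1"]) (auto simp: flat_exp_def)
  qed
  ultimately have "((\<lambda>h. flat_exp m h / h) \<longlongrightarrow> 0) (at 0)"
    by (simp add: filterlim_at_split)
  then show ?thesis using equal by (simp add: DERIV_def flat_exp_def)
next
  case greater
  define u where "u = 1 / t"
  have du: "((\<lambda>t. 1 / t) has_real_derivative - (u ^ 2)) (at t)"
    using greater by (auto intro!: derivative_eq_intros simp: u_def power2_eq_square)
  have "((\<lambda>t. (1 / t) ^ m * exp (- (1 / t))) has_real_derivative
     (of_nat m * (- (u ^ 2) * u ^ (m - Suc 0)) * exp (- u) + exp (- u) * u ^ 2 * u ^ m)) (at t)"
    using DERIV_mult[OF DERIV_power[OF du, of m] DERIV_fun_exp[OF DERIV_minus[OF du]]]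
    by (simp add: u_def)
  moreover have "of_nat m * (- (u ^ 2) * u ^ (m - Suc 0)) * exp (- u) + exp (- u) * u ^ 2 * u ^ m
      = flat_exp (m + 2) t - of_nat m * flat_exp (m + 1) t"
  proof -
    have "flat_exp n t = u ^ n * exp (- u)" for n
      using greater by (simp add: flat_exp_def u_def)
    then show ?thesis
      by (cases m) (simp_all add: power2_eq_square algebra_simps)
  qed
  ultimately have "((\<lambda>t. (1 / t) ^ m * exp (- (1 / t))) has_real_derivative
     (flat_exp (m + 2) t - of_nat m * flat_exp (m + 1) t)) (at t)"
    by simp
  then show ?thesis
    by (rule has_field_derivative_transform_within_open[of _ _ _ "{0<..}"])
      (use greater in \<open>auto simp: flat_exp_def\<close>)
qed

lemma C_k_flat_exp: "C_k k (\<lambda>x. flat_exp m (a + c * x $ i))"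
proof (induction k arbitrary: m)
  case 0
  have "isCont (flat_exp m) t" for t using flat_exp_has_derivative DERIV_isCont by blast
  then have "continuous_on UNIV (flat_exp m)" by (simp add: continuous_at_imp_continuous_on)
  then show ?case by (auto intro!: continuous_on_compose2[of UNIV "flat_exp m"] continuous_intros)
next
  case (Suc k)
  define D where "D x = flat_exp (m + 2) (a + c * x $ i) - of_nat m * flat_exp (m + 1) (a + c * x $ i)" for x :: "real^3"
  have D: "((\<lambda>x. flat_exp m (a + c * x $ i)) has_derivative (\<lambda>h. D x * (c * h $ i))) (at x)" for x :: "real^3"
  proof -
    have "((\<lambda>x. a + c * x $ i) has_derivative (\<lambda>h. c * h $ i)) (at x)"
      by (auto intro!: derivative_eq_intros bounded_linear_imp_has_derivative bounded_linear_vec_nth)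
    from has_derivative_compose[OF this flat_exp_has_derivative[unfolded has_field_derivative_def]]
    show ?thesis by (simp add: D_def)
  qed
  have "partial j (\<lambda>x. flat_exp m (a + c * x $ i)) = (\<lambda>x. (c * axis j 1 $ i) * D x)" for j
    using partial_eq[OF D] by (auto simp: fun_eq_iff)
  moreover have "C_k k D"
  proof -
    have "D = (\<lambda>x. flat_exp (m + 2) (a + c * x $ i) + (- of_nat m) * flat_exp (m + 1) (a + c * x $ i))"
      by (auto simp: D_def)
    then show ?thesis using Suc by (simp only:) (intro C_k_add C_k_mult C_k_const)
  qed
  moreover have "(\<lambda>x. flat_exp m (a + c * x $ i)) differentiable_on UNIV"
    unfolding differentiable_on_def differentiable_def using D by blast
  ultimately show ?case by (auto intro!: C_k_mult C_k_const)
qed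

text \<open>
  A product, over the coordinates \<open>x\<^sub>i\<close>, of flat exponentials in \<open>\<delta> + x\<^sub>i\<close> and \<open>\<delta> - x\<^sub>i\<close>: it is positive
  exactly on an open cube.
\<close>

lemma bump_exists:
  assumes "\<epsilon> > 0"
  obtains \<rho> where "\<rho> \<in> test_functions" "\<And>x. \<rho> x \<ge> 0" "\<And>x. norm x \<ge> \<epsilon> \<Longrightarrow> \<rho> x = 0"
    "(LINT x|lborel. \<rho> x) > 0"
proof -
  (* a cube of half width \<epsilon> / 3 lies in the ball of radius \<epsilon>, by the sum norm in dimension 3 *)
  define \<delta> where "\<delta> = \<epsilon> / 3"
  have \<delta>: "\<delta> > 0" using assms by (simp add: \<delta>_def)
  define \<rho> :: "real^3 \<Rightarrow> real" where
    "\<rho> x = (\<Prod>i\<in>UNIV. flat_exp 0 (\<delta> + 1 * x $ i) * flat_exp 0 (\<delta> + (-1) * x $ i))" for x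
  have pos: "\<rho> x \<noteq> 0 \<longleftrightarrow> (\<forall>i. \<bar>x $ i\<bar> < \<delta>)" for x
  proof -
    have "\<bar>x $ i\<bar> < \<delta> \<longleftrightarrow> 0 < \<delta> + x $ i \<and> x $ i < \<delta>" for i by arith
    then show ?thesis by (auto simp: \<rho>_def flat_exp_def)
  qed
  have supp: "\<rho> x = 0" if "norm x \<ge> \<epsilon>" for x
  proof (rule ccontr)
    assume "\<rho> x \<noteq> 0"
    then have "\<bar>x $ i\<bar> < \<delta>" for i using pos by blast
    then have "(\<Sum>i\<in>UNIV. \<bar>x $ i\<bar>) < (\<Sum>i\<in>(UNIV::3 set). \<delta>)"
      by (intro sum_strict_mono) auto
    then have "norm x < \<epsilon>" using norm_le_l1_cart[of x] by (simp add: \<delta>_def)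
    with that show False by simp
  qed
  have C: "C_k k \<rho>" for k
    unfolding \<rho>_def by (intro C_k_prod C_k_mult C_k_flat_exp) auto
  have "bounded {x. \<rho> x \<noteq> 0}"
    unfolding bounded_iff using supp by (intro exI[of _ \<epsilon>]) force
  then have T: "\<rho> \<in> test_functions" by (simp add: test_functions_def C)
  have nn: "\<rho> x \<ge> 0" for x by (auto simp: \<rho>_def flat_exp_def intro!: prod_nonneg)
  have cont: "continuous_on UNIV \<rho>" using test_function_continuous[OF T] .
  have int: "integrable lborel \<rho>"
    by (rule integrable_continuous_bounded_support[OF cont, of \<epsilon>]) (simp add: supp)
  have "(LINT x|lborel. \<rho> x) \<noteq> 0"
  proof
    assume "(LINT x|lborel. \<rho> x) = 0"
    then have ae: "AE x in lborel. \<rho> x = 0" using integral_nonneg_eq_0_iff_AE[OF int] nn by simp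
    have o: "open {x. \<rho> x \<noteq> 0}" using cont by (intro open_Collect_neq continuous_intros) auto
    have "{x. \<rho> x \<noteq> 0} \<in> null_sets lborel"
    proof (rule iffD2[OF AE_iff_null_sets])
      show "{x. \<rho> x \<noteq> 0} \<in> sets lborel" using o by simp
      show "AE x in lborel. x \<notin> {x. \<rho> x \<noteq> 0}" using ae by simp
    qed
    then have "negligible {x. \<rho> x \<noteq> 0}"
      by (simp add: negligible_iff_null_sets null_sets_completionI)
    then have "{x. \<rho> x \<noteq> 0} = {}" using open_not_negligible[OF o] by blast
    moreover have "\<rho> 0 \<noteq> 0" using pos \<delta> by simp
    ultimately show False by blast
  qed
  then have "(LINT x|lborel. \<rho> x) > 0" using Bochner_Integration.integral_nonneg[of lborel \<rho>] nn by (simp add: less_le)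
  with that T nn supp show ?thesis by blast
qed

section \<open>The lattice and its periodicity cell\<close>

lemma borel_measurable_vec_nth [measurable (raw)]:
  fixes f :: "'a \<Rightarrow> ('b::euclidean_space)^'n"
  assumes "f \<in> borel_measurable M"
  shows "(\<lambda>x. f x $ i) \<in> borel_measurable M"
  by (rule borel_measurable_continuous_on[OF _ assms])
    (intro linear_continuous_on bounded_linear_vec_nth)

locale period_lattice =
  fixes g :: "3 \<Rightarrow> real^3"
  assumes inj_g: "inj g" and indep_g: "independent (range g)"
begin

abbreviation "\<Lambda> \<equiv> lattice g"

definition gen_comb :: "real^3 \<Rightarrow> real^3" where
  "gen_comb x = (\<Sum>i\<in>UNIV. x $ i *\<^sub>R g i)"

definition coord :: "real^3 \<Rightarrow> real^3" where
  "coord = inv gen_comb"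

lemma linear_gen_comb: "linear gen_comb"
  by (rule linearI) (simp_all add: gen_comb_def scaleR_left_distrib sum.distrib scaleR_sum_right)

lemma inj_gen_comb: "inj gen_comb"
proof (rule linear_injective_0[THEN iffD2, OF linear_gen_comb], intro allI impI)
  fix x assume x: "gen_comb x = 0"
  define u where "u v = x $ (inv g v)" for v
  have u: "u (g i) = x $ i" for i by (simp add: u_def inj_g)
  have "(\<Sum>v\<in>range g. u v *\<^sub>R v) = 0"
    using x by (simp add: sum.reindex[OF inj_g] u gen_comb_def)
  then have "\<forall>v\<in>range g. u v = 0"
    using dependent_finite[of "range g"] indep_g by auto
  then show "x = 0" using u by (simp add: vec_eq_iff)
qed

lemma coord_gen_comb [simp]: "coord (gen_comb x) = x"
  by (simp add: coord_def inj_gen_comb)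

lemma gen_comb_coord [simp]: "gen_comb (coord y) = y"
  using linear_injective_imp_surjective[OF linear_gen_comb inj_gen_comb]
  by (simp add: coord_def surj_f_inv_f)

lemma linear_coord: "linear coord"
proof (rule linearI)
  fix a b :: "real^3" and r :: real
  have "gen_comb (coord a + coord b) = a + b" by (simp add: linear_add[OF linear_gen_comb])
  then show "coord (a + b) = coord a + coord b" by (metis coord_gen_comb)
  have "gen_comb (r *\<^sub>R coord a) = r *\<^sub>R a" by (simp add: linear_scale[OF linear_gen_comb])
  then show "coord (r *\<^sub>R a) = r *\<^sub>R coord a" by (metis coord_gen_comb)
qed

lemma continuous_coord: "continuous_on UNIV coord"
  by (rule linear_continuous_on) (simp add: linear_coord linear_conv_bounded_linear[symmetric])

lemma measurable_coord [measurable]: "coord \<in> borel_measurable borel"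
  by (rule borel_measurable_continuous_onI[OF continuous_coord])

lemma lattice_eq: "\<Lambda> = {y. \<forall>i. coord y $ i \<in> \<int>}"
proof (intro set_eqI iffI)
  fix y assume "y \<in> \<Lambda>"
  then have "y \<in> group_closure (range g)" by (simp add: lattice_def)
  then show "y \<in> {y. \<forall>i. coord y $ i \<in> \<int>}"
  proof induction
    case (base s)
    have "g j = gen_comb (axis j 1)" for j
      by (simp add: gen_comb_def axis_def if_distrib[of "\<lambda>a. a *\<^sub>R _"] cong: if_cong)
    then have "coord (g j) = axis j 1" for j by simp
    with base show ?case by (auto simp: linear_0[OF linear_coord] axis_def)
  next
    case (diff s t)
    then show ?case by (auto simp: linear_diff[OF linear_coord])
  qed
next
  fix y assume "y \<in> {y. \<forall>i. coord y $ i \<in> \<int>}"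
  then have y: "coord y $ i \<in> \<int>" for i by simp
  have nat: "of_nat n *\<^sub>R g i \<in> \<Lambda>" for n i
  proof (induction n)
    case (Suc n)
    have "g i \<in> \<Lambda>" by (auto simp: lattice_def intro: group_closure.base)
    with Suc show ?case by (auto simp: lattice_def scaleR_left_distrib intro: group_closure_add)
  qed (simp add: lattice_def)
  have int: "r *\<^sub>R g i \<in> \<Lambda>" if "r \<in> \<int>" for r i
  proof -
    obtain k where k: "r = of_int k" using \<open>r \<in> \<int>\<close> by (auto elim: Ints_cases)
    show ?thesis
    proof (cases "k \<ge> 0")
      case True
      then show ?thesis using nat[of "nat k" i] k by simp
    next
      case False
      then have "r *\<^sub>R g i = - (of_nat (nat (- k)) *\<^sub>R g i)" using k by simp
      moreover have "- x \<in> \<Lambda>" if "x \<in> \<Lambda>" for x using that by (simp add: lattice_def)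
      ultimately show ?thesis using nat by metis
    qed
  qed
  have "(\<Sum>i\<in>I. coord y $ i *\<^sub>R g i) \<in> \<Lambda>" if "finite I" for I
    using that int[OF y]
    by (induction I) (auto simp: lattice_def intro: group_closure_add)
  then have "gen_comb (coord y) \<in> \<Lambda>" unfolding gen_comb_def by simp
  then show "y \<in> \<Lambda>" by simp
qed

lemma lattice_0 [simp]: "0 \<in> \<Lambda>"
  and lattice_add: "s \<in> \<Lambda> \<Longrightarrow> t \<in> \<Lambda> \<Longrightarrow> s + t \<in> \<Lambda>"
  and lattice_uminus [simp]: "- t \<in> \<Lambda> \<longleftrightarrow> t \<in> \<Lambda>"
  by (auto simp: lattice_def intro: group_closure_add)

lemma finite_lattice_bounded: "finite {t \<in> \<Lambda>. norm t \<le> r}"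
proof -
  obtain B where B: "\<And>y. norm (coord y) \<le> B * norm y" "B > 0"
    using bounded_linear.pos_bounded linear_coord
    by (metis linear_conv_bounded_linear mult.commute)
  define Z where "Z = {x \<in> \<int>. \<bar>x\<bar> \<le> B * r}"
  have "finite Z"
  proof -
    have "Z \<subseteq> of_int ` {- \<lceil>B * r\<rceil>..\<lceil>B * r\<rceil>}"
    proof
      fix x assume "x \<in> Z"
      then obtain k where k: "x = of_int k" "\<bar>x\<bar> \<le> B * r" by (auto simp: Z_def elim: Ints_cases)
      then have "\<bar>k\<bar> \<le> \<lceil>B * r\<rceil>" by linarith
      then have "k \<in> {- \<lceil>B * r\<rceil>..\<lceil>B * r\<rceil>}" by (auto simp: abs_le_iff)
      with k(1) show "x \<in> of_int ` {- \<lceil>B * r\<rceil>..\<lceil>B * r\<rceil>}" by blast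
    qed
    then show ?thesis by (rule finite_subset) simp
  qed
  have "finite {x :: real^3. \<forall>i. x $ i \<in> Z}"
  proof (rule finite_subset[rotated])
    show "finite (vec_lambda ` (\<Pi>\<^sub>E i\<in>(UNIV::3 set). Z))"
      using \<open>finite Z\<close> by (intro finite_imageI finite_PiE) auto
    have "x = vec_lambda (($) x)" "($) x \<in> (\<Pi>\<^sub>E i\<in>(UNIV::3 set). Z)"
      if "\<forall>i. x $ i \<in> Z" for x :: "real^3"
      using that by (auto simp: vec_lambda_eta)
    then show "{x :: real^3. \<forall>i. x $ i \<in> Z} \<subseteq> vec_lambda ` (\<Pi>\<^sub>E i\<in>(UNIV::3 set). Z)"
      by blast
  qed
  moreover have "{t \<in> \<Lambda>. norm t \<le> r} \<subseteq> gen_comb ` {x. \<forall>i. x $ i \<in> Z}"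
  proof
    fix t assume t: "t \<in> {t \<in> \<Lambda>. norm t \<le> r}"
    have "\<bar>coord t $ i\<bar> \<le> B * r" for i
    proof -
      have "\<bar>coord t $ i\<bar> \<le> norm (coord t)" by (rule component_le_norm_cart)
      also have "\<dots> \<le> B * norm t" by (rule B)
      also have "\<dots> \<le> B * r" using t B(2) by simp
      finally show ?thesis .
    qed
    with t have "coord t \<in> {x. \<forall>i. x $ i \<in> Z}" by (auto simp: Z_def lattice_eq)
    then show "t \<in> gen_comb ` {x. \<forall>i. x $ i \<in> Z}" by (metis gen_comb_coord imageI)
  qed
  ultimately show ?thesis by (meson finite_imageI finite_subset)
qed

lemma countable_lattice: "countable \<Lambda>"
proof -
  have "\<Lambda> = (\<Union>n::nat. {t \<in> \<Lambda>. norm t \<le> real n})"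
  proof
    show "\<Lambda> \<subseteq> (\<Union>n::nat. {t \<in> \<Lambda>. norm t \<le> real n})"
      using real_arch_simple by fast
  qed blast
  moreover have "countable (\<Union>n::nat. {t \<in> \<Lambda>. norm t \<le> real n})"
    by (intro countable_UN[OF countableI_type] countable_finite finite_lattice_bounded)
  ultimately show ?thesis by simp
qed

definition floor_pt :: "real^3 \<Rightarrow> real^3" where
  "floor_pt y = gen_comb (\<chi> i. of_int \<lfloor>coord y $ i\<rfloor>)"

text \<open>
  The half-open cell meets every orbit of the lattice in exactly one point, which the closed cell
  does not; the two differ by a null set.
\<close>

definition cell0 :: "(real^3) set" where
  "cell0 = {y. \<forall>i. 0 \<le> coord y $ i \<and> coord y $ i < 1}"

definition wrap :: "real^3 \<Rightarrow> real^3" where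
  "wrap y = y - floor_pt y"

lemma floor_pt_lattice [simp]: "floor_pt y \<in> \<Lambda>"
  by (simp add: floor_pt_def lattice_eq)

lemma cell0_iff: "y \<in> cell0 \<longleftrightarrow> floor_pt y = 0"
proof -
  have "floor_pt y = 0 \<longleftrightarrow> (\<chi> i. real_of_int \<lfloor>coord y $ i\<rfloor>) = 0"
    using inj_gen_comb linear_0[OF linear_gen_comb] by (metis floor_pt_def coord_gen_comb)
  also have "\<dots> \<longleftrightarrow> y \<in> cell0"
    by (auto simp: vec_eq_iff cell0_def floor_eq_iff)
  finally show ?thesis by simp
qed

lemma floor_pt_add: "t \<in> \<Lambda> \<Longrightarrow> floor_pt (y + t) = floor_pt y + t"
proof -
  assume t: "t \<in> \<Lambda>"
  have "\<lfloor>coord y $ i + coord t $ i\<rfloor> = \<lfloor>coord y $ i\<rfloor> + \<lfloor>coord t $ i\<rfloor>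
      \<and> real_of_int \<lfloor>coord t $ i\<rfloor> = coord t $ i" for i
    using t by (auto simp: lattice_eq elim!: Ints_cases dest!: spec[of _ i])
  then have "(\<chi> i. real_of_int \<lfloor>coord (y + t) $ i\<rfloor>) = (\<chi> i. of_int \<lfloor>coord y $ i\<rfloor>) + coord t"
    by (simp add: vec_eq_iff linear_add[OF linear_coord])
  then show ?thesis by (simp add: floor_pt_def linear_add[OF linear_gen_comb])
qed

lemma wrap_add [simp]: "t \<in> \<Lambda> \<Longrightarrow> wrap (y + t) = wrap y"
  by (simp add: wrap_def floor_pt_add)

lemma wrap_in_cell0: "wrap y \<in> cell0"
  using floor_pt_add[of "- floor_pt y" y] by (simp add: cell0_iff wrap_def)

lemma wrap_eq: "y \<in> cell0 \<Longrightarrow> wrap y = y"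
  by (simp add: cell0_iff wrap_def)

lemma diff_in_cell0_iff: "t \<in> \<Lambda> \<Longrightarrow> y - t \<in> cell0 \<longleftrightarrow> t = floor_pt y"
  using floor_pt_add[of "- t" y] by (auto simp: cell0_iff)

lemma measurable_cell0 [measurable]: "cell0 \<in> sets borel"
  unfolding cell0_def by measurable

lemma measurable_floor_pt [measurable]: "floor_pt \<in> borel_measurable borel"
proof -
  have "(\<lambda>x::real. real_of_int \<lfloor>x\<rfloor>) \<in> borel_measurable borel" by measurable
  then have "(\<lambda>y. of_int \<lfloor>coord y $ i\<rfloor> *\<^sub>R g i) \<in> borel_measurable borel" for i
    by measurable
  then show ?thesis unfolding floor_pt_def gen_comb_def by (simp add: borel_measurable_sum)
qed

lemma measurable_wrap [measurable]: "wrap \<in> borel_measurable borel"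
  unfolding wrap_def by measurable

lemma cell_eq: "cell g = {y. \<forall>i. 0 \<le> coord y $ i \<and> coord y $ i \<le> 1}"
proof (intro set_eqI iffI)
  fix y assume "y \<in> cell g"
  then obtain s where s: "y = (\<Sum>i\<in>UNIV. s i *\<^sub>R g i)" "\<forall>i. s i \<in> {0..1}" by (auto simp: cell_def)
  then have "y = gen_comb (\<chi> i. s i)" by (simp add: gen_comb_def)
  then have "coord y = (\<chi> i. s i)" by (simp only: coord_gen_comb)
  with s show "y \<in> {y. \<forall>i. 0 \<le> coord y $ i \<and> coord y $ i \<le> 1}" by simp
next
  fix y assume "y \<in> {y. \<forall>i. 0 \<le> coord y $ i \<and> coord y $ i \<le> 1}"
  moreover have "y = (\<Sum>i\<in>UNIV. coord y $ i *\<^sub>R g i)" using gen_comb_coord[of y] by (simp add: gen_comb_def)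
  ultimately show "y \<in> cell g" unfolding cell_def by fastforce
qed

lemma cell_subset_cball:
  obtains r where "r > 0" "cell g \<subseteq> cball 0 r"
proof -
  have "norm y \<le> 1 + (\<Sum>i\<in>UNIV. norm (g i))" if "y \<in> cell g" for y
  proof -
    have y: "0 \<le> coord y $ i \<and> coord y $ i \<le> 1" for i using that by (simp add: cell_eq)
    have "norm y = norm (\<Sum>i\<in>UNIV. coord y $ i *\<^sub>R g i)"
      using gen_comb_coord[of y] by (simp add: gen_comb_def)
    also have "\<dots> \<le> (\<Sum>i\<in>UNIV. norm (g i))"
      using y by (intro sum_norm_le) (simp add: mult_left_le_one_le)
    finally show ?thesis by simp
  qed
  moreover have "1 + (\<Sum>i\<in>UNIV. norm (g i)) > 0" by (simp add: add_pos_nonneg sum_nonneg)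
  ultimately show ?thesis by (intro that[of "1 + (\<Sum>i\<in>UNIV. norm (g i))"]) (auto simp: subset_iff)
qed

lemma cell0_subset_cell: "cell0 \<subseteq> cell g"
  by (auto simp: cell_eq cell0_def intro: less_imp_le)

lemma measurable_cell [measurable]: "cell g \<in> sets borel"
  unfolding cell_eq by measurable

lemma AE_cell_iff_cell0: "AE y in lborel. y \<in> cell g \<longleftrightarrow> y \<in> cell0"
proof -
  have "negligible {y. coord y $ i = 1}" for i
  proof -
    define a where "a = (\<chi> j. coord (axis j 1) $ i)"
    have "coord y $ i = a \<bullet> y" for y
    proof -
      have "coord y $ i = coord (\<Sum>j\<in>UNIV. y $ j *\<^sub>R axis j 1) $ i"
        by (simp add: basis_expansion flip: scalar_mult_eq_scaleR)
      also have "\<dots> = a \<bullet> y"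
        by (simp add: linear_sum[OF linear_coord] linear_scale[OF linear_coord] a_def inner_vec_def mult.commute)
      finally show ?thesis .
    qed
    moreover have "a \<noteq> 0 \<or> (1::real) \<noteq> 0" by simp
    ultimately show ?thesis using negligible_hyperplane[of a 1] by simp
  qed
  then have "negligible (\<Union>i. {y. coord y $ i = 1})" by (intro negligible_Union) auto
  then have "(\<Union>i. {y. coord y $ i = 1}) \<in> null_sets lborel"
    by (simp add: negligible_iff_null_sets null_sets_completion_iff)
  then show ?thesis
    by (rule AE_I') (auto simp: cell_eq cell0_def less_le)
qed

definition cell_vol :: real where "cell_vol = measure lborel cell0"

text \<open>
  The uniform distribution on the half-open cell, kept as a measure on all Borel sets of the space,
  so that periodic functions need not be restricted.
\<close>

definition \<mu> :: "(real^3) measure" where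
  "\<mu> = density lborel (\<lambda>y. ennreal (indicator cell0 y / cell_vol))"

text \<open>
  The translates of the half-open cell partition the space.
\<close>

lemma nn_integral_lattice_sum:
  assumes [measurable]: "F \<in> borel_measurable borel"
  shows "(\<integral>\<^sup>+y. F y \<partial>lborel) = (\<integral>\<^sup>+t. (\<integral>\<^sup>+y. F (y + t) * indicator cell0 y \<partial>lborel) \<partial>count_space \<Lambda>)"
proof -
  have one: "(\<integral>\<^sup>+t. indicator cell0 (y - t) \<partial>count_space \<Lambda>) = 1" for y
  proof -
    have "(\<integral>\<^sup>+t. indicator cell0 (y - t) \<partial>count_space \<Lambda>)
        = (\<integral>\<^sup>+t. indicator {floor_pt y} t \<partial>count_space \<Lambda>)"
      by (intro nn_integral_cong) (auto simp: indicator_def diff_in_cell0_iff)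
    also have "\<dots> = 1" by (subst nn_integral_indicator) auto
    finally show ?thesis .
  qed
  have "(\<integral>\<^sup>+y. F y \<partial>lborel) = (\<integral>\<^sup>+y. (\<integral>\<^sup>+t. F y * indicator cell0 (y - t) \<partial>count_space \<Lambda>) \<partial>lborel)"
    by (simp add: nn_integral_cmult one)
  also have "\<dots> = (\<integral>\<^sup>+t. (\<integral>\<^sup>+y. F y * indicator cell0 (y - t) \<partial>lborel) \<partial>count_space \<Lambda>)"
    by (intro nn_integral_count_space_nn_integral countable_lattice) measurable
  also have "\<dots> = (\<integral>\<^sup>+t. (\<integral>\<^sup>+y. F (y + t) * indicator cell0 y \<partial>lborel) \<partial>count_space \<Lambda>)"
  proof (rule nn_integral_cong)
    fix t
    have "(\<integral>\<^sup>+y. F y * indicator cell0 (y - t) \<partial>lborel)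
        = (\<integral>\<^sup>+y. F y * indicator cell0 (y - t) \<partial>distr lborel borel ((+) t))"
      by (simp add: lborel_distr_plus)
    also have "\<dots> = (\<integral>\<^sup>+y. F (y + t) * indicator cell0 y \<partial>lborel)"
      by (subst nn_integral_distr) (auto simp: add.commute)
    finally show "(\<integral>\<^sup>+y. F y * indicator cell0 (y - t) \<partial>lborel)
        = (\<integral>\<^sup>+y. F (y + t) * indicator cell0 y \<partial>lborel)" .
  qed
  finally show ?thesis .
qed

lemma emeasure_cell0: "emeasure lborel cell0 = ennreal cell_vol" and cell_vol_pos: "cell_vol > 0"
proof -
  obtain r where "cell g \<subseteq> cball 0 r" using cell_subset_cball by blast
  then have "bounded cell0" using cell0_subset_cell bounded_cball bounded_subset by (metis subset_trans)
  then have fin: "emeasure lborel cell0 < \<infinity>" by (rule emeasure_bounded_finite)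
  then show eq: "emeasure lborel cell0 = ennreal cell_vol"
    by (simp add: cell_vol_def emeasure_eq_ennreal_measure)
  have "emeasure lborel cell0 \<noteq> 0"
  proof
    assume 0: "emeasure lborel cell0 = 0"
    have "(\<integral>\<^sup>+y. 1 \<partial>(lborel :: (real^3) measure)) = 0"
      using 0 by (subst nn_integral_lattice_sum) auto
    then show False by simp
  qed
  with eq show "cell_vol > 0" by (simp add: ennreal_eq_0_iff)
qed

lemma sets_cell_measure [measurable_cong, simp]: "sets \<mu> = sets borel"
  by (simp add: \<mu>_def)

lemma space_cell_measure [simp]: "space \<mu> = UNIV"
  by (simp add: \<mu>_def)

lemma nn_integral_cell_measure:
  assumes [measurable]: "F \<in> borel_measurable borel"
  shows "(\<integral>\<^sup>+y. F y \<partial>\<mu>) = ennreal (1 / cell_vol) * (\<integral>\<^sup>+y. F y * indicator cell0 y \<partial>lborel)"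
proof -
  have *: "ennreal (indicator cell0 y / cell_vol) * F y = ennreal (1 / cell_vol) * (F y * indicator cell0 y)" for y
    by (auto simp: indicator_def)
  show ?thesis
    unfolding \<mu>_def
    by (subst nn_integral_density) (simp_all add: * nn_integral_cmult)
qed

lemma nn_integral_cell0:
  assumes [measurable]: "F \<in> borel_measurable borel"
  shows "(\<integral>\<^sup>+y. F y * indicator cell0 y \<partial>lborel) = ennreal cell_vol * (\<integral>\<^sup>+y. F y \<partial>\<mu>)"
  using cell_vol_pos
  by (simp add: nn_integral_cell_measure mult.assoc[symmetric] ennreal_mult[symmetric])

lemma AE_cell_measure: "(AE y in \<mu>. P y) \<longleftrightarrow> (AE y in lborel. y \<in> cell0 \<longrightarrow> P y)"
  using cell_vol_pos unfolding \<mu>_def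
  by (subst AE_density) (auto simp: indicator_def divide_simps intro!: AE_cong)

lemma prob_space_cell_measure: "prob_space \<mu>"
proof
  have "emeasure \<mu> (space \<mu>) = (\<integral>\<^sup>+y. 1 \<partial>\<mu>)" by simp
  also have "\<dots> = 1"
    using cell_vol_pos
    by (subst nn_integral_cell_measure) (simp_all add: emeasure_cell0 ennreal_mult[symmetric])
  finally show "emeasure \<mu> (space \<mu>) = 1" .
qed

sublocale cell: prob_space \<mu> by (rule prob_space_cell_measure)

lemma cell_measure_UNIV [simp]: "measure \<mu> UNIV = 1"
  using cell.prob_space by simp

section \<open>Exactly periodic functions\<close>

text \<open>
  Pointwise, in contrast to \<open>periodic\<close>, which allows an exceptional null set for each translation.
\<close>

definition per :: "(real^3 \<Rightarrow> 'a) \<Rightarrow> bool" where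
  "per f \<longleftrightarrow> (\<forall>t\<in>\<Lambda>. \<forall>y. f (y + t) = f y)"

lemma perD: "per f \<Longrightarrow> t \<in> \<Lambda> \<Longrightarrow> f (y + t) = f y"
  by (simp add: per_def)

lemma per_wrap: "per f \<Longrightarrow> f (wrap y) = f y"
  using perD[of f "- floor_pt y" y] by (simp add: wrap_def)

text \<open>
  The translated cell is cut along the lattice translates of the original one and reassembled.
\<close>

lemma nn_integral_cell_translation:
  assumes [measurable]: "F \<in> borel_measurable borel" and F: "per F"
  shows "(\<integral>\<^sup>+y. F (y + z) \<partial>\<mu>) = (\<integral>\<^sup>+y. F y \<partial>\<mu>)"
proof -
  have one: "(\<integral>\<^sup>+t. indicator cell0 (y - z + t) \<partial>count_space \<Lambda>) = 1" for y
  proof -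
    have "(\<integral>\<^sup>+t. indicator cell0 (y - z + t) \<partial>count_space \<Lambda>)
        = (\<integral>\<^sup>+t. indicator {- floor_pt (y - z)} t \<partial>count_space \<Lambda>)"
    proof (rule nn_integral_cong)
      fix t assume "t \<in> space (count_space \<Lambda>)"
      then have "y - z + t \<in> cell0 \<longleftrightarrow> - t = floor_pt (y - z)"
        using diff_in_cell0_iff[of "- t" "y - z"] by simp
      also have "\<dots> \<longleftrightarrow> t = - floor_pt (y - z)" by (metis minus_minus)
      finally show "indicator cell0 (y - z + t) = (indicator {- floor_pt (y - z)} t :: ennreal)"
        by (simp add: indicator_def)
    qed
    also have "\<dots> = 1" by (subst nn_integral_indicator) auto
    finally show ?thesis .
  qed
  have "(\<integral>\<^sup>+y. F (y + z) * indicator cell0 y \<partial>lborel)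
      = (\<integral>\<^sup>+y. F y * indicator cell0 (y - z) \<partial>distr lborel borel ((+) z))"
    by (subst nn_integral_distr) (auto simp: add.commute)
  also have "\<dots> = (\<integral>\<^sup>+y. F y * indicator cell0 (y - z) \<partial>lborel)"
    by (simp add: lborel_distr_plus)
  also have "\<dots> = (\<integral>\<^sup>+t. (\<integral>\<^sup>+y. F (y + t) * indicator cell0 (y + t - z) * indicator cell0 y \<partial>lborel) \<partial>count_space \<Lambda>)"
    by (subst nn_integral_lattice_sum) auto
  also have "\<dots> = (\<integral>\<^sup>+t. (\<integral>\<^sup>+y. F y * indicator cell0 y * indicator cell0 (y - z + t) \<partial>lborel) \<partial>count_space \<Lambda>)"
    by (intro nn_integral_cong) (simp add: perD[OF F] diff_add_eq mult_ac)
  also have "\<dots> = (\<integral>\<^sup>+y. (\<integral>\<^sup>+t. F y * indicator cell0 y * indicator cell0 (y - z + t) \<partial>count_space \<Lambda>) \<partial>lborel)"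
    by (intro nn_integral_count_space_nn_integral[symmetric] countable_lattice) measurable
  also have "\<dots> = (\<integral>\<^sup>+y. F y * indicator cell0 y \<partial>lborel)"
    by (simp add: nn_integral_cmult one)
  finally show ?thesis by (simp add: nn_integral_cell_measure)
qed

text \<open>
  Translation modulo the lattice preserves \<open>\<mu>\<close>. This form transfers the invariance from nonnegative
  to Bochner integrals.
\<close>

lemma distr_cell_translation: "distr \<mu> borel (\<lambda>y. wrap (y + z)) = \<mu>"
proof (rule measure_eqI)
  fix A assume "A \<in> sets (distr \<mu> borel (\<lambda>y. wrap (y + z)))"
  then have [measurable]: "A \<in> sets borel" by simp
  have "emeasure (distr \<mu> borel (\<lambda>y. wrap (y + z))) A
      = (\<integral>\<^sup>+y. indicator A y \<partial>distr \<mu> borel (\<lambda>y. wrap (y + z)))"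
    by simp
  also have "\<dots> = (\<integral>\<^sup>+y. indicator A (wrap (y + z)) \<partial>\<mu>)"
    by (subst nn_integral_distr) auto
  also have "\<dots> = (\<integral>\<^sup>+y. indicator A (wrap y) \<partial>\<mu>)"
    by (rule nn_integral_cell_translation[of "\<lambda>y. indicator A (wrap y)"]) (auto simp: per_def)
  also have "\<dots> = (\<integral>\<^sup>+y. indicator A y \<partial>\<mu>)"
    by (rule nn_integral_cong_AE) (auto simp: AE_cell_measure wrap_eq)
  also have "\<dots> = emeasure \<mu> A" by simp
  finally show "emeasure (distr \<mu> borel (\<lambda>y. wrap (y + z))) A = emeasure \<mu> A" .
qed simp

lemma integral_cell_translation:
  fixes f :: "real^3 \<Rightarrow> 'b::{banach, second_countable_topology}"
  assumes [measurable]: "f \<in> borel_measurable borel" and f: "per f"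
  shows "(LINT y|\<mu>. f (y + z)) = (LINT y|\<mu>. f y)" (is ?int)
    and "integrable \<mu> (\<lambda>y. f (y + z)) \<longleftrightarrow> integrable \<mu> f" (is ?able)
proof -
  have "(LINT y|\<mu>. f y) = (LINT y|distr \<mu> borel (\<lambda>y. wrap (y + z)). f y)"
    by (simp add: distr_cell_translation)
  also have "\<dots> = (LINT y|\<mu>. f (y + z))"
    by (subst integral_distr) (auto simp: per_wrap[OF f])
  finally show ?int ..
  have "integrable \<mu> f \<longleftrightarrow> integrable (distr \<mu> borel (\<lambda>y. wrap (y + z))) f"
    by (simp add: distr_cell_translation)
  also have "\<dots> \<longleftrightarrow> integrable \<mu> (\<lambda>y. f (y + z))"
    by (subst integrable_distr_eq) (auto simp: per_wrap[OF f])
  finally show ?able ..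
qed

end

section \<open>Square-integrable functions\<close>

definition sq_int :: "'a measure \<Rightarrow> ('a \<Rightarrow> 'b::euclidean_space) \<Rightarrow> bool" where
  "sq_int M f \<longleftrightarrow> f \<in> borel_measurable M \<and> integrable M (\<lambda>x. (norm (f x))\<^sup>2)"

lemma sq_int_measurable [measurable_dest]: "sq_int M f \<Longrightarrow> f \<in> borel_measurable M"
  by (simp add: sq_int_def)

lemma sq_int_integrable_power2: "sq_int M f \<Longrightarrow> integrable M (\<lambda>x. (norm (f x))\<^sup>2)"
  by (simp add: sq_int_def)

lemma two_mult_norm_le: "2 * (norm a * norm b) \<le> (norm a)\<^sup>2 + (norm b)\<^sup>2"
  using zero_le_power2[of "norm a - norm b"] by (simp add: power2_diff)

lemma sq_int_dominated:
  assumes f: "sq_int M f" and [measurable]: "h \<in> borel_measurable M"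
    and le: "\<And>x. norm (h x) \<le> c * norm (f x)"
  shows "sq_int M h"
  unfolding sq_int_def
proof
  show "integrable M (\<lambda>x. (norm (h x))\<^sup>2)"
  proof (rule Bochner_Integration.integrable_bound)
    show "integrable M (\<lambda>x. c\<^sup>2 * (norm (f x))\<^sup>2)"
      using f by (simp add: sq_int_def)
    show "AE x in M. norm ((norm (h x))\<^sup>2) \<le> norm (c\<^sup>2 * (norm (f x))\<^sup>2)"
      using power_mono[OF le, where n=2] by (simp add: power_mult_distrib)
  qed measurable
qed fact

lemma sq_int_add:
  assumes f: "sq_int M f" and h: "sq_int M h"
  shows "sq_int M (\<lambda>x. f x + h x)"
  unfolding sq_int_def
proof
  note [measurable] = sq_int_measurable[OF f] sq_int_measurable[OF h]
  show "(\<lambda>x. f x + h x) \<in> borel_measurable M" by measurable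
  show "integrable M (\<lambda>x. (norm (f x + h x))\<^sup>2)"
  proof (rule Bochner_Integration.integrable_bound)
    show "integrable M (\<lambda>x. 2 * ((norm (f x))\<^sup>2 + (norm (h x))\<^sup>2))"
      using f h by (simp add: sq_int_def)
    show "AE x in M. norm ((norm (f x + h x))\<^sup>2) \<le> norm (2 * ((norm (f x))\<^sup>2 + (norm (h x))\<^sup>2))"
    proof (rule AE_I2)
      fix x
      have "(norm (f x + h x))\<^sup>2 \<le> (norm (f x) + norm (h x))\<^sup>2"
        by (intro power_mono norm_triangle_ineq) simp
      also have "\<dots> \<le> 2 * ((norm (f x))\<^sup>2 + (norm (h x))\<^sup>2)"
        using two_mult_norm_le[of "f x" "h x"] by (simp add: power2_sum)
      finally show "norm ((norm (f x + h x))\<^sup>2) \<le> norm (2 * ((norm (f x))\<^sup>2 + (norm (h x))\<^sup>2))"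
        by simp
    qed
  qed measurable
qed

lemma sq_int_bounded_linear:
  assumes l: "bounded_linear l" and f: "sq_int M f"
  shows "sq_int M (\<lambda>x. l (f x))"
proof (rule sq_int_dominated[OF f])
  show "(\<lambda>x. l (f x)) \<in> borel_measurable M"
    by (rule borel_measurable_continuous_on[OF linear_continuous_on[OF l] sq_int_measurable[OF f]])
  show "norm (l (f x)) \<le> onorm l * norm (f x)" for x by (rule onorm[OF l])
qed

lemma sq_int_scaleR: "sq_int M f \<Longrightarrow> sq_int M (\<lambda>x. c *\<^sub>R f x)"
  by (rule sq_int_bounded_linear[OF bounded_linear_scaleR_right])

lemma sq_int_diff: "sq_int M f \<Longrightarrow> sq_int M h \<Longrightarrow> sq_int M (\<lambda>x. f x - h x)"
  using sq_int_add[of M f "\<lambda>x. (-1) *\<^sub>R h x"] sq_int_scaleR[of M h "-1"] by simp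

lemma sq_int_nth: "sq_int M f \<Longrightarrow> sq_int M (\<lambda>x. f x $ i)"
  by (rule sq_int_bounded_linear[OF bounded_linear_vec_nth])

lemma norm_vec_power2:
  fixes v :: "('b::real_inner)^'n"
  shows "(norm v)\<^sup>2 = (\<Sum>i\<in>UNIV. (norm (v $ i))\<^sup>2)"
  by (simp add: power2_norm_eq_inner inner_vec_def)

lemma sq_int_vec:
  fixes f :: "'a \<Rightarrow> ('b::euclidean_space)^'n"
  assumes "\<And>i. sq_int M (\<lambda>x. f x $ i)"
  shows "sq_int M f"
proof -
  have [measurable]: "(\<lambda>x. f x $ i) \<in> borel_measurable M" for i by (rule sq_int_measurable[OF assms])
  have "f \<in> borel_measurable M"
  proof (rule borel_measurable_euclidean_space[THEN iffD2], rule ballI)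
    fix b :: "'b^'n" assume "b \<in> Basis"
    have "(\<lambda>x. f x \<bullet> b) = (\<lambda>x. \<Sum>i\<in>UNIV. f x $ i \<bullet> b $ i)" by (simp add: inner_vec_def)
    then show "(\<lambda>x. f x \<bullet> b) \<in> borel_measurable M" by simp
  qed
  then show ?thesis
    unfolding sq_int_def norm_vec_power2 using sq_int_integrable_power2[OF assms] by simp
qed

lemma sq_int_norm: "sq_int M f \<Longrightarrow> sq_int M (\<lambda>x. norm (f x))"
  by (rule sq_int_dominated[where c=1]) auto

lemma sq_int_inner:
  assumes f: "sq_int M f" and h: "sq_int M h"
  shows "integrable M (\<lambda>x. f x \<bullet> h x)"
proof (rule Bochner_Integration.integrable_bound)
  show "integrable M (\<lambda>x. (norm (f x))\<^sup>2 + (norm (h x))\<^sup>2)"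
    using f h by (simp add: sq_int_def)
  show "AE x in M. norm (f x \<bullet> h x) \<le> norm ((norm (f x))\<^sup>2 + (norm (h x))\<^sup>2)"
  proof (rule AE_I2)
    fix x
    have "\<bar>f x \<bullet> h x\<bar> \<le> norm (f x) * norm (h x)" by (rule Cauchy_Schwarz_ineq2)
    also have "\<dots> \<le> (norm (f x))\<^sup>2 + (norm (h x))\<^sup>2"
      using two_mult_norm_le[of "f x" "h x"] by (smt (verit) mult_nonneg_nonneg norm_ge_zero)
    finally show "norm (f x \<bullet> h x) \<le> norm ((norm (f x))\<^sup>2 + (norm (h x))\<^sup>2)" by simp
  qed
qed (use f h in \<open>auto intro!: borel_measurable_inner sq_int_measurable\<close>)

lemma sq_int_const: "finite_measure M \<Longrightarrow> sq_int M (\<lambda>x. c)"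
  by (simp add: sq_int_def finite_measure.integrable_const)

lemma sq_int_integrable:
  assumes M: "finite_measure M" and f: "sq_int M f"
  shows "integrable M f"
proof (rule Bochner_Integration.integrable_bound)
  show "integrable M (\<lambda>x. (norm (f x))\<^sup>2 + 1)"
    using f finite_measure.integrable_const[OF M]
    by (intro Bochner_Integration.integrable_add) (auto simp: sq_int_def)
  show "AE x in M. norm (f x) \<le> norm ((norm (f x))\<^sup>2 + 1)"
  proof (rule AE_I2)
    fix x show "norm (f x) \<le> norm ((norm (f x))\<^sup>2 + 1)"
      using two_mult_norm_le[of "f x" "1::real"] norm_ge_zero[of "f x"] by (simp, linarith)
  qed
qed (use f in \<open>simp add: sq_int_def\<close>)

lemma sq_int_bounded:
  assumes M: "finite_measure M" and [measurable]: "f \<in> borel_measurable M" and b: "\<And>x. norm (f x) \<le> B"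
  shows "sq_int M f"
  by (rule sq_int_dominated[OF sq_int_const[OF M, of "1::real"], where c=B]) (auto simp: b)

lemma integral_norm_power2_diff:
  assumes f: "sq_int M f" and h: "sq_int M h"
  shows "(LINT x|M. (norm (f x - h x))\<^sup>2)
    = (LINT x|M. (norm (f x))\<^sup>2) - 2 * (LINT x|M. f x \<bullet> h x) + (LINT x|M. (norm (h x))\<^sup>2)"
proof -
  have "(norm (f x - h x))\<^sup>2 = (norm (f x))\<^sup>2 - 2 * (f x \<bullet> h x) + (norm (h x))\<^sup>2" for x
    by (simp add: power2_norm_eq_inner inner_diff inner_commute)
  then show ?thesis
    using sq_int_inner[OF f h] sq_int_integrable_power2[OF f] sq_int_integrable_power2[OF h] by simp
qed

lemma Cauchy_Schwarz_integral:
  assumes f: "sq_int M f" and h: "sq_int M h"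
  shows "(LINT x|M. f x \<bullet> h x)\<^sup>2 \<le> (LINT x|M. (norm (f x))\<^sup>2) * (LINT x|M. (norm (h x))\<^sup>2)"
proof -
  define a b c where "a = (LINT x|M. (norm (f x))\<^sup>2)" "b = (LINT x|M. f x \<bullet> h x)" "c = (LINT x|M. (norm (h x))\<^sup>2)"
  have q: "a - 2 * t * b + t\<^sup>2 * c \<ge> 0" for t
  proof -
    have "0 \<le> (LINT x|M. (norm (f x - t *\<^sub>R h x))\<^sup>2)" by simp
    also have "\<dots> = a - 2 * t * b + t\<^sup>2 * c"
      unfolding integral_norm_power2_diff[OF f sq_int_scaleR[OF h]]
      by (simp add: a_b_c_def power_mult_distrib)
    finally show ?thesis .
  qed
  have "c \<ge> 0" by (simp add: a_b_c_def)
  have "b\<^sup>2 \<le> a * c"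
  proof (cases "c = 0")
    case True
    have "b = 0"
    proof (rule ccontr)
      assume "b \<noteq> 0"
      then show False using q[of "(a + 1) / (2 * b)"] True by simp
    qed
    then show ?thesis using True by simp
  next
    case False
    with \<open>c \<ge> 0\<close> have "c > 0" by simp
    then have "a - b\<^sup>2 / c \<ge> 0" using q[of "b / c"] by (simp add: power2_eq_square field_simps)
    with \<open>c > 0\<close> show ?thesis by (simp add: field_simps)
  qed
  then show ?thesis by (simp add: a_b_c_def)
qed

lemma integral_inner_tendsto:
  assumes f: "\<And>n. sq_int M (f n)" and F: "sq_int M F" and h: "sq_int M h"
    and lim: "(\<lambda>n. LINT x|M. (norm (f n x - F x))\<^sup>2) \<longlonglongrightarrow> 0"
  shows "(\<lambda>n. LINT x|M. f n x \<bullet> h x) \<longlonglongrightarrow> (LINT x|M. F x \<bullet> h x)"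
proof -
  have "(\<lambda>n. sqrt ((LINT x|M. (norm (f n x - F x))\<^sup>2) * (LINT x|M. (norm (h x))\<^sup>2))) \<longlonglongrightarrow> sqrt (0 * (LINT x|M. (norm (h x))\<^sup>2))"
    by (intro tendsto_intros lim)
  then have *: "(\<lambda>n. sqrt ((LINT x|M. (norm (f n x - F x))\<^sup>2) * (LINT x|M. (norm (h x))\<^sup>2))) \<longlonglongrightarrow> 0"
    by simp
  show ?thesis
  proof (rule Lim_null[THEN iffD2], rule Lim_null_comparison[OF _ *], rule always_eventually, intro allI)
    fix n
    have "(LINT x|M. f n x \<bullet> h x) - (LINT x|M. F x \<bullet> h x) = (LINT x|M. (f n x - F x) \<bullet> h x)"
      using sq_int_inner[OF f h] sq_int_inner[OF F h] by (simp add: inner_diff_left)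
    then show "norm ((LINT x|M. f n x \<bullet> h x) - (LINT x|M. F x \<bullet> h x))
        \<le> sqrt ((LINT x|M. (norm (f n x - F x))\<^sup>2) * (LINT x|M. (norm (h x))\<^sup>2))"
      using Cauchy_Schwarz_integral[OF sq_int_diff[OF f F] h] by (auto intro: real_le_rsqrt simp: real_le_rsqrt)
  qed
qed

lemma square_integral_le:
  fixes u :: "'a \<Rightarrow> real"
  assumes "prob_space M" and u: "sq_int M u"
  shows "(LINT x|M. u x)\<^sup>2 \<le> (LINT x|M. (u x)\<^sup>2)"
proof -
  interpret prob_space M by fact
  show ?thesis
    using Cauchy_Schwarz_integral[OF u sq_int_const[of M "1::real"]] finite_measure_axioms
    by (simp add: prob_space)
qed

text \<open>
  The Riesz--Fischer theorem. On a probability space \<open>L\<^sup>2\<close>-Cauchy implies \<open>L\<^sup>1\<close>-Cauchy, so a subsequence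
  converges almost everywhere, and Fatou's lemma upgrades this to convergence in \<open>L\<^sup>2\<close>. The limit is
  given explicitly as a pointwise \<open>lim\<close>, because it then inherits exact periodicity from the
  sequence, also at the points where the subsequence diverges.
\<close>

lemma L2_complete:
  fixes f :: "nat \<Rightarrow> 'a \<Rightarrow> 'b::euclidean_space"
  assumes M: "prob_space M" and f: "\<And>n. sq_int M (f n)"
    and cauchy: "\<And>\<epsilon>. \<epsilon> > 0 \<Longrightarrow> \<exists>N. \<forall>m\<ge>N. \<forall>n\<ge>N. (LINT x|M. (norm (f m x - f n x))\<^sup>2) < \<epsilon>"
  obtains r where "sq_int M (\<lambda>x. lim (\<lambda>n. f (r n) x))"
    "(\<lambda>n. LINT x|M. (norm (f n x - lim (\<lambda>k. f (r k) x)))\<^sup>2) \<longlonglongrightarrow> 0"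
proof -
  interpret prob_space M by fact
  note [measurable] = sq_int_measurable[OF f]
  have "\<exists>N. \<forall>i\<ge>N. \<forall>j\<ge>N. (LINT x|M. norm (f i x - f j x)) < \<epsilon>" if "\<epsilon> > 0" for \<epsilon>
  proof -
    obtain N where N: "\<forall>m\<ge>N. \<forall>n\<ge>N. (LINT x|M. (norm (f m x - f n x))\<^sup>2) < \<epsilon>\<^sup>2"
      using cauchy[of "\<epsilon>\<^sup>2"] \<open>\<epsilon> > 0\<close> by auto
    have "(LINT x|M. norm (f i x - f j x)) < \<epsilon>" if "i \<ge> N" "j \<ge> N" for i j
    proof -
      have "(LINT x|M. norm (f i x - f j x))\<^sup>2 \<le> (LINT x|M. (norm (f i x - f j x))\<^sup>2)"
        using square_integral_le[OF M sq_int_norm[OF sq_int_diff[OF f f]]] by simp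
      also have "\<dots> < \<epsilon>\<^sup>2" using N that by blast
      finally show ?thesis using \<open>\<epsilon> > 0\<close> by (simp add: power2_less_imp_less)
    qed
    then show ?thesis by blast
  qed
  then obtain r where r: "strict_mono r" "AE x in M. Cauchy (\<lambda>i. f (r i) x)"
    using cauchy_L1_AE_cauchy_subseq[of M f] sq_int_integrable[OF finite_measure_axioms f] by blast
  define F where "F x = lim (\<lambda>n. f (r n) x)" for x
  have [measurable]: "F \<in> borel_measurable M" unfolding F_def by measurable
  have conv: "AE x in M. (\<lambda>n. f (r n) x) \<longlonglongrightarrow> F x"
    using r(2) by eventually_elim (simp add: F_def Cauchy_convergent_iff convergent_LIMSEQ_iff)
  have fatou: "(\<integral>\<^sup>+x. ennreal ((norm (f n x - F x))\<^sup>2) \<partial>M) \<le> ennreal \<epsilon>"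
    if n: "n \<ge> N" and N: "\<forall>m\<ge>N. \<forall>n\<ge>N. (LINT x|M. (norm (f m x - f n x))\<^sup>2) < \<epsilon>" for n N \<epsilon>
  proof -
    have "(\<integral>\<^sup>+x. ennreal ((norm (f n x - F x))\<^sup>2) \<partial>M)
        = (\<integral>\<^sup>+x. liminf (\<lambda>k. ennreal ((norm (f n x - f (r k) x))\<^sup>2)) \<partial>M)"
    proof (rule nn_integral_cong_AE, use conv in eventually_elim)
      fix x assume "(\<lambda>k. f (r k) x) \<longlonglongrightarrow> F x"
      then have "(\<lambda>k. ennreal ((norm (f n x - f (r k) x))\<^sup>2)) \<longlonglongrightarrow> ennreal ((norm (f n x - F x))\<^sup>2)"
        by (intro tendsto_intros)
      then show "ennreal ((norm (f n x - F x))\<^sup>2) = liminf (\<lambda>k. ennreal ((norm (f n x - f (r k) x))\<^sup>2))"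
        by (rule lim_imp_Liminf[OF trivial_limit_sequentially, symmetric])
    qed
    also have "\<dots> \<le> liminf (\<lambda>k. \<integral>\<^sup>+x. ennreal ((norm (f n x - f (r k) x))\<^sup>2) \<partial>M)"
      by (intro nn_integral_liminf) measurable
    also have "\<dots> \<le> ennreal \<epsilon>"
    proof (rule order_trans[OF Liminf_le_Limsup Limsup_bounded])
      show "\<forall>\<^sub>F k in sequentially. (\<integral>\<^sup>+x. ennreal ((norm (f n x - f (r k) x))\<^sup>2) \<partial>M) \<le> ennreal \<epsilon>"
      proof (rule eventually_sequentiallyI[of N])
        fix k assume "k \<ge> N"
        then have "r k \<ge> N" using seq_suble[OF r(1), of k] by simp
        then have "(LINT x|M. (norm (f n x - f (r k) x))\<^sup>2) \<le> \<epsilon>" using N n by (simp add: less_imp_le)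
        then show "(\<integral>\<^sup>+x. ennreal ((norm (f n x - f (r k) x))\<^sup>2) \<partial>M) \<le> ennreal \<epsilon>"
          using sq_int_integrable_power2[OF sq_int_diff[OF f f]]
          by (subst nn_integral_eq_integral) (auto intro: ennreal_leI)
      qed
    qed simp
    finally show ?thesis .
  qed
  obtain N1 where N1: "\<forall>m\<ge>N1. \<forall>n\<ge>N1. (LINT x|M. (norm (f m x - f n x))\<^sup>2) < 1"
    using cauchy[of 1] by auto
  have "(\<integral>\<^sup>+x. ennreal ((norm (f N1 x - F x))\<^sup>2) \<partial>M) < \<infinity>"
    using fatou[OF order_refl N1] by (auto intro: le_less_trans)
  then have "sq_int M (\<lambda>x. f N1 x - F x)"
    by (simp add: sq_int_def integrable_iff_bounded)
  from sq_int_diff[OF f[of N1] this] have F: "sq_int M F" by simp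
  have "(\<lambda>n. LINT x|M. (norm (f n x - F x))\<^sup>2) \<longlonglongrightarrow> 0"
  proof (rule LIMSEQ_I)
    fix \<epsilon> :: real assume "\<epsilon> > 0"
    then obtain N where N: "\<forall>m\<ge>N. \<forall>n\<ge>N. (LINT x|M. (norm (f m x - f n x))\<^sup>2) < \<epsilon> / 2"
      using cauchy[of "\<epsilon> / 2"] by auto
    have "norm ((LINT x|M. (norm (f n x - F x))\<^sup>2) - 0) < \<epsilon>" if "n \<ge> N" for n
    proof -
      have "ennreal (LINT x|M. (norm (f n x - F x))\<^sup>2) = (\<integral>\<^sup>+x. ennreal ((norm (f n x - F x))\<^sup>2) \<partial>M)"
        using sq_int_integrable_power2[OF sq_int_diff[OF f F]] by (subst nn_integral_eq_integral) auto
      also have "\<dots> \<le> ennreal (\<epsilon> / 2)" by (rule fatou[OF that N])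
      finally have "(LINT x|M. (norm (f n x - F x))\<^sup>2) \<le> \<epsilon> / 2"
        using \<open>\<epsilon> > 0\<close> by (simp add: ennreal_le_iff)
      then show ?thesis using \<open>\<epsilon> > 0\<close> by simp
    qed
    then show "\<exists>N. \<forall>n\<ge>N. norm ((LINT x|M. (norm (f n x - F x))\<^sup>2) - 0) < \<epsilon>" by blast
  qed
  with F that show ?thesis unfolding F_def by blast
qed

section \<open>Integrals over the space as integrals over the cell\<close>

context period_lattice
begin

lemma finite_lattice_near_cell:
  obtains T where "finite T" "T \<subseteq> \<Lambda>" "\<And>t y. t \<in> \<Lambda> \<Longrightarrow> y \<in> cell0 \<Longrightarrow> norm (y + t) \<le> R \<Longrightarrow> t \<in> T"
proof -
  obtain r where r: "cell g \<subseteq> cball 0 r" using cell_subset_cball by blast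
  have "t \<in> {t \<in> \<Lambda>. norm t \<le> R + r}" if "t \<in> \<Lambda>" "y \<in> cell0" "norm (y + t) \<le> R" for t y
  proof -
    have "norm y \<le> r" using that(2) cell0_subset_cell r by (auto simp: subset_iff)
    moreover have "norm t \<le> norm (y + t) + norm y" by (metis add_diff_cancel_left' norm_triangle_ineq4)
    ultimately show ?thesis using that by simp
  qed
  then show ?thesis by (intro that[of "{t \<in> \<Lambda>. norm t \<le> R + r}"]) (auto intro: finite_lattice_bounded)
qed

text \<open>
  Only finitely many cells meet a bounded set, so the sum over the lattice becomes a finite one.
\<close>

lemma nn_integral_unfold:
  assumes [measurable]: "F \<in> borel_measurable borel" and R: "\<And>y. norm y > R \<Longrightarrow> F y = 0"
    and T: "finite T" "T \<subseteq> \<Lambda>" "\<And>t y. t \<in> \<Lambda> \<Longrightarrow> y \<in> cell0 \<Longrightarrow> norm (y + t) \<le> R \<Longrightarrow> t \<in> T"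
  shows "(\<integral>\<^sup>+y. F y \<partial>lborel) = ennreal cell_vol * (\<Sum>t\<in>T. \<integral>\<^sup>+y. F (y + t) \<partial>\<mu>)"
proof -
  have z: "(\<integral>\<^sup>+y. F (y + t) * indicator cell0 y \<partial>lborel) = 0" if "t \<in> \<Lambda>" "t \<notin> T" for t
  proof -
    have "F (y + t) * indicator cell0 y = 0" for y :: "real^3"
      using T(3)[OF that(1), of y] that(2) R[of "y + t"] by (cases "y \<in> cell0"; cases "norm (y + t) \<le> R") auto
    then show ?thesis by (simp only:) simp
  qed
  have "(\<integral>\<^sup>+y. F y \<partial>lborel) = (\<Sum>t\<in>T. \<integral>\<^sup>+y. F (y + t) * indicator cell0 y \<partial>lborel)"
    unfolding nn_integral_lattice_sum[OF assms(1)]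
    by (rule nn_integral_count_space') (use T z in auto)
  also have "\<dots> = (\<Sum>t\<in>T. ennreal cell_vol * (\<integral>\<^sup>+y. F (y + t) \<partial>\<mu>))"
    by (intro sum.cong refl nn_integral_cell0) measurable
  finally show ?thesis by (simp add: sum_distrib_left)
qed

lemma integral_cell_measure:
  fixes f :: "real^3 \<Rightarrow> 'b::{banach, second_countable_topology}"
  assumes [measurable]: "f \<in> borel_measurable borel"
  shows "(LINT y|\<mu>. f y) = (1 / cell_vol) *\<^sub>R (LINT y|lborel. indicator cell0 y *\<^sub>R f y)"
    and "integrable \<mu> f \<longleftrightarrow> integrable lborel (\<lambda>y. indicator cell0 y *\<^sub>R f y)"
proof -
  have eq: "(indicator cell0 y / cell_vol) *\<^sub>R f y = (1 / cell_vol) *\<^sub>R (indicator cell0 y *\<^sub>R f y)" for y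
    by simp
  show "(LINT y|\<mu>. f y) = (1 / cell_vol) *\<^sub>R (LINT y|lborel. indicator cell0 y *\<^sub>R f y)"
    unfolding \<mu>_def using cell_vol_pos
    by (subst integral_density) (simp_all only: eq integral_scaleR_right, simp_all add: less_imp_le)
  have "integrable \<mu> f
      \<longleftrightarrow> integrable lborel (\<lambda>y. (indicator cell0 y / cell_vol) *\<^sub>R f y)"
    unfolding \<mu>_def using cell_vol_pos by (subst integrable_density) (simp_all add: less_imp_le)
  also have "\<dots> \<longleftrightarrow> integrable lborel (\<lambda>y. indicator cell0 y *\<^sub>R f y)"
  proof
    assume "integrable lborel (\<lambda>y. (indicator cell0 y / cell_vol) *\<^sub>R f y)"
    then have "integrable lborel (\<lambda>y. cell_vol *\<^sub>R ((indicator cell0 y / cell_vol) *\<^sub>R f y))"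
      by (rule integrable_scaleR_right)
    then show "integrable lborel (\<lambda>y. indicator cell0 y *\<^sub>R f y)" using cell_vol_pos by simp
  next
    assume "integrable lborel (\<lambda>y. indicator cell0 y *\<^sub>R f y)"
    then have "integrable lborel (\<lambda>y. (1 / cell_vol) *\<^sub>R (indicator cell0 y *\<^sub>R f y))"
      by (rule integrable_scaleR_right)
    then show "integrable lborel (\<lambda>y. (indicator cell0 y / cell_vol) *\<^sub>R f y)" by simp
  qed
  finally show "integrable \<mu> f \<longleftrightarrow> integrable lborel (\<lambda>y. indicator cell0 y *\<^sub>R f y)" .
qed

lemma integrable_unfold:
  fixes F :: "real^3 \<Rightarrow> 'b::{banach, second_countable_topology}"
  assumes [measurable]: "F \<in> borel_measurable borel" and R: "\<And>y. norm y > R \<Longrightarrow> F y = 0"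
    and int: "\<And>t. t \<in> \<Lambda> \<Longrightarrow> integrable \<mu> (\<lambda>y. F (y + t))"
  shows "integrable lborel F"
proof (rule integrableI_bounded)
  obtain T where T: "finite T" "T \<subseteq> \<Lambda>" "\<And>t y. t \<in> \<Lambda> \<Longrightarrow> y \<in> cell0 \<Longrightarrow> norm (y + t) \<le> R \<Longrightarrow> t \<in> T"
    using finite_lattice_near_cell by blast
  have "(\<integral>\<^sup>+y. ennreal (norm (F y)) \<partial>lborel) = ennreal cell_vol * (\<Sum>t\<in>T. \<integral>\<^sup>+y. ennreal (norm (F (y + t))) \<partial>\<mu>)"
    by (rule nn_integral_unfold[OF _ _ T]) (auto simp: R)
  also have "\<dots> < \<infinity>"
  proof -
    have "(\<Sum>t\<in>T. \<integral>\<^sup>+y. ennreal (norm (F (y + t))) \<partial>\<mu>) < top"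
      using int T(2) by (subst ennreal_sum_less_top[OF T(1)]) (auto simp: integrable_iff_bounded)
    then show ?thesis by (simp add: ennreal_mult_less_top)
  qed
  finally show "(\<integral>\<^sup>+y. ennreal (norm (F y)) \<partial>lborel) < \<infinity>" .
qed measurable

lemma integral_unfold:
  fixes F :: "real^3 \<Rightarrow> 'b::{banach, second_countable_topology}"
  assumes [measurable]: "F \<in> borel_measurable borel" and R: "\<And>y. norm y > R \<Longrightarrow> F y = 0"
    and T: "finite T" "T \<subseteq> \<Lambda>" "\<And>t y. t \<in> \<Lambda> \<Longrightarrow> y \<in> cell0 \<Longrightarrow> norm (y + t) \<le> R \<Longrightarrow> t \<in> T"
    and int: "integrable lborel F"
  shows "(LINT y|lborel. F y) = cell_vol *\<^sub>R (\<Sum>t\<in>T. LINT y|\<mu>. F (y + t))"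
proof -
  have eq: "F y = (\<Sum>t\<in>T. indicator cell0 (y - t) *\<^sub>R F y)" for y
  proof (cases "floor_pt y \<in> T")
    case True
    have "(\<Sum>t\<in>T. indicator cell0 (y - t) *\<^sub>R F y) = (\<Sum>t\<in>T. if t = floor_pt y then F y else 0)"
      using T(2) by (intro sum.cong) (auto simp: indicator_def diff_in_cell0_iff)
    with True T(1) show ?thesis by simp
  next
    case False
    have "norm y > R"
    proof (rule ccontr)
      assume "\<not> norm y > R"
      with T(3)[OF floor_pt_lattice wrap_in_cell0[of y], of y] False show False by (simp add: wrap_def)
    qed
    then show ?thesis using R by simp
  qed
  have "(LINT y|lborel. F y) = (\<Sum>t\<in>T. LINT y|lborel. indicator cell0 (y - t) *\<^sub>R F y)"
  proof (subst eq, rule Bochner_Integration.integral_sum)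
    show "integrable lborel (\<lambda>y. indicator cell0 (y - t) *\<^sub>R F y)" for t
      by (rule Bochner_Integration.integrable_bound[OF int]) (auto simp: indicator_def)
  qed
  also have "\<dots> = (\<Sum>t\<in>T. cell_vol *\<^sub>R (LINT y|\<mu>. F (y + t)))"
  proof (rule sum.cong)
    fix t
    have "(LINT y|lborel. indicator cell0 (y - t) *\<^sub>R F y) = (LINT y|lborel. indicator cell0 y *\<^sub>R F (y + t))"
      using lborel_integral_translation[of "\<lambda>y. indicator cell0 (y - t) *\<^sub>R F y" t] by simp
    then show "(LINT y|lborel. indicator cell0 (y - t) *\<^sub>R F y) = cell_vol *\<^sub>R (LINT y|\<mu>. F (y + t))"
      using cell_vol_pos by (simp add: integral_cell_measure)
  qed simp
  finally show ?thesis by (simp add: scaleR_sum_right)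
qed

text \<open>
  The sum of all lattice translates. The index set is restricted to the translates that do not vanish
  at \<open>y\<close>, since a sum over an infinite set would be 0.
\<close>

definition periodization :: "(real^3 \<Rightarrow> real) \<Rightarrow> real^3 \<Rightarrow> real" where
  "periodization \<psi> y = (\<Sum>t | t \<in> \<Lambda> \<and> \<psi> (y + t) \<noteq> 0. \<psi> (y + t))"

lemma periodization_eq:
  assumes "finite T" "T \<subseteq> \<Lambda>" "\<And>t. t \<in> \<Lambda> \<Longrightarrow> \<psi> (y + t) \<noteq> 0 \<Longrightarrow> t \<in> T"
  shows "periodization \<psi> y = (\<Sum>t\<in>T. \<psi> (y + t))"
  unfolding periodization_def using assms by (intro sum.mono_neutral_left) auto

lemma per_periodization: "per (periodization \<psi>)"
  unfolding per_def periodization_def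
proof (intro ballI allI)
  fix s y assume s: "s \<in> \<Lambda>"
  show "(\<Sum>t | t \<in> \<Lambda> \<and> \<psi> (y + s + t) \<noteq> 0. \<psi> (y + s + t)) = (\<Sum>t | t \<in> \<Lambda> \<and> \<psi> (y + t) \<noteq> 0. \<psi> (y + t))"
  proof (rule sum.reindex_bij_witness[of _ "\<lambda>t. t - s" "\<lambda>t. s + t"])
    fix t assume "t \<in> {t \<in> \<Lambda>. \<psi> (y + t) \<noteq> 0}"
    then show "t - s \<in> {t \<in> \<Lambda>. \<psi> (y + s + t) \<noteq> 0}"
      using lattice_add[of t "- s"] s by simp
  qed (use s in \<open>auto simp: add.assoc intro: lattice_add\<close>)
qed

text \<open>
  On each unit ball the periodization is one fixed finite sum; continuity and derivatives are read
  off from it.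
\<close>

lemma periodization_local:
  assumes R: "\<And>y. norm y > R \<Longrightarrow> \<psi> y = 0"
  defines "T y0 \<equiv> {t \<in> \<Lambda>. norm t \<le> R + norm y0 + 1}"
  shows "finite (T y0)" and "dist y y0 < 1 \<Longrightarrow> periodization \<psi> y = (\<Sum>t\<in>T y0. \<psi> (y + t))"
proof -
  show fin: "finite (T y0)" unfolding T_def by (rule finite_lattice_bounded)
  assume d: "dist y y0 < 1"
  show "periodization \<psi> y = (\<Sum>t\<in>T y0. \<psi> (y + t))"
  proof (rule periodization_eq[OF fin])
    fix t assume t: "t \<in> \<Lambda>" "\<psi> (y + t) \<noteq> 0"
    then have "norm (y + t) \<le> R" using R[of "y + t"] by force
    moreover have "norm t \<le> norm (y + t) + norm y" by (metis add_diff_cancel_left' norm_triangle_ineq4)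
    moreover have "norm y \<le> norm y0 + 1" using d norm_triangle_sub[of y y0] by (simp add: dist_norm)
    ultimately show "t \<in> T y0" using t by (simp add: T_def)
  qed (simp add: T_def)
qed

lemma continuous_periodization:
  assumes R: "\<And>y. norm y > R \<Longrightarrow> \<psi> y = 0" and cont: "continuous_on UNIV \<psi>"
  shows "continuous_on UNIV (periodization \<psi>)"
proof (rule continuous_at_imp_continuous_on, rule ballI)
  fix y0 :: "real^3"
  let ?T = "{t \<in> \<Lambda>. norm t \<le> R + norm y0 + 1}"
  have "continuous_on UNIV (\<lambda>y. \<Sum>t\<in>?T. \<psi> (y + t))"
    by (auto intro!: continuous_on_sum continuous_on_compose2[OF cont] continuous_intros)
  then have c: "isCont (\<lambda>y. \<Sum>t\<in>?T. \<psi> (y + t)) y0"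
    by (simp add: continuous_on_eq_continuous_at)
  have "\<forall>\<^sub>F y in nhds y0. periodization \<psi> y = (\<Sum>t\<in>?T. \<psi> (y + t))"
    using periodization_local(2)[OF R] unfolding eventually_nhds_metric by (intro exI[of _ 1]) auto
  from isCont_cong[OF this] c show "isCont (periodization \<psi>) y0" by simp
qed

lemma periodization_has_derivative:
  assumes \<psi>: "\<psi> \<in> test_functions"
  shows "(periodization \<psi> has_derivative (\<lambda>h. (\<chi> j. periodization (partial j \<psi>) y) \<bullet> h)) (at y)"
proof -
  obtain R where R: "\<And>x. norm x > R \<Longrightarrow> \<psi> x = 0" "\<And>x j. norm x > R \<Longrightarrow> partial j \<psi> x = 0"
    using test_function_support[OF \<psi>] by metis
  define T where "T = {t \<in> \<Lambda>. norm t \<le> R + norm y + 1}"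
  have d: "((\<lambda>y. \<psi> (y + t)) has_derivative (\<lambda>h. \<Sum>j\<in>UNIV. h $ j * partial j \<psi> (y + t))) (at y)" for t
  proof -
    have "((\<lambda>y. y + t) has_derivative (\<lambda>h. h)) (at y)" by (auto intro!: derivative_eq_intros)
    from has_derivative_compose[OF this has_derivative_partial[OF test_function_differentiable[OF \<psi>]]]
    show ?thesis by simp
  qed
  have "((\<lambda>y. \<Sum>t\<in>T. \<psi> (y + t)) has_derivative
      (\<lambda>h. \<Sum>t\<in>T. \<Sum>j\<in>UNIV. h $ j * partial j \<psi> (y + t))) (at y)"
    by (intro has_derivative_sum d)
  also have "(\<lambda>h. \<Sum>t\<in>T. \<Sum>j\<in>UNIV. h $ j * partial j \<psi> (y + t))
      = (\<lambda>h. (\<chi> j. periodization (partial j \<psi>) y) \<bullet> h)"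
  proof
    fix h :: "real^3"
    have "(\<Sum>t\<in>T. \<Sum>j\<in>UNIV. h $ j * partial j \<psi> (y + t)) = (\<Sum>j\<in>UNIV. h $ j * (\<Sum>t\<in>T. partial j \<psi> (y + t)))"
      by (subst sum.swap) (simp add: sum_distrib_left)
    also have "\<dots> = (\<Sum>j\<in>UNIV. h $ j * periodization (partial j \<psi>) y)"
      using periodization_local(2)[of R "partial j \<psi>" y y for j] R(2) by (simp add: T_def)
    finally show "(\<Sum>t\<in>T. \<Sum>j\<in>UNIV. h $ j * partial j \<psi> (y + t)) = (\<chi> j. periodization (partial j \<psi>) y) \<bullet> h"
      by (simp add: inner_vec_def mult.commute)
  qed
  finally show ?thesis
  proof (rule has_derivative_transform_within[where d=1])
    show "dist y' y < 1 \<Longrightarrow> (\<Sum>t\<in>T. \<psi> (y' + t)) = periodization \<psi> y'" for y'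
      using periodization_local(2)[of R \<psi> y' y] R(1) by (simp add: T_def)
  qed auto
qed

text \<open>
  The link between the integrals over the space in the definition of weak derivatives and divergences
  and the integrals over the cell.
\<close>

lemma per_integral_unfold:
  fixes f :: "real^3 \<Rightarrow> 'b::{banach, second_countable_topology}"
  assumes [measurable]: "f \<in> borel_measurable borel" and f: "per f" "integrable \<mu> f"
    and \<psi>: "continuous_on UNIV \<psi>" and R: "\<And>y. norm y > R \<Longrightarrow> \<psi> y = 0"
  shows "integrable lborel (\<lambda>y. \<psi> y *\<^sub>R f y)"
    and "(LINT y|lborel. \<psi> y *\<^sub>R f y) = cell_vol *\<^sub>R (LINT y|\<mu>. periodization \<psi> y *\<^sub>R f y)"
proof -
  have [measurable]: "\<psi> \<in> borel_measurable borel" using \<psi> by (rule borel_measurable_continuous_onI)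
  obtain B where B: "\<And>y. norm (\<psi> y) \<le> B" using continuous_bounded_support_bound[OF \<psi> R] by metis
  have int: "integrable \<mu> (\<lambda>y. \<psi> (y + t) *\<^sub>R f y)" for t
  proof (rule Bochner_Integration.integrable_bound)
    show "integrable \<mu> (\<lambda>y. B *\<^sub>R f y)" using f(2) by simp
    have "norm (\<psi> (y + t)) * norm (f y) \<le> \<bar>B\<bar> * norm (f y)" for y
      using B[of "y + t"] by (intro mult_right_mono) auto
    then show "AE y in \<mu>. norm (\<psi> (y + t) *\<^sub>R f y) \<le> norm (B *\<^sub>R f y)"
      by simp
  qed measurable
  show i: "integrable lborel (\<lambda>y. \<psi> y *\<^sub>R f y)"
    by (rule integrable_unfold[where R=R]) (auto simp: R perD[OF f(1)] int)
  obtain T where T: "finite T" "T \<subseteq> \<Lambda>" "\<And>t y. t \<in> \<Lambda> \<Longrightarrow> y \<in> cell0 \<Longrightarrow> norm (y + t) \<le> R \<Longrightarrow> t \<in> T"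
    using finite_lattice_near_cell by blast
  have "(LINT y|lborel. \<psi> y *\<^sub>R f y) = cell_vol *\<^sub>R (\<Sum>t\<in>T. LINT y|\<mu>. \<psi> (y + t) *\<^sub>R f (y + t))"
    by (rule integral_unfold[OF _ _ T i]) (auto simp: R)
  also have "(\<Sum>t\<in>T. LINT y|\<mu>. \<psi> (y + t) *\<^sub>R f (y + t)) = (\<Sum>t\<in>T. LINT y|\<mu>. \<psi> (y + t) *\<^sub>R f y)"
    using T(2) by (intro sum.cong) (auto simp: perD[OF f(1)])
  also have "\<dots> = (LINT y|\<mu>. (\<Sum>t\<in>T. \<psi> (y + t) *\<^sub>R f y))"
    by (rule Bochner_Integration.integral_sum[symmetric]) (rule int)
  also have "\<dots> = (LINT y|\<mu>. periodization \<psi> y *\<^sub>R f y)"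
  proof (rule integral_cong_AE)
    have [measurable]: "periodization \<psi> \<in> borel_measurable borel"
      by (rule borel_measurable_continuous_onI[OF continuous_periodization[OF R \<psi>]])
    show "(\<lambda>y. periodization \<psi> y *\<^sub>R f y) \<in> borel_measurable \<mu>" by measurable
    have "periodization \<psi> y = (\<Sum>t\<in>T. \<psi> (y + t))" if "y \<in> cell0" for y
      using T(3)[OF _ that] R by (intro periodization_eq T(1,2)) (metis not_le)
    then show "AE y in \<mu>. (\<Sum>t\<in>T. \<psi> (y + t) *\<^sub>R f y) = periodization \<psi> y *\<^sub>R f y"
      unfolding AE_cell_measure by (simp add: scaleR_sum_left)
  qed measurable
  finally show "(LINT y|lborel. \<psi> y *\<^sub>R f y) = cell_vol *\<^sub>R (LINT y|\<mu>. periodization \<psi> y *\<^sub>R f y)" .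
qed

end

section \<open>Continuity of translations in the mean\<close>

lemma measurable_cball [measurable]: "cball a r \<in> sets borel"
  by (simp add: borel_closed)

lemma lborel_integral_reflect:
  fixes f :: "'a::euclidean_space \<Rightarrow> 'b::{banach, second_countable_topology}"
  assumes [measurable]: "f \<in> borel_measurable borel"
  shows "(LINT y|lborel. f (w - y)) = (LINT y|lborel. f y)"
proof -
  have "(LINT y|lborel. f y) = (LINT y|density (distr lborel borel (\<lambda>x. w + (-1) *\<^sub>R x)) (\<lambda>_. ennreal (\<bar>-1\<bar> ^ DIM('a))). f y)"
    by (subst lborel_affine[of "-1" w]) simp_all
  also have "\<dots> = (LINT y|distr lborel borel (\<lambda>x. w - x). f y)"
    by (simp add: density_1)
  also have "\<dots> = (LINT y|lborel. f (w - y))"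
    by (subst integral_distr) auto
  finally show ?thesis ..
qed

text \<open>
  Truncating at a high level \<open>k\<close> costs little. The truncated function is an almost everywhere limit of
  continuous functions, which may be truncated at the same level; then bounded convergence applies.
\<close>

lemma continuous_approx_in_L2:
  fixes b :: "'a::euclidean_space \<Rightarrow> real"
  assumes [measurable]: "b \<in> borel_measurable borel"
    and int: "integrable lborel (\<lambda>y. indicator (cball 0 R) y * (b y)\<^sup>2)" and "\<epsilon> > 0"
  obtains h :: "'a \<Rightarrow> real" where "continuous_on UNIV h"
    "(\<integral>\<^sup>+y. ennreal (indicator (cball 0 R) y * (b y - h y)\<^sup>2) \<partial>lborel) \<le> ennreal \<epsilon>"
proof -
  let ?I = "\<lambda>y::'a. indicator (cball 0 R) y :: real"
  define clip :: "real \<Rightarrow> real \<Rightarrow> real" where "clip k x = max (- k) (min k x)" for k x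
  have clip_bound: "\<bar>clip k x\<bar> \<le> k" if "k \<ge> 0" for k x using that by (auto simp: clip_def)
  have clip_le: "(x - clip k x)\<^sup>2 \<le> x\<^sup>2" if "k \<ge> 0" for k x
    using that by (auto simp: clip_def simp flip: abs_le_square_iff)
  have clip_cont: "continuous_on UNIV (clip k)" for k
    unfolding clip_def by (intro continuous_intros)
  have [measurable]: "clip k \<in> borel_measurable borel" for k
    using clip_cont by (rule borel_measurable_continuous_onI)
  have "(\<lambda>k. LINT y|lborel. ?I y * (b y - clip (real k) (b y))\<^sup>2) \<longlonglongrightarrow> (LINT y|(lborel::'a measure). 0)"
  proof (rule integral_dominated_convergence[OF _ _ int])
    show "AE y in lborel. (\<lambda>k. ?I y * (b y - clip (real k) (b y))\<^sup>2) \<longlonglongrightarrow> 0"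
    proof (rule AE_I2, rule tendsto_eventually)
      fix y :: 'a
      obtain k0 :: nat where "\<bar>b y\<bar> \<le> real k0" using real_arch_simple by blast
      then show "\<forall>\<^sub>F k in sequentially. ?I y * (b y - clip (real k) (b y))\<^sup>2 = 0"
        by (intro eventually_sequentiallyI[of k0]) (auto simp: clip_def)
    qed
    show "AE y in lborel. norm (?I y * (b y - clip (real k) (b y))\<^sup>2) \<le> ?I y * (b y)\<^sup>2" for k
      using clip_le[of "real k" "b y" for y] by (auto simp: indicator_def)
  qed auto
  then have "\<forall>\<^sub>F k in sequentially. (LINT y|lborel. ?I y * (b y - clip (real k) (b y))\<^sup>2) < \<epsilon> / 4"
    using \<open>\<epsilon> > 0\<close> by (intro order_tendstoD(2)) auto
  then obtain k :: nat where k: "(LINT y|lborel. ?I y * (b y - clip (real k) (b y))\<^sup>2) < \<epsilon> / 4"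
    by (meson eventually_sequentially order_refl)
  define bk where "bk y = clip (real k) (b y)" for y
  have [measurable]: "bk \<in> borel_measurable borel" unfolding bk_def by measurable
  have "bk measurable_on UNIV"
    by (rule lebesgue_measurable_imp_measurable_on) (auto intro: measurable_completion)
  then obtain N :: "'a set" and c :: "nat \<Rightarrow> 'a \<Rightarrow> real" where N: "negligible N"
    and c: "\<And>n. continuous_on UNIV (c n)" "\<And>x. x \<notin> N \<Longrightarrow> (\<lambda>n. c n x) \<longlonglongrightarrow> bk x"
    unfolding measurable_on_def by auto
  define h where "h n y = clip (real k) (c n y)" for n y
  have hc: "continuous_on UNIV (h n)" for n
    unfolding h_def by (rule continuous_on_compose2[OF clip_cont c(1)]) auto
  have [measurable]: "h n \<in> borel_measurable borel" for n
    by (rule borel_measurable_continuous_onI[OF hc])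
  have bk_h_le: "(bk y - h n y)\<^sup>2 \<le> (2 * real k)\<^sup>2" for n y
  proof (rule abs_le_square_iff[THEN iffD1])
    show "\<bar>bk y - h n y\<bar> \<le> \<bar>2 * real k\<bar>"
      using clip_bound[of "real k" "b y"] clip_bound[of "real k" "c n y"] by (auto simp: bk_def h_def)
  qed
  have "AE y in lebesgue. y \<notin> N"
    using N by (intro AE_not_in) (simp add: negligible_iff_null_sets)
  then have aeN: "AE y in lborel. y \<notin> N" by (simp add: AE_completion_iff)
  have int_cball: "integrable lborel (\<lambda>y::'a. K * indicator (cball 0 R) y)" for K :: real
  proof -
    have "emeasure lborel (cball (0::'a) R) < \<infinity>" by (rule emeasure_bounded_finite) simp
    then show ?thesis by simp
  qed
  have "(\<lambda>n. LINT y|lborel. ?I y * (bk y - h n y)\<^sup>2) \<longlonglongrightarrow> (LINT y|(lborel::'a measure). 0)"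
  proof (rule integral_dominated_convergence[OF _ _ int_cball[of "(2 * real k)\<^sup>2"]])
    show "AE y in lborel. (\<lambda>n. ?I y * (bk y - h n y)\<^sup>2) \<longlonglongrightarrow> 0"
      using aeN
    proof eventually_elim
      case (elim y)
      have "(\<lambda>n. h n y) \<longlonglongrightarrow> clip (real k) (bk y)"
        unfolding h_def clip_def by (intro tendsto_intros c(2) elim)
      moreover have "clip (real k) (bk y) = bk y" by (auto simp: bk_def clip_def)
      ultimately have "(\<lambda>n. ?I y * (bk y - h n y)\<^sup>2) \<longlonglongrightarrow> ?I y * (bk y - bk y)\<^sup>2"
        by (intro tendsto_intros) simp
      then show ?case by simp
    qed
    show "AE y in lborel. norm (?I y * (bk y - h n y)\<^sup>2) \<le> (2 * real k)\<^sup>2 * ?I y" for n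
      using bk_h_le by (auto simp: indicator_def)
  qed auto
  then have "\<forall>\<^sub>F n in sequentially. (LINT y|lborel. ?I y * (bk y - h n y)\<^sup>2) < \<epsilon> / 4"
    using \<open>\<epsilon> > 0\<close> by (intro order_tendstoD(2)) auto
  then obtain n where n: "(LINT y|lborel. ?I y * (bk y - h n y)\<^sup>2) < \<epsilon> / 4"
    by (meson eventually_sequentially order_refl)
  have i1: "integrable lborel (\<lambda>y. ?I y * (b y - bk y)\<^sup>2)"
    by (rule Bochner_Integration.integrable_bound[OF int])
      (use clip_le[of "real k" "b y" for y] in \<open>auto simp: indicator_def bk_def\<close>)
  have i2: "integrable lborel (\<lambda>y. ?I y * (bk y - h n y)\<^sup>2)"
    by (rule Bochner_Integration.integrable_bound[OF int_cball[of "(2 * real k)\<^sup>2"]])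
      (use bk_h_le in \<open>auto simp: indicator_def\<close>)
  have "(\<integral>\<^sup>+y. ennreal (?I y * (b y - h n y)\<^sup>2) \<partial>lborel)
      \<le> (\<integral>\<^sup>+y. ennreal (2 * (?I y * (b y - bk y)\<^sup>2) + 2 * (?I y * (bk y - h n y)\<^sup>2)) \<partial>lborel)"
  proof (intro nn_integral_mono ennreal_leI)
    fix y :: 'a
    have "(b y - h n y)\<^sup>2 \<le> 2 * (b y - bk y)\<^sup>2 + 2 * (bk y - h n y)\<^sup>2"
      using zero_le_power2[of "(b y - bk y) - (bk y - h n y)"]
      by (simp add: power2_eq_square algebra_simps)
    then show "?I y * (b y - h n y)\<^sup>2 \<le> 2 * (?I y * (b y - bk y)\<^sup>2) + 2 * (?I y * (bk y - h n y)\<^sup>2)"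
      by (auto simp: indicator_def)
  qed
  also have "\<dots> = ennreal (LINT y|lborel. 2 * (?I y * (b y - bk y)\<^sup>2) + 2 * (?I y * (bk y - h n y)\<^sup>2))"
    using i1 i2 by (intro nn_integral_eq_integral) auto
  also have "\<dots> \<le> ennreal \<epsilon>"
    using i1 i2 k n by (intro ennreal_leI) (simp flip: bk_def)
  finally show ?thesis using hc that by blast
qed

context period_lattice
begin

lemma integrable_cball_of_cell:
  fixes b :: "real^3 \<Rightarrow> real"
  assumes b: "sq_int \<mu> b" "per b"
  shows "integrable lborel (\<lambda>y. indicator (cball 0 R) y * (b y)\<^sup>2)"
proof (rule integrable_unfold[where R=R])
  have [measurable]: "b \<in> borel_measurable borel" using sq_int_measurable[OF b(1)] by simp
  show "(\<lambda>y. indicator (cball 0 R) y * (b y)\<^sup>2) \<in> borel_measurable borel" by measurable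
  show "norm y > R \<Longrightarrow> indicator (cball 0 R) y * (b y)\<^sup>2 = 0" for y by simp
  fix t assume t: "t \<in> \<Lambda>"
  show "integrable \<mu> (\<lambda>y. indicator (cball 0 R) (y + t) * (b (y + t))\<^sup>2)"
    by (rule Bochner_Integration.integrable_bound[OF sq_int_integrable_power2[OF b(1)]])
      (auto simp: indicator_def perD[OF b(2) t])
qed

text \<open>
  Clear for a uniformly continuous function, and the general case follows by approximation. For
  \<open>|z| < 1\<close> both \<open>w\<close> and \<open>w - z\<close> stay in one large ball when \<open>w\<close> runs through the cell, so an
  approximation on that ball suffices.
\<close>

lemma L2_translation_continuous:
  fixes b :: "real^3 \<Rightarrow> real"
  assumes b: "sq_int \<mu> b" "per b" and "\<eta> > 0"
  obtains \<epsilon> where "\<epsilon> > 0" "\<And>z. norm z < \<epsilon> \<Longrightarrow> (LINT w|\<mu>. (b w - b (w - z))\<^sup>2) \<le> \<eta>"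
proof -
  have bm [measurable]: "b \<in> borel_measurable borel" using sq_int_measurable[OF b(1)] by simp
  obtain r where r: "cell g \<subseteq> cball 0 r" using cell_subset_cball by blast
  (* one unit of room around the cell for the translations *)
  define R where "R = r + 1"
  have near: "w - z \<in> cball 0 R" "w \<in> cball 0 R" if "w \<in> cell0" "norm z < 1" for w z
  proof -
    have "norm w \<le> r" using r cell0_subset_cell that(1) by (auto simp: subset_iff)
    then show "w - z \<in> cball 0 R" "w \<in> cball 0 R"
      using norm_triangle_ineq4[of w z] that(2) by (auto simp: R_def)
  qed
  (* the error over the cell is the error over the space divided by the volume; three terms of size
     \<eta> / 9, times the factor 3 of the elementary inequality, add up to \<eta> *)
  obtain h :: "real^3 \<Rightarrow> real" where h: "continuous_on UNIV h"
    "(\<integral>\<^sup>+y. ennreal (indicator (cball 0 R) y * (b y - h y)\<^sup>2) \<partial>lborel) \<le> ennreal (\<eta> * cell_vol / 9)"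
    using continuous_approx_in_L2[OF bm integrable_cball_of_cell[OF b], of "\<eta> * cell_vol / 9"]
      \<open>\<eta> > 0\<close> cell_vol_pos by auto
  have [measurable]: "h \<in> borel_measurable borel" using h(1) by (rule borel_measurable_continuous_onI)
  have "uniformly_continuous_on (cball 0 R) h"
    using continuous_on_subset[OF h(1)] by (intro compact_uniformly_continuous) auto
  then obtain d where d: "d > 0"
    "\<And>x y. x \<in> cball 0 R \<Longrightarrow> y \<in> cball 0 R \<Longrightarrow> dist y x < d \<Longrightarrow> dist (h y) (h x) < sqrt (\<eta> / 9)"
    using \<open>\<eta> > 0\<close> unfolding uniformly_continuous_on_def
    by (metis divide_pos_pos real_sqrt_gt_0_iff zero_less_numeral)
  show ?thesis
  proof (rule that[of "min 1 d"])
    show "min 1 d > 0" using d(1) by simp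
    fix z :: "real^3" assume z: "norm z < min 1 d"
    have shifted: "(\<integral>\<^sup>+w. ennreal ((b (w - z') - h (w - z'))\<^sup>2) \<partial>\<mu>) \<le> ennreal (\<eta> / 9)"
      if z': "norm z' < 1" for z'
    proof -
      have "(\<integral>\<^sup>+w. ennreal ((b (w - z') - h (w - z'))\<^sup>2) * indicator cell0 w \<partial>lborel)
          \<le> (\<integral>\<^sup>+w. ennreal (indicator (cball 0 R) (w - z') * (b (w - z') - h (w - z'))\<^sup>2) \<partial>lborel)"
        using near(1)[OF _ z'] by (intro nn_integral_mono) (auto simp: indicator_def)
      also have "\<dots> = (\<integral>\<^sup>+w. ennreal (indicator (cball 0 R) w * (b w - h w)\<^sup>2) \<partial>distr lborel borel ((+) (- z')))"
        by (subst nn_integral_distr) auto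
      also have "\<dots> \<le> ennreal (\<eta> * cell_vol / 9)" using h(2) by (simp add: lborel_distr_plus)
      finally have "ennreal cell_vol * (\<integral>\<^sup>+w. ennreal ((b (w - z') - h (w - z'))\<^sup>2) \<partial>\<mu>)
          \<le> ennreal (\<eta> * cell_vol / 9)"
        by (subst nn_integral_cell0[symmetric]) auto
      then have "ennreal (1 / cell_vol) * (ennreal cell_vol * (\<integral>\<^sup>+w. ennreal ((b (w - z') - h (w - z'))\<^sup>2) \<partial>\<mu>))
          \<le> ennreal (1 / cell_vol) * ennreal (\<eta> * cell_vol / 9)"
        by (rule mult_left_mono) simp
      then show ?thesis
        using cell_vol_pos \<open>\<eta> > 0\<close> by (simp add: mult.assoc[symmetric] ennreal_mult[symmetric])
    qed
    have hz: "(h w - h (w - z))\<^sup>2 \<le> \<eta> / 9" if "w \<in> cell0" for w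
    proof -
      have "dist (h w) (h (w - z)) < sqrt (\<eta> / 9)"
        using z near[OF that, of z] by (intro d(2)) (auto simp: dist_norm)
      then have "\<bar>h w - h (w - z)\<bar> \<le> \<bar>sqrt (\<eta> / 9)\<bar>" using \<open>\<eta> > 0\<close> by (simp add: dist_real_def)
      then have "(h w - h (w - z))\<^sup>2 \<le> (sqrt (\<eta> / 9))\<^sup>2" by (rule abs_le_square_iff[THEN iffD1])
      then show ?thesis using \<open>\<eta> > 0\<close> by simp
    qed
    have "(\<integral>\<^sup>+w. ennreal ((b w - b (w - z))\<^sup>2) \<partial>\<mu>)
      \<le> (\<integral>\<^sup>+w. ennreal 3 * (ennreal ((b w - h w)\<^sup>2) + (ennreal ((b (w - z) - h (w - z))\<^sup>2) + ennreal (\<eta> / 9))) \<partial>\<mu>)"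
    proof (rule nn_integral_mono_AE, unfold AE_cell_measure, intro AE_I2 impI)
      fix w assume w: "w \<in> cell0"
      define x y u where "x = b w - h w" "y = h w - h (w - z)" "u = b (w - z) - h (w - z)"
      have "(x + y - u)\<^sup>2 \<le> 3 * (x\<^sup>2 + (u\<^sup>2 + y\<^sup>2))"
        using zero_le_power2[of "x - y"] zero_le_power2[of "x + u"] zero_le_power2[of "y + u"]
        by (simp add: power2_eq_square algebra_simps)
      also have "\<dots> \<le> 3 * (x\<^sup>2 + (u\<^sup>2 + \<eta> / 9))" using hz[OF w] by (simp add: x_y_u_def)
      finally have "(b w - b (w - z))\<^sup>2 \<le> 3 * (x\<^sup>2 + (u\<^sup>2 + \<eta> / 9))" by (simp add: x_y_u_def)
      then have "ennreal ((b w - b (w - z))\<^sup>2) \<le> ennreal (3 * (x\<^sup>2 + (u\<^sup>2 + \<eta> / 9)))" by (rule ennreal_leI)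
      also have "\<dots> = ennreal 3 * (ennreal (x\<^sup>2) + (ennreal (u\<^sup>2) + ennreal (\<eta> / 9)))"
        using \<open>\<eta> > 0\<close> by (subst ennreal_mult') (simp_all add: ennreal_plus)
      finally show "ennreal ((b w - b (w - z))\<^sup>2) \<le> ennreal 3 * (ennreal ((b w - h w)\<^sup>2) + (ennreal ((b (w - z) - h (w - z))\<^sup>2) + ennreal (\<eta> / 9)))"
        by (simp add: x_y_u_def)
    qed
    also have "\<dots> = ennreal 3 * ((\<integral>\<^sup>+w. ennreal ((b w - h w)\<^sup>2) \<partial>\<mu>)
        + ((\<integral>\<^sup>+w. ennreal ((b (w - z) - h (w - z))\<^sup>2) \<partial>\<mu>) + ennreal (\<eta> / 9)))"
      using cell.emeasure_space_1 by (simp add: nn_integral_cmult nn_integral_add)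
    also have "\<dots> \<le> ennreal 3 * (ennreal (\<eta> / 9) + (ennreal (\<eta> / 9) + ennreal (\<eta> / 9)))"
      using shifted[of 0] shifted[of z] z by (intro mult_left_mono add_mono) auto
    also have "\<dots> = ennreal \<eta>"
      using \<open>\<eta> > 0\<close> ennreal_mult[of 3 "\<eta> / 3"]
      by (simp add: ennreal_plus[symmetric] del: ennreal_plus)
    finally have le: "(\<integral>\<^sup>+w. ennreal ((b w - b (w - z))\<^sup>2) \<partial>\<mu>) \<le> ennreal \<eta>" .
    have "(LINT w|\<mu>. (b w - b (w - z))\<^sup>2)
        = enn2real (\<integral>\<^sup>+w. ennreal ((b w - b (w - z))\<^sup>2) \<partial>\<mu>)"
      by (rule integral_eq_nn_integral) auto
    also have "\<dots> \<le> enn2real (ennreal \<eta>)" by (rule enn2real_mono[OF le]) simp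
    finally show "(LINT w|\<mu>. (b w - b (w - z))\<^sup>2) \<le> \<eta>" using \<open>\<eta> > 0\<close> by simp
  qed
qed

section \<open>Mollified pairings\<close>

sublocale cell_pair: pair_sigma_finite \<mu> \<mu>
  by (simp add: pair_sigma_finite_def cell.sigma_finite_measure_axioms)

sublocale lborel_cell: pair_sigma_finite "lborel :: (real^3) measure" \<mu>
  by (simp add: pair_sigma_finite_def cell.sigma_finite_measure_axioms lborel.sigma_finite_measure_axioms)

lemma periodization_translate: "periodization (\<lambda>w. u (w - y)) w = periodization u (w - y)"
  by (simp add: periodization_def diff_add_eq)

lemma periodization_reflect: "periodization (\<lambda>y. u (w - y)) y = periodization u (w - y)"
  unfolding periodization_def
  by (rule sum.reindex_bij_witness[of _ uminus uminus]) (auto simp: algebra_simps)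

lemma per_bounded:
  fixes f :: "real^3 \<Rightarrow> 'b::real_normed_vector"
  assumes f: "per f" "continuous_on UNIV f"
  obtains B where "B > 0" "\<And>x. norm (f x) \<le> B"
proof -
  obtain r where r: "cell g \<subseteq> cball 0 r" using cell_subset_cball by blast
  have "compact (f ` cball 0 r)"
    by (intro compact_continuous_image continuous_on_subset[OF f(2)]) auto
  then obtain B where B: "B > 0" "\<And>x. x \<in> cball 0 r \<Longrightarrow> norm (f x) \<le> B"
    by (auto dest!: compact_imp_bounded simp: bounded_pos)
  have "norm (f x) \<le> B" for x
  proof -
    have "wrap x \<in> cball 0 r" using wrap_in_cell0 cell0_subset_cell r by blast
    then have "norm (f (wrap x)) \<le> B" by (rule B(2))
    then show ?thesis by (simp add: per_wrap[OF f(1)])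
  qed
  with B(1) that show ?thesis by blast
qed

text \<open>
  Both inner integrals are unfolded to cell integrals against the same kernel, the periodization of
  \<open>u\<close> at \<open>w - y\<close>; this kernel is bounded, so Fubini's theorem applies on the product of two copies of
  the cell.
\<close>

lemma periodic_kernel_Fubini:
  fixes a b u :: "real^3 \<Rightarrow> real"
  assumes a: "per a" "integrable \<mu> a" and b: "per b" "integrable \<mu> b"
    and u: "continuous_on UNIV u" and R: "\<And>x. norm x > R \<Longrightarrow> u x = 0"
  shows "(LINT w|\<mu>. a w * (LINT y|lborel. u (w - y) * b y))
       = (LINT y|\<mu>. b y * (LINT w|lborel. u (w - y) * a w))"
    and "integrable \<mu> (\<lambda>w. a w * (LINT y|lborel. u (w - y) * b y))"
    and "integrable \<mu> (\<lambda>y. b y * (LINT w|lborel. u (w - y) * a w))"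
proof -
  have [measurable]: "a \<in> borel_measurable borel" "b \<in> borel_measurable borel"
    using borel_measurable_integrable[OF a(2)] borel_measurable_integrable[OF b(2)] by simp_all
  have cp: "continuous_on UNIV (periodization u)" by (rule continuous_periodization[OF R u])
  have [measurable]: "periodization u \<in> borel_measurable borel" by (rule borel_measurable_continuous_onI[OF cp])
  obtain B where B: "\<And>x. norm (periodization u x) \<le> B" using per_bounded[OF per_periodization cp] by metis
  have Rs: "norm (w - y) > R" if "norm y > R + norm w" for w y :: "real^3"
    using that norm_triangle_ineq3[of w y] by linarith
  have Rs': "norm (w - y) > R" if "norm w > R + norm y" for w y :: "real^3"
    using that norm_triangle_ineq3[of w y] by linarith
  have c: "continuous_on UNIV (\<lambda>y. u (w - y))" "continuous_on UNIV (\<lambda>w. u (w - y))" for w y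
    by (auto intro!: continuous_on_compose2[OF u] continuous_intros)
  have 1: "(LINT y|lborel. u (w - y) * b y) = cell_vol * (LINT y|\<mu>. periodization u (w - y) * b y)" for w
    using per_integral_unfold(2)[OF _ b(1,2) c(1), of "R + norm w" w] R Rs by (simp add: periodization_reflect)
  have 2: "(LINT w|lborel. u (w - y) * a w) = cell_vol * (LINT w|\<mu>. periodization u (w - y) * a w)" for y
    using per_integral_unfold(2)[OF _ a(1,2) c(2), of "R + norm y" y] R Rs' by (simp add: periodization_translate)
  have int: "integrable (\<mu> \<Otimes>\<^sub>M \<mu>) (\<lambda>(w, y). periodization u (w - y) * (a w * b y))"
  proof (rule Bochner_Integration.integrable_bound)
    have "integrable (\<mu> \<Otimes>\<^sub>M \<mu>) (\<lambda>(w, y). a w * b y)"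
    proof (rule cell_pair.Fubini_integrable)
      show "AE x in \<mu>. integrable \<mu> (\<lambda>y. case (x, y) of (w, y) \<Rightarrow> a w * b y)"
        using b by simp
      show "integrable \<mu> (\<lambda>x. LINT y|\<mu>. norm (case (x, y) of (w, y) \<Rightarrow> a w * b y))"
        using a by (simp add: abs_mult)
    qed measurable
    then have "integrable (\<mu> \<Otimes>\<^sub>M \<mu>) (\<lambda>x. B * (case x of (w, y) \<Rightarrow> a w * b y))"
      by (rule integrable_mult_right)
    then show "integrable (\<mu> \<Otimes>\<^sub>M \<mu>) (\<lambda>(w, y). B * (a w * b y))"
      by (simp add: case_prod_unfold)
    have "\<bar>periodization u x\<bar> * (\<bar>s\<bar> * \<bar>t\<bar>) \<le> \<bar>B\<bar> * (\<bar>s\<bar> * \<bar>t\<bar>)" for x and s t :: real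
      using B[of x] by (intro mult_right_mono) auto
    then show "AE x in \<mu> \<Otimes>\<^sub>M \<mu>.
        norm (case x of (w, y) \<Rightarrow> periodization u (w - y) * (a w * b y)) \<le> norm (case x of (w, y) \<Rightarrow> B * (a w * b y))"
      by (intro AE_I2) (auto simp: abs_mult)
  qed measurable
  have e1: "a w * (LINT y|lborel. u (w - y) * b y)
      = cell_vol * (LINT y|\<mu>. periodization u (w - y) * (a w * b y))" for w
    by (simp add: 1 mult.left_commute[of _ "a w"])
  have e2: "b y * (LINT w|lborel. u (w - y) * a w)
      = cell_vol * (LINT w|\<mu>. periodization u (w - y) * (a w * b y))" for y
    by (simp add: 2 mult.commute[of _ "b y"] mult.left_commute[of _ "b y"])
  show "(LINT w|\<mu>. a w * (LINT y|lborel. u (w - y) * b y))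
       = (LINT y|\<mu>. b y * (LINT w|lborel. u (w - y) * a w))"
    unfolding e1 e2 using cell_pair.Fubini_integral[OF int] by simp
  show "integrable \<mu> (\<lambda>w. a w * (LINT y|lborel. u (w - y) * b y))"
    unfolding e1 using cell_pair.integrable_fst[OF int] by simp
  show "integrable \<mu> (\<lambda>y. b y * (LINT w|lborel. u (w - y) * a w))"
    unfolding e2 using cell_pair.integrable_snd[OF int] by simp
qed

lemma sq_int_translate:
  fixes f :: "real^3 \<Rightarrow> 'b::euclidean_space"
  assumes f: "sq_int \<mu> f" "per f"
  shows "sq_int \<mu> (\<lambda>w. f (w + z))"
    and "(LINT w|\<mu>. (norm (f (w + z)))\<^sup>2) = (LINT w|\<mu>. (norm (f w))\<^sup>2)"
proof -
  have [measurable]: "f \<in> borel_measurable borel" using sq_int_measurable[OF f(1)] by simp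
  have p: "per (\<lambda>w. (norm (f w))\<^sup>2)" using f(2) by (simp add: per_def)
  show "sq_int \<mu> (\<lambda>w. f (w + z))"
    using integral_cell_translation(2)[OF _ p, of z] f(1) by (simp add: sq_int_def)
  show "(LINT w|\<mu>. (norm (f (w + z)))\<^sup>2) = (LINT w|\<mu>. (norm (f w))\<^sup>2)"
    using integral_cell_translation(1)[OF _ p, of z] by simp
qed

text \<open>
  The pairing of \<open>a\<close> with \<open>\<rho> * b\<close> is \<open>\<integral> \<rho>(z) c(z) dz\<close> with \<open>c(z) = \<integral> a(w) b(w - z) d\<mu>(w)\<close>, and
  \<open>c(z) - c(0)\<close> is small for small \<open>z\<close> by the Cauchy--Schwarz inequality.
\<close>

lemma mollification_error:
  fixes a b \<rho> :: "real^3 \<Rightarrow> real"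
  assumes a: "sq_int \<mu> a" "per a" and b: "sq_int \<mu> b" "per b"
    and \<rho>: "continuous_on UNIV \<rho>" "\<And>x. \<rho> x \<ge> 0" "\<And>x. norm x \<ge> \<epsilon> \<Longrightarrow> \<rho> x = 0"
    and \<eta>: "\<And>z. norm z < \<epsilon> \<Longrightarrow> (LINT w|\<mu>. (b w - b (w - z))\<^sup>2) \<le> \<eta>"
  shows "\<bar>(LINT w|\<mu>. a w * (LINT y|lborel. \<rho> (w - y) * b y))
      - (LINT y|lborel. \<rho> y) * (LINT w|\<mu>. a w * b w)\<bar>
    \<le> (LINT y|lborel. \<rho> y) * sqrt ((LINT w|\<mu>. (a w)\<^sup>2) * \<eta>)"
proof -
  have [measurable]: "a \<in> borel_measurable borel" "b \<in> borel_measurable borel"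
    using sq_int_measurable[OF a(1)] sq_int_measurable[OF b(1)] by simp_all
  have [measurable]: "\<rho> \<in> borel_measurable borel" by (rule borel_measurable_continuous_onI[OF \<rho>(1)])
  have \<rho>int: "integrable lborel \<rho>"
    by (rule integrable_continuous_bounded_support[OF \<rho>(1), of \<epsilon>]) (simp add: \<rho>(3))
  define c where "c z = (LINT w|\<mu>. a w * b (w - z))" for z
  have tr: "sq_int \<mu> (\<lambda>w. b (w - z))" for z
    using sq_int_translate(1)[OF b, of "- z"] by simp
  have trn: "(LINT w|\<mu>. (b (w - z))\<^sup>2) = (LINT w|\<mu>. (b w)\<^sup>2)" for z
    using sq_int_translate(2)[OF b, of "- z"] by simp
  define C where "C = sqrt ((LINT w|\<mu>. (a w)\<^sup>2) * (LINT w|\<mu>. (b w)\<^sup>2))"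
  have abs_int: "integrable \<mu> (\<lambda>w. \<bar>a w * b (w - z)\<bar>)" for z
    using sq_int_inner[OF a(1) tr[of z]] by (intro integrable_abs) simp
  have abs_le: "(LINT w|\<mu>. \<bar>a w * b (w - z)\<bar>) \<le> C" for z
  proof -
    have "(LINT w|\<mu>. \<bar>a w\<bar> * \<bar>b (w - z)\<bar>)\<^sup>2
        \<le> (LINT w|\<mu>. (a w)\<^sup>2) * (LINT w|\<mu>. (b (w - z))\<^sup>2)"
      using Cauchy_Schwarz_integral[OF sq_int_norm[OF a(1)] sq_int_norm[OF tr[of z]]] by simp
    then show ?thesis unfolding C_def trn abs_mult by (rule real_le_rsqrt)
  qed
  have int: "integrable (lborel \<Otimes>\<^sub>M \<mu>) (\<lambda>(z, w). a w * (\<rho> z * b (w - z)))"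
  proof (rule lborel_cell.Fubini_integrable)
    show "AE z in lborel. integrable \<mu> (\<lambda>w. case (z, w) of (z, w) \<Rightarrow> a w * (\<rho> z * b (w - z)))"
    proof (rule AE_I2)
      fix z
      have "integrable \<mu> (\<lambda>w. \<rho> z * (a w * b (w - z)))"
        using sq_int_inner[OF a(1) tr[of z]] by simp
      then show "integrable \<mu> (\<lambda>w. case (z, w) of (z, w) \<Rightarrow> a w * (\<rho> z * b (w - z)))"
        by (simp add: mult.left_commute)
    qed
    show "integrable lborel (\<lambda>z. LINT w|\<mu>. norm (case (z, w) of (z, w) \<Rightarrow> a w * (\<rho> z * b (w - z))))"
    proof (rule Bochner_Integration.integrable_bound)
      show "integrable lborel (\<lambda>z. C * \<rho> z)" using \<rho>int by simp
      show "AE z in lborel. norm (LINT w|\<mu>. norm (case (z, w) of (z, w) \<Rightarrow> a w * (\<rho> z * b (w - z))))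
          \<le> norm (C * \<rho> z)"
      proof (rule AE_I2)
        fix z
        have "(LINT w|\<mu>. norm (case (z, w) of (z, w) \<Rightarrow> a w * (\<rho> z * b (w - z))))
            = \<rho> z * (LINT w|\<mu>. \<bar>a w * b (w - z)\<bar>)"
          using \<rho>(2)[of z] by (simp add: abs_mult mult.left_commute[of _ "\<rho> z"])
        also have "\<dots> \<le> \<rho> z * C" by (intro mult_left_mono abs_le \<rho>(2))
        finally show "norm (LINT w|\<mu>. norm (case (z, w) of (z, w) \<Rightarrow> a w * (\<rho> z * b (w - z))))
          \<le> norm (C * \<rho> z)"
          using \<rho>(2)[of z] by (simp add: mult.commute)
      qed
    qed measurable
  qed measurable
  have "(LINT w|\<mu>. a w * (LINT y|lborel. \<rho> (w - y) * b y))
      = (LINT w|\<mu>. (LINT z|lborel. a w * (\<rho> z * b (w - z))))"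
  proof (rule Bochner_Integration.integral_cong[OF refl])
    fix w
    show "a w * (LINT y|lborel. \<rho> (w - y) * b y) = (LINT z|lborel. a w * (\<rho> z * b (w - z)))"
      using lborel_integral_reflect[of "\<lambda>z. \<rho> z * b (w - z)" w] by simp
  qed
  also have "\<dots> = (LINT z|lborel. (LINT w|\<mu>. a w * (\<rho> z * b (w - z))))"
    using lborel_cell.Fubini_integral[OF int] by simp
  also have "\<dots> = (LINT z|lborel. \<rho> z * c z)"
    by (simp add: c_def mult.left_commute[of "a _"])
  finally have eq: "(LINT w|\<mu>. a w * (LINT y|lborel. \<rho> (w - y) * b y)) = (LINT z|lborel. \<rho> z * c z)" .
  have ci: "integrable lborel (\<lambda>z. \<rho> z * c z)"
    using lborel_cell.integrable_fst[OF int] by (simp add: c_def mult.left_commute[of "a _"])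
  have cdiff: "\<bar>c z - c 0\<bar> \<le> sqrt ((LINT w|\<mu>. (a w)\<^sup>2) * \<eta>)" if "norm z < \<epsilon>" for z
  proof -
    have "c 0 - c z = (LINT w|\<mu>. a w \<bullet> (b w - b (w - z)))"
      using sq_int_inner[OF a(1) tr[of z]] sq_int_inner[OF a(1) b(1)]
      by (simp add: c_def right_diff_distrib)
    also have "\<bar>\<dots>\<bar> \<le> sqrt ((LINT w|\<mu>. (a w)\<^sup>2) * (LINT w|\<mu>. (b w - b (w - z))\<^sup>2))"
      using Cauchy_Schwarz_integral[OF a(1) sq_int_diff[OF b(1) tr[of z]]] by (intro real_le_rsqrt) simp
    also have "\<dots> \<le> sqrt ((LINT w|\<mu>. (a w)\<^sup>2) * \<eta>)"
      by (intro real_sqrt_le_mono mult_left_mono \<eta> that) simp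
    finally show ?thesis by (simp add: abs_minus_commute)
  qed
  have "(LINT z|lborel. \<rho> z * c z) - (LINT y|lborel. \<rho> y) * c 0 = (LINT z|lborel. \<rho> z * (c z - c 0))"
    using ci \<rho>int by (simp add: right_diff_distrib)
  also have "\<bar>\<dots>\<bar> \<le> (LINT z|lborel. \<rho> z * sqrt ((LINT w|\<mu>. (a w)\<^sup>2) * \<eta>))"
  proof (rule integral_abs_bound_integral)
    show "integrable lborel (\<lambda>z. \<rho> z * (c z - c 0))" using ci \<rho>int by (simp add: right_diff_distrib)
    show "integrable lborel (\<lambda>z. \<rho> z * sqrt ((LINT w|\<mu>. (a w)\<^sup>2) * \<eta>))" using \<rho>int by simp
    fix z
    show "\<bar>\<rho> z * (c z - c 0)\<bar> \<le> \<rho> z * sqrt ((LINT w|\<mu>. (a w)\<^sup>2) * \<eta>)"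
    proof (cases "norm z < \<epsilon>")
      case True
      then show ?thesis using cdiff[OF True] \<rho>(2)[of z] by (simp add: abs_mult mult_left_mono)
    next
      case False
      then show ?thesis using \<rho>(3)[of z] by simp
    qed
  qed
  also have "\<dots> = (LINT y|lborel. \<rho> y) * sqrt ((LINT w|\<mu>. (a w)\<^sup>2) * \<eta>)"
    by simp
  finally show ?thesis by (simp add: eq c_def)
qed

end

section \<open>Symmetric parts of matrices\<close>

definition sym_part :: "real^3^3 \<Rightarrow> real^3^3" where
  "sym_part A = (1/2) *\<^sub>R (A + transpose A)"

lemma sym_part_nth: "sym_part A $ i $ j = (A $ i $ j + A $ j $ i) / 2"
  by (simp add: sym_part_def transpose_def)

lemma bounded_linear_sym_part: "bounded_linear sym_part"
  unfolding linear_conv_bounded_linear[symmetric]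
  by (rule linearI) (simp_all add: vec_eq_iff sym_part_nth field_simps)

lemma linear_sym_part: "linear sym_part"
  by (rule bounded_linear.linear[OF bounded_linear_sym_part])

lemmas sym_part_add = linear_add[OF linear_sym_part]
  and sym_part_diff = linear_diff[OF linear_sym_part]
  and sym_part_scaleR = linear_scale[OF linear_sym_part]

lemma transpose_sym_part: "transpose (sym_part A) = sym_part A"
  by (simp add: vec_eq_iff transpose_def sym_part_nth add.commute)

lemma sym_part_eq: "transpose A = A \<Longrightarrow> sym_part A = A"
  by (simp add: sym_part_def)

lemma transpose_eq_nth: "transpose A = A \<Longrightarrow> A $ i $ j = A $ j $ i"
  by (metis transpose_def vec_lambda_beta)

lemma transpose_diff_sym_part:
  assumes "transpose A = A"
  shows "transpose (A - sym_part B) = A - sym_part B"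
  using transpose_sym_part[of "A - B"] by (simp add: sym_part_diff sym_part_eq[OF assms])

lemma transpose_integral:
  fixes f :: "'a \<Rightarrow> real^3^3"
  assumes "integrable M f" "\<And>x. transpose (f x) = f x"
  shows "transpose (LINT x|M. f x) = (LINT x|M. f x)"
proof -
  have "(LINT x|M. f x) = (LINT x|M. sym_part (f x))" by (simp add: sym_part_eq assms(2))
  also have "\<dots> = sym_part (LINT x|M. f x)"
    by (rule integral_bounded_linear[OF bounded_linear_sym_part assms(1)])
  finally show ?thesis by (metis transpose_sym_part)
qed

lemma sym_part_inner: "sym_part A \<bullet> S = A \<bullet> S" if S: "transpose S = S"
proof -
  have "(\<Sum>i\<in>UNIV. \<Sum>j\<in>UNIV. A $ j $ i * S $ i $ j) = (\<Sum>i\<in>UNIV. \<Sum>j\<in>UNIV. A $ i $ j * S $ i $ j)"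
    by (subst sum.swap) (simp add: transpose_eq_nth[OF S])
  moreover have "sym_part A \<bullet> S
      = (1/2) * ((\<Sum>i\<in>UNIV. \<Sum>j\<in>UNIV. A $ i $ j * S $ i $ j) + (\<Sum>i\<in>UNIV. \<Sum>j\<in>UNIV. A $ j $ i * S $ i $ j))"
    by (simp add: matrix_inner_eq_sum sym_part_nth distrib_right sum.distrib add_divide_distrib sum_divide_distrib)
  ultimately show ?thesis by (simp add: matrix_inner_eq_sum)
qed

section \<open>Weak gradients\<close>

lemma L2_loc_add:
  fixes f h :: "real^3 \<Rightarrow> 'b::euclidean_space"
  assumes f: "f \<in> L2_loc" and h: "h \<in> L2_loc"
  shows "(\<lambda>y. f y + h y) \<in> L2_loc"
proof -
  have [measurable]: "f \<in> borel_measurable lebesgue" "h \<in> borel_measurable lebesgue"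
    using f h by (auto simp: L2_loc_def)
  have "set_integrable lebesgue K (\<lambda>y. (norm (f y + h y))\<^sup>2)" if K: "compact K" for K
    unfolding set_integrable_def
  proof (rule Bochner_Integration.integrable_bound)
    have [measurable]: "K \<in> sets lebesgue" using K by (simp add: borel_compact sets_completionI_sets)
    show "integrable lebesgue (\<lambda>y. 2 * (indicator K y *\<^sub>R (norm (f y))\<^sup>2 + indicator K y *\<^sub>R (norm (h y))\<^sup>2))"
      using f h K by (auto simp: L2_loc_def set_integrable_def)
    show "AE y in lebesgue. norm (indicator K y *\<^sub>R (norm (f y + h y))\<^sup>2)
        \<le> norm (2 * (indicator K y *\<^sub>R (norm (f y))\<^sup>2 + indicator K y *\<^sub>R (norm (h y))\<^sup>2))"
    proof (rule AE_I2)
      fix y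
      have "(norm (f y + h y))\<^sup>2 \<le> (norm (f y) + norm (h y))\<^sup>2"
        by (intro power_mono norm_triangle_ineq) simp
      also have "\<dots> \<le> 2 * ((norm (f y))\<^sup>2 + (norm (h y))\<^sup>2)"
        using two_mult_norm_le[of "f y" "h y"] by (simp add: power2_sum)
      finally show "norm (indicator K y *\<^sub>R (norm (f y + h y))\<^sup>2)
        \<le> norm (2 * (indicator K y *\<^sub>R (norm (f y))\<^sup>2 + indicator K y *\<^sub>R (norm (h y))\<^sup>2))"
        by (simp add: indicator_def)
    qed
    show "(\<lambda>y. indicator K y *\<^sub>R (norm (f y + h y))\<^sup>2) \<in> borel_measurable lebesgue" by measurable
  qed
  then show ?thesis by (simp add: L2_loc_def)
qed

lemma L2_loc_continuous:
  fixes f :: "real^3 \<Rightarrow> 'b::euclidean_space"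
  assumes f: "continuous_on UNIV f"
  shows "f \<in> L2_loc"
proof -
  have [measurable]: "f \<in> borel_measurable borel" by (rule borel_measurable_continuous_onI[OF f])
  have "set_integrable lebesgue K (\<lambda>y. (norm (f y))\<^sup>2)" if K: "compact K" for K
  proof -
    have [measurable]: "K \<in> sets borel" using K by (simp add: borel_compact)
    have "integrable lborel (\<lambda>y. indicator K y *\<^sub>R (norm (f y))\<^sup>2)"
      by (rule borel_integrable_compact[OF K]) (intro continuous_intros continuous_on_subset[OF f], simp)
    then show ?thesis unfolding set_integrable_def by (subst integrable_completion) auto
  qed
  moreover have "f \<in> borel_measurable lebesgue" by (auto intro: measurable_completion)
  ultimately show ?thesis by (simp add: L2_loc_def)
qed

lemma L2_loc_scaleR: "f \<in> L2_loc \<Longrightarrow> (\<lambda>y. c *\<^sub>R f y) \<in> L2_loc"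
  by (auto simp: L2_loc_def power_mult_distrib set_integrable_def mult.left_commute[of _ "c\<^sup>2"])

lemma L2_loc_mult_integrable:
  fixes f :: "real^3 \<Rightarrow> 'b::euclidean_space"
  assumes f: "f \<in> L2_loc" and l: "bounded_linear (l :: 'b \<Rightarrow> real)"
    and \<psi>: "continuous_on UNIV \<psi>" and R: "\<And>x. norm x > R \<Longrightarrow> \<psi> x = 0"
  shows "integrable lebesgue (\<lambda>y. l (f y) * \<psi> y)"
proof -
  obtain B where B: "B > 0" "\<And>y. norm (\<psi> y) \<le> B" using continuous_bounded_support_bound[OF \<psi> R] by metis
  obtain K where K: "K > 0" "\<And>x. norm (l x) \<le> norm x * K" using bounded_linear.pos_bounded[OF l] by blast
  show ?thesis
  proof (rule Bochner_Integration.integrable_bound)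
    have "integrable lebesgue (\<lambda>y. indicator (cball 0 R) y *\<^sub>R (norm (f y))\<^sup>2)"
      using f by (auto simp: L2_loc_def set_integrable_def)
    moreover have "integrable lebesgue (indicator (cball (0::real^3) R) :: real^3 \<Rightarrow> real)"
    proof (rule integrable_real_indicator)
      have "emeasure lborel (cball (0::real^3) R) < \<infinity>" by (rule emeasure_bounded_finite) simp
      then show "emeasure lebesgue (cball (0::real^3) R) < \<infinity>" by simp
    qed simp
    ultimately show "integrable lebesgue (\<lambda>y. (K * B) * (indicator (cball 0 R) y *\<^sub>R (norm (f y))\<^sup>2 + indicator (cball 0 R) y))"
      by simp
    show "AE y in lebesgue. norm (l (f y) * \<psi> y)
        \<le> norm ((K * B) * (indicator (cball 0 R) y *\<^sub>R (norm (f y))\<^sup>2 + indicator (cball 0 R) y))"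
    proof (rule AE_I2)
      fix y
      have "norm (f y) \<le> (norm (f y))\<^sup>2 + 1"
        using two_mult_norm_le[of "f y" "1::real"] norm_ge_zero[of "f y"] by (simp, linarith)
      then have "norm (l (f y)) \<le> K * ((norm (f y))\<^sup>2 + 1)"
        using K(2)[of "f y"] K(1) by (smt (verit) mult.commute mult_left_mono)
      then have "norm (l (f y)) * norm (\<psi> y) \<le> (K * ((norm (f y))\<^sup>2 + 1)) * B"
        using B(2)[of y] K(1) by (intro mult_mono) auto
      then show "norm (l (f y) * \<psi> y)
        \<le> norm ((K * B) * (indicator (cball 0 R) y *\<^sub>R (norm (f y))\<^sup>2 + indicator (cball 0 R) y))"
        using R[of y] K(1) B(1) by (auto simp: indicator_def abs_mult not_le algebra_simps)
    qed
    have "(\<lambda>y. l (f y)) \<in> borel_measurable lebesgue"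
      using f by (intro borel_measurable_continuous_on[OF linear_continuous_on[OF l]]) (simp add: L2_loc_def)
    moreover have "\<psi> \<in> borel_measurable lebesgue"
      using borel_measurable_continuous_onI[OF \<psi>] by (auto intro: measurable_completion)
    ultimately show "(\<lambda>y. l (f y) * \<psi> y) \<in> borel_measurable lebesgue" by measurable
  qed
qed

lemma has_weak_gradient_integrable:
  assumes v: "has_weak_gradient v G" and \<psi>: "\<psi> \<in> test_functions"
  shows "integrable lebesgue (\<lambda>y. v y $ i * partial j \<psi> y)"
    and "integrable lebesgue (\<lambda>y. G y $ i $ j * \<psi> y)"
proof -
  obtain R where R: "\<And>x. norm x > R \<Longrightarrow> \<psi> x = 0" "\<And>x j. norm x > R \<Longrightarrow> partial j \<psi> x = 0"
    using test_function_support[OF \<psi>] by metis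
  have L: "v \<in> L2_loc" "G \<in> L2_loc" using v by (simp_all add: has_weak_gradient_def)
  show "integrable lebesgue (\<lambda>y. v y $ i * partial j \<psi> y)"
    by (rule L2_loc_mult_integrable[OF L(1) bounded_linear_vec_nth test_function_partial_continuous[OF \<psi>] R(2)])
  have "bounded_linear (\<lambda>M::real^3^3. M $ i $ j)"
    by (intro bounded_linear_compose[OF bounded_linear_vec_nth bounded_linear_vec_nth])
  then show "integrable lebesgue (\<lambda>y. G y $ i $ j * \<psi> y)"
    by (rule L2_loc_mult_integrable[OF L(2) _ test_function_continuous[OF \<psi>] R(1)])
qed

lemma has_weak_gradient_by_parts:
  assumes "has_weak_gradient v G" "\<psi> \<in> test_functions"
  shows "(LINT y|lebesgue. v y $ i * partial j \<psi> y) = - (LINT y|lebesgue. G y $ i $ j * \<psi> y)"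
proof -
  have "distr_partial j (\<lambda>y. v y $ i) \<psi> = (LINT y|lebesgue. G y $ i $ j * \<psi> y)"
    using assms by (simp add: has_weak_gradient_def)
  then show ?thesis by (simp add: distr_partial_def)
qed

lemma has_weak_gradient_add_scaleR:
  assumes u: "has_weak_gradient u U" and v: "has_weak_gradient v V"
  shows "has_weak_gradient (\<lambda>y. u y + c *\<^sub>R v y) (\<lambda>y. U y + c *\<^sub>R V y)"
  unfolding has_weak_gradient_def
proof (intro conjI ballI allI)
  show "(\<lambda>y. u y + c *\<^sub>R v y) \<in> L2_loc" "(\<lambda>y. U y + c *\<^sub>R V y) \<in> L2_loc"
    using u v by (auto simp: has_weak_gradient_def intro!: L2_loc_add L2_loc_scaleR)
  fix \<psi> i j assume \<psi>: "\<psi> \<in> test_functions"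
  show "distr_partial j (\<lambda>y. (u y + c *\<^sub>R v y) $ i) \<psi> = (LINT y|lebesgue. (U y + c *\<^sub>R V y) $ i $ j * \<psi> y)"
    using has_weak_gradient_integrable[OF u \<psi>, of i j] has_weak_gradient_integrable[OF v \<psi>, of i j]
      has_weak_gradient_by_parts[OF u \<psi>, of i j] has_weak_gradient_by_parts[OF v \<psi>, of i j]
    by (simp add: distr_partial_def distrib_right mult.assoc)
qed

lemma has_weak_gradient_AE_cong:
  assumes v: "has_weak_gradient v G" and v': "v' \<in> L2_loc" and eq: "AE y in lebesgue. v y = v' y"
  shows "has_weak_gradient v' G"
  unfolding has_weak_gradient_def
proof (intro conjI ballI allI v')
  have [measurable]: "v' \<in> borel_measurable lebesgue" using v' by (simp add: L2_loc_def)
  show "G \<in> L2_loc" using v by (simp add: has_weak_gradient_def)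
  fix \<psi> i j assume \<psi>: "\<psi> \<in> test_functions"
  have [measurable]: "partial j \<psi> \<in> borel_measurable lebesgue"
    using borel_measurable_continuous_onI[OF test_function_partial_continuous[OF \<psi>]]
    by (auto intro: measurable_completion)
  have "(LINT y|lebesgue. v' y $ i * partial j \<psi> y) = (LINT y|lebesgue. v y $ i * partial j \<psi> y)"
  proof (rule integral_cong_AE)
    show "(\<lambda>y. v y $ i * partial j \<psi> y) \<in> borel_measurable lebesgue"
      by (rule borel_measurable_integrable[OF has_weak_gradient_integrable(1)[OF v \<psi>]])
    show "AE y in lebesgue. v' y $ i * partial j \<psi> y = v y $ i * partial j \<psi> y"
      using eq by eventually_elim simp
  qed measurable
  then show "distr_partial j (\<lambda>y. v' y $ i) \<psi> = (LINT y|lebesgue. G y $ i $ j * \<psi> y)"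
    using has_weak_gradient_by_parts[OF v \<psi>, of i j] by (simp add: distr_partial_def)
qed

lemma has_weak_gradient_borelI:
  assumes L: "v \<in> L2_loc" "G \<in> L2_loc"
    and m: "v \<in> borel_measurable borel" "G \<in> borel_measurable borel"
    and grad: "\<And>\<psi> i j. \<psi> \<in> test_functions \<Longrightarrow>
       (LINT y|lborel. v y $ i * partial j \<psi> y) = - (LINT y|lborel. G y $ i $ j * \<psi> y)"
  shows "has_weak_gradient v G"
  unfolding has_weak_gradient_def
proof (intro conjI ballI allI L)
  fix \<psi> i j assume \<psi>: "\<psi> \<in> test_functions"
  note [measurable] = m
  have [measurable]: "\<psi> \<in> borel_measurable borel" "partial j \<psi> \<in> borel_measurable borel"
    using borel_measurable_continuous_onI[OF test_function_partial_continuous[OF \<psi>]]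
      borel_measurable_continuous_onI[OF test_function_continuous[OF \<psi>]] by auto
  have "(LINT y|lebesgue. v y $ i * partial j \<psi> y) = (LINT y|lborel. v y $ i * partial j \<psi> y)"
    "(LINT y|lebesgue. G y $ i $ j * \<psi> y) = (LINT y|lborel. G y $ i $ j * \<psi> y)"
    by (rule integral_completion, measurable)+
  with grad[OF \<psi>, of i j] show "distr_partial j (\<lambda>y. v y $ i) \<psi> = (LINT y|lebesgue. G y $ i $ j * \<psi> y)"
    by (simp add: distr_partial_def)
qed

lemma has_weak_gradient_linear: "has_weak_gradient (\<lambda>y. A *v y) (\<lambda>y. A)"
proof (rule has_weak_gradient_borelI)
  have cA: "continuous_on UNIV (\<lambda>y. A *v y)"
    by (intro linear_continuous_on matrix_vector_mul_bounded_linear)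
  then show "(\<lambda>y. A *v y) \<in> L2_loc" "(\<lambda>y. A *v y) \<in> borel_measurable borel"
    by (auto intro: L2_loc_continuous borel_measurable_continuous_onI)
  show "(\<lambda>y. A) \<in> L2_loc" by (rule L2_loc_continuous) simp
  fix \<psi> i j assume \<psi>: "\<psi> \<in> test_functions"
  have "bounded_linear (\<lambda>y. (A *v y) $ i)"
    by (intro bounded_linear_compose[OF bounded_linear_vec_nth] matrix_vector_mul_bounded_linear)
  then have d: "((\<lambda>y. (A *v y) $ i) has_derivative (\<lambda>h. (A *v h) $ i)) (at x)" for x
    by (rule bounded_linear_imp_has_derivative)
  have a: "(A *v axis j 1) $ i = A $ i $ j"
    by (simp add: matrix_vector_mult_basis column_def)
  show "(LINT y|lborel. (A *v y) $ i * partial j \<psi> y) = - (LINT y|lborel. A $ i $ j * \<psi> y)"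
    using integration_by_parts[OF d _ \<psi>, of j] by (simp add: a)
qed simp

lemma div_free_const: "div_free (\<lambda>y. S)"
proof -
  have "(LINT y|lebesgue. S $ i $ j * partial j \<phi> y) = 0" if \<phi>: "\<phi> \<in> test_functions" for i j \<phi>
  proof -
    have [measurable]: "partial j \<phi> \<in> borel_measurable borel"
      by (rule borel_measurable_continuous_onI[OF test_function_partial_continuous[OF \<phi>]])
    have "(LINT y|lborel. S $ i $ j * partial j \<phi> y) = 0"
      using integration_by_parts[of "\<lambda>_. S $ i $ j" "\<lambda>_ _. 0" j \<phi>] \<phi> by simp
    then show ?thesis by (subst integral_completion) auto
  qed
  then show ?thesis
    by (auto simp: div_free_def distr_div_def distr_partial_def vec_eq_iff intro!: sum.neutral)
qed

lemma div_free_AE_cong: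
  assumes "s \<in> borel_measurable lebesgue" "s' \<in> borel_measurable lebesgue"
    and eq: "AE y in lebesgue. s y = s' y"
  shows "div_free s \<longleftrightarrow> div_free s'"
proof -
  note [measurable] = assms(1,2)
  have "(LINT y|lebesgue. s y $ i $ j * partial j \<phi> y) = (LINT y|lebesgue. s' y $ i $ j * partial j \<phi> y)"
    if \<phi>: "\<phi> \<in> test_functions" for i j \<phi>
  proof -
    have [measurable]: "partial j \<phi> \<in> borel_measurable lebesgue"
      using borel_measurable_continuous_onI[OF test_function_partial_continuous[OF \<phi>]]
      by (auto intro: measurable_completion)
    show ?thesis using eq by (intro integral_cong_AE) (auto elim: eventually_mono)
  qed
  then show ?thesis by (simp add: div_free_def distr_div_def distr_partial_def)
qed

section \<open>Representatives\<close>

lemma borel_representative: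
  fixes f :: "'a::euclidean_space \<Rightarrow> 'b::euclidean_space"
  assumes f: "f \<in> borel_measurable lebesgue"
  obtains f0 where "f0 \<in> borel_measurable borel" "AE y in lborel. f y = f0 y"
proof -
  have "\<exists>u\<in>borel_measurable lborel. AE y in lborel. f y \<bullet> b = u y" for b :: 'b
    by (intro completion_ex_borel_measurable_real borel_measurable_inner[OF f borel_measurable_const])
  then obtain u where u: "\<And>b::'b. u b \<in> borel_measurable lborel" "\<And>b. AE y in lborel. f y \<bullet> b = u b y"
    by metis
  have "(\<lambda>y. \<Sum>b\<in>Basis. u b y *\<^sub>R b) \<in> borel_measurable borel"
    using u(1) by simp
  moreover have "AE y in lborel. f y = (\<Sum>b\<in>Basis. u b y *\<^sub>R b)"
  proof -
    have "AE y in lborel. \<forall>b\<in>Basis. f y \<bullet> b = u b y"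
      by (intro AE_finite_allI u(2)) simp
    then show ?thesis
    proof eventually_elim
      case (elim y)
      then have "(\<Sum>b\<in>Basis. u b y *\<^sub>R b) = (\<Sum>b\<in>Basis. (f y \<bullet> b) *\<^sub>R b)" by simp
      then show ?case by (simp add: euclidean_representation)
    qed
  qed
  ultimately show ?thesis using that by blast
qed

lemma AE_lborel_translate:
  fixes t :: "'a::euclidean_space"
  assumes "AE y in lborel. P y"
  shows "AE y in lborel. P (y + t)"
proof -
  obtain N where N: "N \<in> null_sets lborel" "{y. \<not> P y} \<subseteq> N"
    using assms by (auto simp: eventually_ae_filter)
  have "AE y in distr lborel borel ((+) t). y \<notin> N"
    unfolding lborel_distr_plus by (rule AE_not_in[OF N(1)])
  then have "AE y in lborel. t + y \<notin> N"
    using N(1) by (subst (asm) AE_distr_iff) auto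
  then show ?thesis
    by eventually_elim (use N(2) in \<open>auto simp: add.commute\<close>)
qed

context period_lattice
begin

text \<open>
  Choose a Borel representative and read it off at the representative point in the half-open cell.
  Almost every point is good for all lattice translations at once, as there are only countably many.
\<close>

lemma periodic_representative:
  fixes f :: "real^3 \<Rightarrow> 'b::euclidean_space"
  assumes f: "f \<in> borel_measurable lebesgue" and p: "periodic g f"
  obtains f1 where "f1 \<in> borel_measurable borel" "per f1" "AE y in lborel. f y = f1 y"
proof -
  obtain f0 where f0 [measurable]: "f0 \<in> borel_measurable borel" and eq: "AE y in lborel. f y = f0 y"
    using borel_representative[OF f] by blast
  have "AE y in lborel. \<forall>t\<in>\<Lambda>. f (y + t) = f y \<and> f (y + t) = f0 (y + t)"
  proof (rule AE_ball_countable'[OF _ countable_lattice])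
    fix t assume t: "t \<in> \<Lambda>"
    have "AE y in lborel. f (y + t) = f y"
      using p t by (simp add: periodic_def AE_completion_iff)
    with AE_lborel_translate[OF eq, of t] show "AE y in lborel. f (y + t) = f y \<and> f (y + t) = f0 (y + t)"
      by eventually_elim simp
  qed
  then have "AE y in lborel. f y = f0 (wrap y)"
  proof eventually_elim
    case (elim y)
    then have "f (y + - floor_pt y) = f y \<and> f (y + - floor_pt y) = f0 (y + - floor_pt y)"
      by (rule bspec) simp
    then have "f y = f0 (y + - floor_pt y)" by (elim conjE) (erule subst, assumption)
    then show ?case by (simp add: wrap_def)
  qed
  moreover have "per (\<lambda>y. f0 (wrap y))" by (simp add: per_def)
  ultimately show ?thesis by (intro that[of "\<lambda>y. f0 (wrap y)"]) auto
qed

lemma sq_int_of_L2_loc: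
  fixes f :: "real^3 \<Rightarrow> 'b::euclidean_space"
  assumes f: "f \<in> L2_loc" and [measurable]: "f1 \<in> borel_measurable borel" and eq: "AE y in lborel. f y = f1 y"
  shows "sq_int \<mu> f1"
proof -
  have [measurable]: "f1 \<in> borel_measurable lebesgue" by (auto intro: measurable_completion)
  obtain r where r: "cell g \<subseteq> cball 0 r" using cell_subset_cball by blast
  have "integrable lebesgue (\<lambda>y. indicator (cball 0 r) y *\<^sub>R (norm (f y))\<^sup>2)"
    using f by (auto simp: L2_loc_def set_integrable_def)
  moreover have [measurable]: "f \<in> borel_measurable lebesgue" "cball (0::real^3) r \<in> sets lebesgue"
    using f by (simp_all add: L2_loc_def)
  ultimately have "integrable lebesgue (\<lambda>y. indicator (cball 0 r) y *\<^sub>R (norm (f1 y))\<^sup>2)"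
    using eq by (subst integrable_cong_AE[where g="\<lambda>y. indicator (cball 0 r) y *\<^sub>R (norm (f y))\<^sup>2"])
      (auto simp: AE_completion_iff elim: eventually_mono)
  then have i: "integrable lborel (\<lambda>y. indicator (cball 0 r) y *\<^sub>R (norm (f1 y))\<^sup>2)"
    by (subst (asm) integrable_completion) auto
  have "integrable lborel (\<lambda>y. indicator cell0 y *\<^sub>R (norm (f1 y))\<^sup>2)"
    by (rule Bochner_Integration.integrable_bound[OF i])
      (use r cell0_subset_cell in \<open>auto simp: indicator_def subset_iff intro!: AE_I2\<close>)
  then show ?thesis by (simp add: sq_int_def integral_cell_measure(2))
qed

lemma L2_loc_of_sq_int:
  fixes f :: "real^3 \<Rightarrow> 'b::euclidean_space"
  assumes f: "sq_int \<mu> f" "per f"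
  shows "f \<in> L2_loc"
proof -
  have [measurable]: "f \<in> borel_measurable borel" using sq_int_measurable[OF f(1)] by simp
  have "set_integrable lebesgue K (\<lambda>y. (norm (f y))\<^sup>2)" if K: "compact K" for K
  proof -
    have [measurable]: "K \<in> sets borel" using K by (simp add: borel_compact)
    obtain R where R: "K \<subseteq> cball 0 R" using compact_imp_bounded[OF K] by (auto simp: bounded_iff subset_iff)
    have i: "integrable lborel (\<lambda>y. indicator (cball 0 R) y * (norm (f y))\<^sup>2)"
      using integrable_cball_of_cell[of "\<lambda>y. norm (f y)" R] sq_int_norm[OF f(1)] f(2) by (simp add: per_def)
    have "integrable lborel (\<lambda>y. indicator K y *\<^sub>R (norm (f y))\<^sup>2)"
      by (rule Bochner_Integration.integrable_bound[OF i]) (use R in \<open>auto simp: indicator_def subset_iff intro!: AE_I2\<close>)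
    then show ?thesis unfolding set_integrable_def by (subst integrable_completion) auto
  qed
  moreover have "f \<in> borel_measurable lebesgue" by (auto intro: measurable_completion)
  ultimately show ?thesis by (simp add: L2_loc_def)
qed

lemma per_imp_periodic: "per f \<Longrightarrow> periodic g f"
  by (simp add: periodic_def perD)

lemma cell_mean_eq:
  fixes f :: "real^3 \<Rightarrow> 'b::euclidean_space"
  assumes [measurable]: "f \<in> borel_measurable lebesgue" "f1 \<in> borel_measurable borel"
    and eq: "AE y in lborel. f y = f1 y"
  shows "cell_mean g f = (LINT y|\<mu>. f1 y)"
proof -
  have [measurable]: "f1 \<in> borel_measurable lebesgue" by (auto intro: measurable_completion)
  have [measurable]: "cell g \<in> sets lebesgue" "cell0 \<in> sets lebesgue"
    by (simp_all add: sets_completionI_sets)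
  have "measure lebesgue (cell g) = measure lborel cell0"
    using AE_cell_iff_cell0 by (simp add: measure_eq_AE)
  moreover have "(LINT y:cell g|lebesgue. f y) = (LINT y|lebesgue. indicator cell0 y *\<^sub>R f1 y)"
    unfolding set_lebesgue_integral_def
  proof (rule integral_cong_AE)
    show "AE y in lebesgue. indicator (cell g) y *\<^sub>R f y = indicator cell0 y *\<^sub>R f1 y"
      using AE_cell_iff_cell0 eq unfolding AE_completion_iff by eventually_elim (auto simp: indicator_def)
  qed measurable
  moreover have "(LINT y|lebesgue. indicator cell0 y *\<^sub>R f1 y) = (LINT y|lborel. indicator cell0 y *\<^sub>R f1 y)"
    by (rule integral_completion) measurable
  ultimately show ?thesis by (simp add: cell_mean_def integral_cell_measure(1) cell_vol_def)
qed

lemma L2_per_sym_representative: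
  assumes e: "e \<in> L2_per_sym g"
  obtains f where "sq_int \<mu> f" "per f" "\<And>y. transpose (f y) = f y" "AE y in lborel. e y = f y"
proof -
  have em: "e \<in> borel_measurable lebesgue" and eL: "e \<in> L2_loc" and ep: "periodic g e"
    and es: "AE y in lborel. transpose (e y) = e y"
    using e by (auto simp: L2_per_sym_def L2_loc_def AE_completion_iff)
  obtain f0 where f0: "f0 \<in> borel_measurable borel" "per f0" "AE y in lborel. e y = f0 y"
    using periodic_representative[OF em ep] by blast
  have "sq_int \<mu> f0" by (rule sq_int_of_L2_loc[OF eL f0(1,3)])
  then have "sq_int \<mu> (\<lambda>y. sym_part (f0 y))"
    by (rule sq_int_bounded_linear[OF bounded_linear_sym_part])
  moreover have "per (\<lambda>y. sym_part (f0 y))" using f0(2) by (simp add: per_def)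
  moreover have "AE y in lborel. e y = sym_part (f0 y)"
    using es f0(3) by eventually_elim (metis sym_part_eq)
  ultimately show ?thesis by (intro that[of "\<lambda>y. sym_part (f0 y)"]) (auto simp: transpose_sym_part)
qed

lemma cell_mean_inner_eq:
  assumes "e \<in> borel_measurable lebesgue" "s \<in> borel_measurable lebesgue"
    and "sq_int \<mu> f" "sq_int \<mu> h"
    and ef: "AE y in lborel. e y = f y" and sh: "AE y in lborel. s y = h y"
  shows "cell_mean g (\<lambda>y. e y \<bullet> s y) = (LINT y|\<mu>. f y \<bullet> h y)"
proof (rule cell_mean_eq)
  note [measurable] = assms(1,2)
  have [measurable]: "f \<in> borel_measurable borel" "h \<in> borel_measurable borel"
    using sq_int_measurable[OF assms(3)] sq_int_measurable[OF assms(4)] by simp_all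
  show "(\<lambda>y. e y \<bullet> s y) \<in> borel_measurable lebesgue" "(\<lambda>y. f y \<bullet> h y) \<in> borel_measurable borel" by measurable
  show "AE y in lborel. e y \<bullet> s y = f y \<bullet> h y" using ef sh by eventually_elim simp
qed

section \<open>Symmetrised gradients are orthogonal to divergence-free fields\<close>

text \<open>
  Periodicity of \<open>\<phi>\<close>, \<open>s\<close> and the symmetric part \<open>f\<close> carries the argument. The full gradient \<open>H\<close> enters
  only through integrals over the space against test functions, where it is at once traded for \<open>\<phi>\<close>
  with a derivative on \<open>\<rho>\<close>; interchanging the integrations then moves that derivative to \<open>s\<close>.
\<close>

lemma mollified_orthogonality:
  fixes f s :: "real^3 \<Rightarrow> real^3^3" and \<phi> :: "real^3 \<Rightarrow> real^3" and H :: "real^3 \<Rightarrow> real^3^3"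
  assumes f: "sq_int \<mu> f" "per f"
    and s: "sq_int \<mu> s" "per s" "\<And>y. transpose (s y) = s y" "div_free s"
    and \<phi>: "sq_int \<mu> \<phi>" "per \<phi>"
    and grad: "has_weak_gradient \<phi> H"
    and fH: "AE y in lebesgue. f y = sym_part (H y)"
    and \<rho>: "\<rho> \<in> test_functions"
  shows "(\<Sum>i\<in>UNIV. \<Sum>j\<in>UNIV. LINT w|\<mu>. s w $ i $ j * (LINT y|lborel. \<rho> (w - y) * f y $ i $ j)) = 0"
proof -
  have fin: "finite_measure \<mu>" by (rule cell.finite_measure_axioms)
  have [measurable]: "f \<in> borel_measurable borel" "s \<in> borel_measurable borel" "\<phi> \<in> borel_measurable borel"
    using sq_int_measurable[OF f(1)] sq_int_measurable[OF s(1)] sq_int_measurable[OF \<phi>(1)] by simp_all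
  have [measurable]: "\<rho> \<in> borel_measurable borel"
    by (rule borel_measurable_continuous_onI[OF test_function_continuous[OF \<rho>]])
  have d\<rho> [measurable]: "partial j \<rho> \<in> borel_measurable borel" for j
    by (rule borel_measurable_continuous_onI[OF test_function_partial_continuous[OF \<rho>]])
  obtain R where R: "\<And>x. norm x > R \<Longrightarrow> \<rho> x = 0" "\<And>x j. norm x > R \<Longrightarrow> partial j \<rho> x = 0"
    using test_function_support[OF \<rho>] by metis
  have comp: "integrable \<mu> (\<lambda>y. f y $ i $ j)" "integrable \<mu> (\<lambda>y. s y $ i $ j)"
    "integrable \<mu> (\<lambda>y. \<phi> y $ i)" for i j
    using sq_int_integrable[OF fin sq_int_nth[OF sq_int_nth[OF f(1)]]]
      sq_int_integrable[OF fin sq_int_nth[OF sq_int_nth[OF s(1)]]]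
      sq_int_integrable[OF fin sq_int_nth[OF \<phi>(1)]] by auto
  have compp: "per (\<lambda>y. f y $ i $ j)" "per (\<lambda>y. s y $ i $ j)" "per (\<lambda>y. \<phi> y $ i)" for i j
    using f(2) s(2) \<phi>(2) by (simp_all add: per_def)
  note Fub = periodic_kernel_Fubini[OF compp(2) comp(2) compp(1) comp(1) test_function_continuous[OF \<rho>] R(1)]
  note Fub' = periodic_kernel_Fubini[OF compp(2) comp(2) compp(3) comp(3) test_function_partial_continuous[OF \<rho>] R(2)]
  have local: "(\<Sum>i\<in>UNIV. \<Sum>j\<in>UNIV. s w $ i $ j * (LINT y|lborel. \<rho> (w - y) * f y $ i $ j))
      = (\<Sum>i\<in>UNIV. \<Sum>j\<in>UNIV. s w $ i $ j * (LINT y|lborel. partial j \<rho> (w - y) * \<phi> y $ i))" for w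
  proof -
    define \<psi> where "\<psi> y = \<rho> (w + (-1) *\<^sub>R y)" for y
    have \<psi>: "\<psi> \<in> test_functions" unfolding \<psi>_def by (rule test_functions_affine[OF \<rho>]) simp
    have \<psi>': "partial j \<psi> y = - partial j \<rho> (w - y)" for j y
      using partial_affine(1)[OF test_function_differentiable[OF \<rho>], where a=w and c="-1" and x=y and j=j] by (simp add: \<psi>_def[abs_def])
    define h where "h i j = (LINT y|lebesgue. H y $ i $ j * \<psi> y)" for i j
    have h: "h i j = (LINT y|lborel. partial j \<rho> (w - y) * \<phi> y $ i)" for i j
    proof -
      have "(LINT y|lebesgue. \<phi> y $ i * partial j \<psi> y) = (LINT y|lborel. \<phi> y $ i * partial j \<psi> y)"
        unfolding \<psi>' by (rule integral_completion) measurable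
      with has_weak_gradient_by_parts[OF grad \<psi>, of i j] show ?thesis
        by (simp add: \<psi>' h_def mult.commute)
    qed
    have fh: "(LINT y|lborel. \<rho> (w - y) * f y $ i $ j) = (h i j + h j i) / 2" for i j
    proof -
      have [measurable]: "\<psi> \<in> borel_measurable lebesgue"
        using borel_measurable_continuous_onI[OF test_function_continuous[OF \<psi>]] by (auto intro: measurable_completion)
      have "(LINT y|lborel. \<rho> (w - y) * f y $ i $ j) = (LINT y|lebesgue. \<rho> (w - y) * f y $ i $ j)"
        by (rule integral_completion[symmetric]) measurable
      also have "\<dots> = (LINT y|lebesgue. (H y $ i $ j * \<psi> y + H y $ j $ i * \<psi> y) / 2)"
      proof (rule integral_cong_AE)
        show "(\<lambda>y. \<rho> (w - y) * f y $ i $ j) \<in> borel_measurable lebesgue"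
          by (rule measurable_completion) measurable
        show "(\<lambda>y. (H y $ i $ j * \<psi> y + H y $ j $ i * \<psi> y) / 2) \<in> borel_measurable lebesgue"
          using has_weak_gradient_integrable(2)[OF grad \<psi>, THEN borel_measurable_integrable] by measurable
        show "AE y in lebesgue. \<rho> (w - y) * f y $ i $ j = (H y $ i $ j * \<psi> y + H y $ j $ i * \<psi> y) / 2"
          using fH by eventually_elim (simp add: sym_part_nth \<psi>_def field_simps)
      qed
      also have "\<dots> = (h i j + h j i) / 2"
        using has_weak_gradient_integrable(2)[OF grad \<psi>] by (simp add: h_def)
      finally show ?thesis .
    qed
    (* symmetry of s removes the symmetric part, so H itself may be used *)
    have "(\<Sum>i\<in>UNIV. \<Sum>j\<in>UNIV. s w $ i $ j * ((h i j + h j i) / 2)) = sym_part (\<chi> i j. h i j) \<bullet> s w"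
      by (simp add: matrix_inner_eq_sum sym_part_nth mult.commute)
    also have "\<dots> = (\<chi> i j. h i j) \<bullet> s w" by (rule sym_part_inner[OF s(3)])
    also have "\<dots> = (\<Sum>i\<in>UNIV. \<Sum>j\<in>UNIV. s w $ i $ j * h i j)"
      by (simp add: matrix_inner_eq_sum mult.commute)
    finally show ?thesis by (simp only: fh h)
  qed
  have "(\<Sum>i\<in>UNIV. \<Sum>j\<in>UNIV. LINT w|\<mu>. s w $ i $ j * (LINT y|lborel. \<rho> (w - y) * f y $ i $ j))
      = (LINT w|\<mu>. (\<Sum>i\<in>UNIV. \<Sum>j\<in>UNIV. s w $ i $ j * (LINT y|lborel. \<rho> (w - y) * f y $ i $ j)))"
    using Fub(2) by simp
  also have "\<dots> = (\<Sum>i\<in>UNIV. \<Sum>j\<in>UNIV. LINT w|\<mu>. s w $ i $ j * (LINT y|lborel. partial j \<rho> (w - y) * \<phi> y $ i))"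
    unfolding local using Fub'(2) by simp
  also have "\<dots> = (\<Sum>i\<in>UNIV. \<Sum>j\<in>UNIV. LINT y|\<mu>. \<phi> y $ i * (LINT w|lborel. partial j \<rho> (w - y) * s w $ i $ j))"
    by (simp only: Fub'(1))
  also have "\<dots> = (\<Sum>i\<in>UNIV. LINT y|\<mu>. \<phi> y $ i * (\<Sum>j\<in>UNIV. LINT w|lborel. partial j \<rho> (w - y) * s w $ i $ j))"
    using Fub'(3) by (simp add: sum_distrib_left)
  also have "\<dots> = 0"
  proof -
    (* this is the divergence of s tested with the translate of \<rho> by y *)
    have "(\<Sum>j\<in>UNIV. LINT w|lborel. partial j \<rho> (w - y) * s w $ i $ j) = 0" for i y
    proof -
      define \<psi> where "\<psi> w = \<rho> (- y + 1 *\<^sub>R w)" for w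
      have \<psi>: "\<psi> \<in> test_functions" unfolding \<psi>_def by (rule test_functions_affine[OF \<rho>]) simp
      have \<psi>': "partial j \<psi> w = partial j \<rho> (w - y)" for j w
        using partial_affine(1)[OF test_function_differentiable[OF \<rho>], where a="- y" and c=1 and x=w and j=j] by (simp add: \<psi>_def[abs_def])
      have "(\<Sum>j\<in>UNIV. LINT w|lebesgue. s w $ i $ j * partial j \<psi> w) = 0"
        using s(4) \<psi> by (simp add: div_free_def distr_div_def distr_partial_def vec_eq_iff sum_negf)
      moreover have "(LINT w|lebesgue. s w $ i $ j * partial j \<psi> w) = (LINT w|lborel. partial j \<rho> (w - y) * s w $ i $ j)" for j
        unfolding \<psi>' by (subst integral_completion) (auto simp: mult.commute)
      ultimately show ?thesis by simp
    qed
    then show ?thesis by simp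
  qed
  finally show ?thesis .
qed

text \<open>
  The mollified pairings vanish; let the support of the mollifier shrink. The mollifier is not
  normalised, so its mass \<open>m\<close> is carried along and cancelled at the end.
\<close>

lemma sym_gradient_orthogonal:
  fixes f s :: "real^3 \<Rightarrow> real^3^3" and \<phi> :: "real^3 \<Rightarrow> real^3" and H :: "real^3 \<Rightarrow> real^3^3"
  assumes f: "sq_int \<mu> f" "per f"
    and s: "sq_int \<mu> s" "per s" "\<And>y. transpose (s y) = s y" "div_free s"
    and \<phi>: "sq_int \<mu> \<phi>" "per \<phi>"
    and grad: "has_weak_gradient \<phi> H"
    and fH: "AE y in lebesgue. f y = sym_part (H y)"
  shows "(LINT y|\<mu>. f y \<bullet> s y) = 0"
proof -
  define A where "A i j = (LINT w|\<mu>. (s w $ i $ j)\<^sup>2)" for i j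
  have A: "A i j \<ge> 0" for i j by (simp add: A_def)
  define I where "I = (\<Sum>i\<in>UNIV. \<Sum>j\<in>UNIV. LINT w|\<mu>. s w $ i $ j * f w $ i $ j)"
  have fc: "sq_int \<mu> (\<lambda>y. f y $ i $ j)" "per (\<lambda>y. f y $ i $ j)" for i j
    using sq_int_nth[OF sq_int_nth[OF f(1)]] f(2) by (auto simp: per_def)
  have sc: "sq_int \<mu> (\<lambda>y. s y $ i $ j)" "per (\<lambda>y. s y $ i $ j)" for i j
    using sq_int_nth[OF sq_int_nth[OF s(1)]] s(2) by (auto simp: per_def)
  have I_eq: "(LINT y|\<mu>. f y \<bullet> s y) = I"
    using sq_int_inner[OF sc(1) fc(1)] by (simp add: I_def matrix_inner_eq_sum mult.commute)
  have bound: "\<bar>I\<bar> \<le> (\<Sum>i\<in>UNIV. \<Sum>j\<in>UNIV. sqrt (A i j * \<eta>))" if "\<eta> > 0" for \<eta>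
  proof -
    have near: "\<forall>i j. \<exists>\<epsilon>>0. \<forall>z. norm z < \<epsilon> \<longrightarrow> (LINT w|\<mu>. (f w $ i $ j - f (w - z) $ i $ j)\<^sup>2) \<le> \<eta>"
    proof (intro allI)
      fix i j :: 3
      obtain \<epsilon> where "\<epsilon> > 0" "\<And>z. norm z < \<epsilon> \<Longrightarrow> (LINT w|\<mu>. (f w $ i $ j - f (w - z) $ i $ j)\<^sup>2) \<le> \<eta>"
        using L2_translation_continuous[OF fc \<open>\<eta> > 0\<close>, of i j] by blast
      then show "\<exists>\<epsilon>>0. \<forall>z. norm z < \<epsilon> \<longrightarrow> (LINT w|\<mu>. (f w $ i $ j - f (w - z) $ i $ j)\<^sup>2) \<le> \<eta>"
        by blast
    qed
    have choice2: "(\<forall>i j. \<exists>\<epsilon>. P i j \<epsilon>) \<Longrightarrow> \<exists>E. \<forall>i j. P i j (E i j)" for P :: "3 \<Rightarrow> 3 \<Rightarrow> real \<Rightarrow> bool"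
      by metis
    obtain E where E: "\<And>i j. E i j > 0"
      "\<And>i j z. norm z < E i j \<Longrightarrow> (LINT w|\<mu>. (f w $ i $ j - f (w - z) $ i $ j)\<^sup>2) \<le> \<eta>"
      using choice2[OF near] by blast
    define \<epsilon> where "\<epsilon> = Min (range (\<lambda>(i, j). E i j))"
    have \<epsilon>: "\<epsilon> > 0" using E(1) by (auto simp: \<epsilon>_def)
    have \<epsilon>_le: "\<epsilon> \<le> E i j" for i j unfolding \<epsilon>_def by (rule Min_le) auto
    obtain \<rho> where \<rho>: "\<rho> \<in> test_functions" "\<And>x. \<rho> x \<ge> 0" "\<And>x. norm x \<ge> \<epsilon> \<Longrightarrow> \<rho> x = 0"
      "(LINT x|lborel. \<rho> x) > 0"
      using bump_exists[OF \<epsilon>] by blast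
    define m where "m = (LINT x|lborel. \<rho> x)"
    (* mollified pairings of the components *)
    define k where "k i j = (LINT w|\<mu>. s w $ i $ j * (LINT y|lborel. \<rho> (w - y) * f y $ i $ j))" for i j
    have "\<bar>k i j - m * (LINT w|\<mu>. s w $ i $ j * f w $ i $ j)\<bar> \<le> m * sqrt (A i j * \<eta>)" for i j
      unfolding k_def m_def A_def
      by (rule mollification_error[OF sc fc test_function_continuous[OF \<rho>(1)] \<rho>(2,3)])
        (auto intro: E(2) less_le_trans[OF _ \<epsilon>_le])
    then have "(\<Sum>i\<in>UNIV. \<Sum>j\<in>UNIV. \<bar>k i j - m * (LINT w|\<mu>. s w $ i $ j * f w $ i $ j)\<bar>)
        \<le> (\<Sum>i\<in>UNIV. \<Sum>j\<in>UNIV. m * sqrt (A i j * \<eta>))"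
      by (intro sum_mono)
    moreover have "\<bar>\<Sum>i\<in>UNIV. \<Sum>j\<in>UNIV. k i j - m * (LINT w|\<mu>. s w $ i $ j * f w $ i $ j)\<bar>
        \<le> (\<Sum>i\<in>UNIV. \<Sum>j\<in>UNIV. \<bar>k i j - m * (LINT w|\<mu>. s w $ i $ j * f w $ i $ j)\<bar>)"
      by (intro order_trans[OF sum_abs] sum_mono order_refl sum_abs)
    moreover have "(\<Sum>i\<in>UNIV. \<Sum>j\<in>UNIV. k i j - m * (LINT w|\<mu>. s w $ i $ j * f w $ i $ j)) = - (m * I)"
      using mollified_orthogonality[OF f s \<phi> grad fH \<rho>(1)]
      by (simp add: k_def I_def sum_subtractf sum_distrib_left)
    ultimately have "m * \<bar>I\<bar> \<le> m * (\<Sum>i\<in>UNIV. \<Sum>j\<in>UNIV. sqrt (A i j * \<eta>))"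
      using \<rho>(4) by (simp add: abs_mult m_def sum_distrib_left)
    then show ?thesis using \<rho>(4) by (simp add: m_def)
  qed
  have "((\<lambda>\<eta>. \<Sum>i\<in>UNIV. \<Sum>j\<in>UNIV. sqrt (A i j * \<eta>)) \<longlongrightarrow> (\<Sum>i\<in>(UNIV::3 set). \<Sum>j\<in>(UNIV::3 set). sqrt (A i j * 0))) (at_right 0)"
    by (intro tendsto_intros)
  (* the bound holds for every \<eta> > 0, hence for the limit 0 *)
  then have "\<bar>I\<bar> \<le> (\<Sum>i\<in>(UNIV::3 set). \<Sum>j\<in>(UNIV::3 set). sqrt (A i j * 0))"
    by (rule tendsto_lowerbound) (auto simp: eventually_at_right_field bound intro!: exI[of _ 1])
  then show ?thesis using I_eq by simp
qed

text \<open>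
  Test with the constant field whose value is the mean of \<open>f\<close>.
\<close>

lemma sym_gradient_mean_zero:
  fixes f :: "real^3 \<Rightarrow> real^3^3" and \<phi> :: "real^3 \<Rightarrow> real^3" and H :: "real^3 \<Rightarrow> real^3^3"
  assumes f: "sq_int \<mu> f" "per f" "\<And>y. transpose (f y) = f y"
    and \<phi>: "sq_int \<mu> \<phi>" "per \<phi>"
    and grad: "has_weak_gradient \<phi> H"
    and fH: "AE y in lebesgue. f y = sym_part (H y)"
  shows "(LINT y|\<mu>. f y) = 0"
proof -
  define S where "S = (LINT y|\<mu>. f y)"
  have fi: "integrable \<mu> f" by (rule sq_int_integrable[OF cell.finite_measure_axioms f(1)])
  have "transpose S = S" unfolding S_def by (rule transpose_integral[OF fi f(3)])
  then have "(LINT y|\<mu>. f y \<bullet> S) = 0"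
    by (intro sym_gradient_orthogonal[OF f(1,2) sq_int_const[OF cell.finite_measure_axioms] _ _ div_free_const \<phi> grad fH])
      (simp_all add: per_def)
  moreover have "(LINT y|\<mu>. f y \<bullet> S) = S \<bullet> S" using fi by (simp add: S_def)
  ultimately show ?thesis by (simp add: S_def)
qed

end

section \<open>Inequalities of Korn and Poincare\<close>

context period_lattice
begin

definition C1_per :: "(real^3 \<Rightarrow> real) \<Rightarrow> (real^3 \<Rightarrow> real^3) \<Rightarrow> bool" where
  "C1_per P D \<longleftrightarrow> per P \<and> (\<forall>x. (P has_derivative (\<lambda>h. D x \<bullet> h)) (at x)) \<and> continuous_on UNIV D"

lemma C1_per_per_deriv: "C1_per P D \<Longrightarrow> per D"
  unfolding per_def
proof (intro ballI allI)
  fix t y assume P: "C1_per P D" and t: "t \<in> \<Lambda>"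
  have "((\<lambda>y. y + t) has_derivative (\<lambda>h. h)) (at y)" by (auto intro!: derivative_eq_intros)
  moreover have "(P has_derivative (\<lambda>h. D (y + t) \<bullet> h)) (at (y + t))" using P by (simp add: C1_per_def)
  ultimately have "((\<lambda>y. P (y + t)) has_derivative (\<lambda>h. D (y + t) \<bullet> h)) (at y)"
    by (rule has_derivative_compose)
  moreover have "(\<lambda>y. P (y + t)) = P" using P t by (simp add: C1_per_def per_def)
  ultimately have "(P has_derivative (\<lambda>h. D (y + t) \<bullet> h)) (at y)" by simp
  moreover have "(P has_derivative (\<lambda>h. D y \<bullet> h)) (at y)" using P by (simp add: C1_per_def)
  ultimately have "(\<lambda>h. D (y + t) \<bullet> h) = (\<lambda>h. D y \<bullet> h)" by (rule has_derivative_unique)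
  then have "D (y + t) \<bullet> h = D y \<bullet> h" for h by meson
  then have "(D (y + t) - D y) \<bullet> (D (y + t) - D y) = 0" by (simp add: inner_diff_left)
  then show "D (y + t) = D y" by simp
qed

lemma C1_per_continuous: "C1_per P D \<Longrightarrow> continuous_on UNIV P"
  unfolding C1_per_def by (auto intro!: continuous_at_imp_continuous_on has_derivative_continuous)

lemma C1_per_sq_int:
  assumes "C1_per P D"
  shows "sq_int \<mu> P" "sq_int \<mu> D"
proof -
  have c: "continuous_on UNIV P" "continuous_on UNIV D" "per P"
    using assms C1_per_continuous by (auto simp: C1_per_def)
  obtain B where "\<And>x. norm (P x) \<le> B" using per_bounded[OF c(3,1)] by blast
  then show "sq_int \<mu> P"
    using borel_measurable_continuous_onI[OF c(1)] by (intro sq_int_bounded cell.finite_measure_axioms) auto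
  obtain B where "\<And>x. norm (D x) \<le> B" using per_bounded[OF C1_per_per_deriv[OF assms] c(2)] by blast
  then show "sq_int \<mu> D"
    using borel_measurable_continuous_onI[OF c(2)] by (intro sq_int_bounded cell.finite_measure_axioms) auto
qed

lemma C1_per_add: "C1_per P D \<Longrightarrow> C1_per Q E \<Longrightarrow> C1_per (\<lambda>x. P x + Q x) (\<lambda>x. D x + E x)"
  by (auto simp: C1_per_def per_def inner_add_left intro!: has_derivative_add continuous_intros)

lemma C1_per_scale: "C1_per P D \<Longrightarrow> C1_per (\<lambda>x. c * P x) (\<lambda>x. c *\<^sub>R D x)"
  by (auto simp: C1_per_def per_def intro!: has_derivative_mult_right continuous_intros)

lemma C1_per_const: "C1_per (\<lambda>x. c) (\<lambda>x. 0)"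
  by (auto simp: C1_per_def per_def)

text \<open>
  For smooth functions this is two integrations by parts. The discrete analogue holds exactly: with
  \<open>J(z, u) = \<integral> P(x + z) Q(x + u) d\<mu>(x)\<close>, which depends only on \<open>u - z\<close>, the product of the forward
  difference quotients of \<open>P\<close> along \<open>a\<close> and of \<open>Q\<close> along \<open>b\<close> has the same integral as the product of the
  backward ones of \<open>P\<close> along \<open>b\<close> and of \<open>Q\<close> along \<open>a\<close>. Only first derivatives appear in the limit,
  so \<open>C\<^sup>1\<close> functions suffice.
\<close>

lemma exchange_derivatives:
  assumes P: "C1_per P D" and Q: "C1_per Q E"
  shows "(LINT x|\<mu>. (D x \<bullet> a) * (E x \<bullet> b)) = (LINT x|\<mu>. (D x \<bullet> b) * (E x \<bullet> a))"
proof -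
  have fin: "finite_measure \<mu>" by (rule cell.finite_measure_axioms)
  have dP: "(P has_derivative (\<lambda>h. D x \<bullet> h)) (at x)" and dQ: "(Q has_derivative (\<lambda>h. E x \<bullet> h)) (at x)" for x
    using P Q by (auto simp: C1_per_def)
  have p: "per P" "per Q" using P Q by (auto simp: C1_per_def)
  have cont: "continuous_on UNIV P" "continuous_on UNIV Q" "continuous_on UNIV D" "continuous_on UNIV E"
    using P Q C1_per_continuous by (auto simp: C1_per_def)
  note [measurable] = cont[THEN borel_measurable_continuous_onI]
  obtain BD where BD: "\<And>x. norm (D x) \<le> BD" using per_bounded[OF C1_per_per_deriv[OF P] cont(3)] by blast
  obtain BE where BE: "\<And>x. norm (E x) \<le> BE" using per_bounded[OF C1_per_per_deriv[OF Q] cont(4)] by blast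
  have D_le: "\<bar>D x \<bullet> c\<bar> \<le> BD * norm c" and E_le: "\<bar>E x \<bullet> c\<bar> \<le> BE * norm c" for x c
    using Cauchy_Schwarz_ineq2[of "D x" c] Cauchy_Schwarz_ineq2[of "E x" c]
      mult_right_mono[OF BD, of "norm c" x] mult_right_mono[OF BE, of "norm c" x] by simp_all
  have lim: "(\<lambda>n. LINT x|\<mu>. ((P (x + h n *\<^sub>R c) - P x) / h n) * ((Q (x + h n *\<^sub>R d) - Q x) / h n))
      \<longlonglongrightarrow> (LINT x|\<mu>. (D x \<bullet> c) * (E x \<bullet> d))"
    if h: "h \<longlonglongrightarrow> 0" "\<And>n. h n \<noteq> 0" for h c d
  proof (rule integral_dominated_convergence[where w="\<lambda>_. (BD * norm c) * (BE * norm d)"])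
    show "AE x in \<mu>. (\<lambda>n. ((P (x + h n *\<^sub>R c) - P x) / h n) * ((Q (x + h n *\<^sub>R d) - Q x) / h n))
        \<longlonglongrightarrow> (D x \<bullet> c) * (E x \<bullet> d)"
      by (intro AE_I2 tendsto_mult difference_quotient_tendsto[OF dP h] difference_quotient_tendsto[OF dQ h])
    show "AE x in \<mu>. norm (((P (x + h n *\<^sub>R c) - P x) / h n) * ((Q (x + h n *\<^sub>R d) - Q x) / h n))
        \<le> (BD * norm c) * (BE * norm d)" for n
    proof (rule AE_I2)
      fix x
      have "\<bar>(P (x + h n *\<^sub>R c) - P x) / h n\<bar> * \<bar>(Q (x + h n *\<^sub>R d) - Q x) / h n\<bar> \<le> (BD * norm c) * (BE * norm d)"
        by (intro mult_mono difference_quotient_bound[OF dP D_le] difference_quotient_bound[OF dQ E_le])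
          (use order_trans[OF norm_ge_zero BD] in auto)
      then show "norm (((P (x + h n *\<^sub>R c) - P x) / h n) * ((Q (x + h n *\<^sub>R d) - Q x) / h n))
        \<le> (BD * norm c) * (BE * norm d)" by (simp add: abs_mult)
    qed
  qed (use fin in \<open>auto intro!: finite_measure.integrable_const\<close>)
  (* J z u depends on the difference u - z only *)
  define J where "J z u = (LINT x|\<mu>. P (x + z) * Q (x + u))" for z u
  have J_int: "integrable \<mu> (\<lambda>x. P (x + z) * Q (x + u))" for z u
    using sq_int_inner[OF sq_int_translate(1)[OF C1_per_sq_int(1)[OF P] p(1)]
        sq_int_translate(1)[OF C1_per_sq_int(1)[OF Q] p(2)]] by simp
  have J: "J (z + v) (u + v) = J z u" for z u v
  proof -
    have "per (\<lambda>x. P (x + z) * Q (x + u))"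
      unfolding per_def by (auto simp: perD[OF p(1)] perD[OF p(2)] add.assoc add.commute[of _ z] add.commute[of _ u] simp flip: add.assoc)
    from integral_cell_translation(1)[OF _ this, of v] show ?thesis
      by (simp add: J_def ac_simps)
  qed
  have J_int0: "integrable \<mu> (\<lambda>x. P x * Q (x + u))" "integrable \<mu> (\<lambda>x. P (x + u) * Q x)"
    "integrable \<mu> (\<lambda>x. P x * Q x)" for u
    using J_int[of 0 u] J_int[of u 0] J_int[of 0 0] by simp_all
  have expand: "(LINT x|\<mu>. ((P (x + z) - P x) / h) * ((Q (x + u) - Q x) / h))
      = (J z u - J z 0 - J 0 u + J 0 0) / h\<^sup>2" for z u h
  proof -
    have "((P (x + z) - P x) / h) * ((Q (x + u) - Q x) / h)
        = (P (x + z) * Q (x + u) - P (x + z) * Q x - P x * Q (x + u) + P x * Q x) / h\<^sup>2" for x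
      by (simp add: power2_eq_square algebra_simps diff_divide_distrib add_divide_distrib)
    then show ?thesis by (simp add: J_def J_int J_int0)
  qed
  define h where "h n = 1 / real (Suc n)" for n
  have h: "h \<longlonglongrightarrow> 0" "\<And>n. h n \<noteq> 0" unfolding h_def by (rule LIMSEQ_Suc[OF lim_1_over_n]) simp
  have h': "(\<lambda>n. - h n) \<longlonglongrightarrow> 0" "\<And>n. - h n \<noteq> 0" using tendsto_minus[OF h(1)] h(2) by simp_all
  have "(LINT x|\<mu>. ((P (x + h n *\<^sub>R a) - P x) / h n) * ((Q (x + h n *\<^sub>R b) - Q x) / h n))
      = (LINT x|\<mu>. ((P (x + (- h n) *\<^sub>R b) - P x) / (- h n)) * ((Q (x + (- h n) *\<^sub>R a) - Q x) / (- h n)))" for n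
  proof -
    define \<alpha> \<beta> where "\<alpha> = h n *\<^sub>R a" "\<beta> = h n *\<^sub>R b"
    have "J \<alpha> \<beta> = J (- \<beta>) (- \<alpha>)" using J[of "- \<beta>" "\<alpha> + \<beta>" "- \<alpha>"] by simp
    moreover have "J \<alpha> 0 = J 0 (- \<alpha>)" using J[of 0 \<alpha> "- \<alpha>"] by simp
    moreover have "J 0 \<beta> = J (- \<beta>) 0" using J[of "- \<beta>" \<beta> 0] by simp
    ultimately show ?thesis
      unfolding expand by (simp add: \<alpha>_\<beta>_def)
  qed
  with lim[OF h, of a b] lim[OF h', of b a] show ?thesis
    by (simp only: LIMSEQ_unique)
qed

text \<open>
  Split the step \<open>z\<close> into \<open>n\<close> equal steps. By the Cauchy--Schwarz inequality for sums and translation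
  invariance the left-hand side is at most the mean square of the difference quotient at step \<open>z / n\<close>,
  for every \<open>n\<close>; let \<open>n\<close> tend to infinity.
\<close>

lemma poincare_translation:
  assumes P: "C1_per P D"
  shows "(LINT x|\<mu>. (P (x + z) - P x)\<^sup>2) \<le> (norm z)\<^sup>2 * (LINT x|\<mu>. (norm (D x))\<^sup>2)"
proof -
  have fin: "finite_measure \<mu>" by (rule cell.finite_measure_axioms)
  have dP: "(P has_derivative (\<lambda>h. D x \<bullet> h)) (at x)" for x using P by (auto simp: C1_per_def)
  have p: "per P" using P by (auto simp: C1_per_def)
  have cont: "continuous_on UNIV P" "continuous_on UNIV D"
    using P C1_per_continuous by (auto simp: C1_per_def)
  note [measurable] = cont[THEN borel_measurable_continuous_onI]
  obtain B where B: "\<And>x. norm (D x) \<le> B" using per_bounded[OF C1_per_per_deriv[OF P] cont(2)] by blast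
  have D_le: "\<bar>D x \<bullet> z\<bar> \<le> B * norm z" for x
    using Cauchy_Schwarz_ineq2[of "D x" z] mult_right_mono[OF B, of "norm z" x] by simp
  define h where "h n = 1 / real (Suc n)" for n
  have h: "h \<longlonglongrightarrow> 0" "\<And>n. h n \<noteq> 0" unfolding h_def by (rule LIMSEQ_Suc[OF lim_1_over_n]) simp
  have Ptr: "sq_int \<mu> (\<lambda>x. P (x + u))" for u
    by (rule sq_int_translate(1)[OF C1_per_sq_int(1)[OF P] p])
  have sq: "integrable \<mu> (\<lambda>x. (P (x + u) - P (x + v))\<^sup>2)" for u v
    using sq_int_integrable_power2[OF sq_int_diff[OF Ptr[of u] Ptr[of v]]] by simp
  have le: "(LINT x|\<mu>. (P (x + z) - P x)\<^sup>2)
      \<le> (LINT x|\<mu>. ((P (x + h n *\<^sub>R z) - P x) / h n)\<^sup>2)" for n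
  proof -
    (* N steps of length |z| / N *)
    define N where "N = Suc n"
    have hN: "h n = 1 / real N" and N: "N > 0" by (simp_all add: h_def N_def)
    define u where "u k = (real k / real N) *\<^sub>R z" for k
    have uS: "u (Suc k) = u k + h n *\<^sub>R z" for k
      by (simp add: u_def hN add_divide_distrib scaleR_left_distrib)
    have "(LINT x|\<mu>. (P (x + z) - P x)\<^sup>2)
        \<le> (LINT x|\<mu>. (\<Sum>k<N. (P (x + u (Suc k)) - P (x + u k))\<^sup>2) * real N)"
    proof (rule integral_mono)
      show "integrable \<mu> (\<lambda>x. (P (x + z) - P x)\<^sup>2)" using sq[of z 0] by simp
      show "integrable \<mu> (\<lambda>x. (\<Sum>k<N. (P (x + u (Suc k)) - P (x + u k))\<^sup>2) * real N)"
        using sq by simp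
      fix x
      have "P (x + z) - P x = (\<Sum>k<N. P (x + u (Suc k)) - P (x + u k))"
        using N by (subst sum_lessThan_telescope) (simp add: u_def)
      then show "(P (x + z) - P x)\<^sup>2 \<le> (\<Sum>k<N. (P (x + u (Suc k)) - P (x + u k))\<^sup>2) * real N"
        using sum_squared_le_sum_of_squares[of "\<lambda>k. P (x + u (Suc k)) - P (x + u k)" "{..<N}"] by simp
    qed
    also have "\<dots> = (\<Sum>k<N. LINT x|\<mu>. (P (x + u (Suc k)) - P (x + u k))\<^sup>2) * real N"
      using sq by simp
    also have "\<dots> = (\<Sum>k<N. LINT x|\<mu>. (P (x + h n *\<^sub>R z) - P x)\<^sup>2) * real N"
    proof -
      have "(LINT x|\<mu>. (P (x + u (Suc k)) - P (x + u k))\<^sup>2)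
          = (LINT x|\<mu>. (P (x + h n *\<^sub>R z) - P x)\<^sup>2)" for k
      proof -
        have "per (\<lambda>x. (P (x + h n *\<^sub>R z) - P x)\<^sup>2)"
          unfolding per_def
        proof (intro ballI allI)
          fix t y assume t: "t \<in> \<Lambda>"
          have "P (y + t + h n *\<^sub>R z) = P (y + h n *\<^sub>R z)"
            using perD[OF p t, of "y + h n *\<^sub>R z"] by (simp add: ac_simps)
          then show "(P (y + t + h n *\<^sub>R z) - P (y + t))\<^sup>2 = (P (y + h n *\<^sub>R z) - P y)\<^sup>2"
            by (simp add: perD[OF p t])
        qed
        from integral_cell_translation(1)[OF _ this, of "u k"] show ?thesis
          by (simp add: uS ac_simps)
      qed
      then show ?thesis by simp
    qed
    also have "\<dots> = (LINT x|\<mu>. ((P (x + h n *\<^sub>R z) - P x) / h n)\<^sup>2)"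
    proof -
      have "((P (x + h n *\<^sub>R z) - P x) / h n)\<^sup>2 = (real N * real N) * (P (x + h n *\<^sub>R z) - P x)\<^sup>2" for x
        by (simp add: hN power2_eq_square ac_simps)
      then show ?thesis by simp
    qed
    finally show ?thesis .
  qed
  have "(\<lambda>n. LINT x|\<mu>. ((P (x + h n *\<^sub>R z) - P x) / h n)\<^sup>2) \<longlonglongrightarrow> (LINT x|\<mu>. (D x \<bullet> z)\<^sup>2)"
  proof (rule integral_dominated_convergence[where w="\<lambda>_. (B * norm z)\<^sup>2"])
    show "AE x in \<mu>. (\<lambda>n. ((P (x + h n *\<^sub>R z) - P x) / h n)\<^sup>2) \<longlonglongrightarrow> (D x \<bullet> z)\<^sup>2"
      by (intro AE_I2 tendsto_power difference_quotient_tendsto[OF dP h])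
    show "AE x in \<mu>. norm (((P (x + h n *\<^sub>R z) - P x) / h n)\<^sup>2) \<le> (B * norm z)\<^sup>2" for n
    proof (rule AE_I2)
      fix x
      have "\<bar>(P (x + h n *\<^sub>R z) - P x) / h n\<bar>\<^sup>2 \<le> (B * norm z)\<^sup>2"
        by (intro power_mono difference_quotient_bound[OF dP D_le]) simp
      then show "norm (((P (x + h n *\<^sub>R z) - P x) / h n)\<^sup>2) \<le> (B * norm z)\<^sup>2"
        by (simp only: real_norm_def power_abs)
    qed
  qed (use fin in \<open>auto intro!: finite_measure.integrable_const\<close>)
  then have "(LINT x|\<mu>. (P (x + z) - P x)\<^sup>2) \<le> (LINT x|\<mu>. (D x \<bullet> z)\<^sup>2)"
    by (rule tendsto_lowerbound) (auto simp: le)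
  also have "\<dots> \<le> (LINT x|\<mu>. (norm z)\<^sup>2 * (norm (D x))\<^sup>2)"
  proof (rule integral_mono)
    have "bounded_linear (\<lambda>v. v \<bullet> z)" by (rule bounded_linear_inner_left)
    from sq_int_bounded_linear[OF this C1_per_sq_int(2)[OF P]]
    show "integrable \<mu> (\<lambda>x. (D x \<bullet> z)\<^sup>2)" by (simp add: sq_int_def)
    show "integrable \<mu> (\<lambda>x. (norm z)\<^sup>2 * (norm (D x))\<^sup>2)"
      using sq_int_integrable_power2[OF C1_per_sq_int(2)[OF P]] by simp
    show "(D x \<bullet> z)\<^sup>2 \<le> (norm z)\<^sup>2 * (norm (D x))\<^sup>2" for x
      using Cauchy_Schwarz_ineq[of "D x" z] by (simp add: power2_norm_eq_inner mult.commute)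
  qed
  finally show ?thesis by simp
qed

text \<open>
  By Jensen's inequality \<open>(P(x) - mean P)\<^sup>2\<close> is at most the mean of \<open>(P(x) - P(z))\<^sup>2\<close> over \<open>z\<close>. Translation
  invariance turns the double mean into one of \<open>(P(y + z) - P(y))\<^sup>2\<close>, to which the translation estimate
  applies with \<open>|z|\<close> bounded on the cell.
\<close>

lemma poincare:
  obtains C where "C \<ge> 0" "\<And>P D. C1_per P D \<Longrightarrow>
    (LINT x|\<mu>. (P x - (LINT y|\<mu>. P y))\<^sup>2) \<le> C * (LINT x|\<mu>. (norm (D x))\<^sup>2)"
proof -
  obtain r where r: "r > 0" "cell g \<subseteq> cball 0 r" using cell_subset_cball by blast
  have "(LINT x|\<mu>. (P x - (LINT y|\<mu>. P y))\<^sup>2) \<le> r\<^sup>2 * (LINT x|\<mu>. (norm (D x))\<^sup>2)"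
    if P: "C1_per P D" for P D
  proof -
    define m where "m = (LINT y|\<mu>. P y)"
    define G where "G = (LINT x|\<mu>. (norm (D x))\<^sup>2)"
    have p: "per P" using P by (auto simp: C1_per_def)
    have cont: "continuous_on UNIV P" using P C1_per_continuous by (auto simp: C1_per_def)
    note [measurable] = cont[THEN borel_measurable_continuous_onI]
    obtain B where B: "\<And>x. norm (P x) \<le> B" using per_bounded[OF p cont] by blast
    have Psq: "sq_int \<mu> P" by (rule C1_per_sq_int(1)[OF P])
    have Pint: "integrable \<mu> P" by (rule sq_int_integrable[OF cell.finite_measure_axioms Psq])
    have bd: "\<bar>(P u - P v)\<^sup>2\<bar> \<le> (2 * B)\<^sup>2" for u v
    proof -
      have "\<bar>P u - P v\<bar> \<le> \<bar>2 * B\<bar>" using B[of u] B[of v] by simp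
      then show ?thesis by (simp add: abs_le_square_iff)
    qed
    have int: "integrable (\<mu> \<Otimes>\<^sub>M \<mu>) (\<lambda>(y, z). (P (z + y) - P y)\<^sup>2)"
    proof -
      interpret pm: finite_measure "\<mu> \<Otimes>\<^sub>M \<mu>"
        by (rule finite_measure_pair_measure[OF cell.finite_measure_axioms cell.finite_measure_axioms])
      show ?thesis
        by (rule pm.integrable_const_bound[of _ "(2 * B)\<^sup>2"]) (use bd in \<open>auto intro!: AE_I2\<close>)
    qed
    have "(P y - m)\<^sup>2 \<le> (LINT z|\<mu>. (P (z + y) - P y)\<^sup>2)" for y
    proof -
      have "m - P y = (LINT z|\<mu>. P z - P y)"
        using Pint by (simp add: m_def cell.prob_space)
      then have "(P y - m)\<^sup>2 = (LINT z|\<mu>. P z - P y)\<^sup>2" by (metis power2_commute)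
      also have "\<dots> \<le> (LINT z|\<mu>. (P z - P y)\<^sup>2)"
        by (intro square_integral_le prob_space_cell_measure sq_int_diff Psq sq_int_const cell.finite_measure_axioms)
      also have "\<dots> = (LINT z|\<mu>. (P (z + y) - P y)\<^sup>2)"
        using p by (intro integral_cell_translation(1)[symmetric, of "\<lambda>z. (P z - P y)\<^sup>2"]) (auto simp: per_def)
      finally show ?thesis .
    qed
    then have "(LINT y|\<mu>. (P y - m)\<^sup>2) \<le> (LINT y|\<mu>. (LINT z|\<mu>. (P (z + y) - P y)\<^sup>2))"
    proof (intro integral_mono)
      show "integrable \<mu> (\<lambda>y. (P y - m)\<^sup>2)"
        using sq_int_integrable_power2[OF sq_int_diff[OF Psq sq_int_const[OF cell.finite_measure_axioms]]] by simp
      show "integrable \<mu> (\<lambda>y. LINT z|\<mu>. (P (z + y) - P y)\<^sup>2)"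
        using cell_pair.integrable_fst[OF int] by simp
    qed
    also have "\<dots> = (LINT z|\<mu>. (LINT y|\<mu>. (P (y + z) - P y)\<^sup>2))"
      using cell_pair.Fubini_integral[OF int] by (simp add: add.commute)
    also have "\<dots> \<le> (LINT z|\<mu>. r\<^sup>2 * G)"
    proof (rule integral_mono_AE)
      show "integrable \<mu> (\<lambda>z. LINT y|\<mu>. (P (y + z) - P y)\<^sup>2)"
        using cell_pair.integrable_snd[OF int] by (simp add: add.commute)
      have "(LINT y|\<mu>. (P (y + z) - P y)\<^sup>2) \<le> r\<^sup>2 * G" if "z \<in> cell0" for z
      proof -
        have "norm z \<le> r" using that r(2) cell0_subset_cell by (auto simp: subset_iff)
        then have "(norm z)\<^sup>2 * G \<le> r\<^sup>2 * G" by (intro mult_right_mono power_mono) (auto simp: G_def)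
        with poincare_translation[OF P, of z] show ?thesis by (simp add: G_def)
      qed
      then show "AE z in \<mu>. (LINT y|\<mu>. (P (y + z) - P y)\<^sup>2) \<le> r\<^sup>2 * G"
        by (simp add: AE_cell_measure)
    qed (simp add: cell.integrable_const)
    also have "\<dots> = r\<^sup>2 * G" by (simp add: cell.prob_space)
    finally show ?thesis by (simp add: m_def G_def)
  qed
  then show ?thesis by (intro that[of "r\<^sup>2"]) auto
qed

definition C1_field :: "(real^3 \<Rightarrow> real^3) \<Rightarrow> (real^3 \<Rightarrow> real^3^3) \<Rightarrow> bool" where
  "C1_field p D \<longleftrightarrow> (\<forall>i. C1_per (\<lambda>x. p x $ i) (\<lambda>x. D x $ i))"

lemma C1_field_sq_int: "C1_field p D \<Longrightarrow> sq_int \<mu> p" "C1_field p D \<Longrightarrow> sq_int \<mu> D"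
  by (intro sq_int_vec C1_per_sq_int(1)[OF C1_field_def[THEN iffD1, rule_format]],
      assumption)
    (intro sq_int_vec[of _ D] C1_per_sq_int(2)[OF C1_field_def[THEN iffD1, rule_format]],
      assumption)

lemma C1_field_per: "C1_field p D \<Longrightarrow> per p" "C1_field p D \<Longrightarrow> per D"
  unfolding C1_field_def
  using C1_per_per_deriv[of "\<lambda>x. p x $ i" "\<lambda>x. D x $ i" for i]
  by (auto simp: C1_per_def per_def vec_eq_iff)

lemma C1_field_combine:
  assumes "C1_field p D" "C1_field q E"
  shows "C1_field (\<lambda>x. a *\<^sub>R p x + b *\<^sub>R q x) (\<lambda>x. a *\<^sub>R D x + b *\<^sub>R E x)"
  using assms C1_per_add[OF C1_per_scale C1_per_scale] by (simp add: C1_field_def)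

text \<open>
  Expanding, \<open>|sym D|\<^sup>2 = |D|\<^sup>2 / 2 + (\<Sum>\<^sub>i\<^sub>j D\<^sub>i\<^sub>j D\<^sub>j\<^sub>i) / 2\<close>, and exchanging derivatives turns the integral of the
  last sum into that of the square of the divergence, which is nonnegative.
\<close>

lemma korn:
  assumes D: "C1_field p D"
  shows "(LINT x|\<mu>. (norm (D x))\<^sup>2) \<le> 2 * (LINT x|\<mu>. (norm (sym_part (D x)))\<^sup>2)"
proof -
  have Dsq: "sq_int \<mu> (\<lambda>x. D x $ i $ j)" for i j
    by (rule sq_int_nth[OF sq_int_nth[OF C1_field_sq_int(2)[OF D]]])
  have int: "integrable \<mu> (\<lambda>x. D x $ i $ j * D x $ k $ l)" for i j k l
    using sq_int_inner[OF Dsq Dsq] by simp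
  have eq: "(norm (sym_part (D x)))\<^sup>2 = (norm (D x))\<^sup>2 / 2 + (\<Sum>i\<in>UNIV. \<Sum>j\<in>UNIV. D x $ i $ j * D x $ j $ i) / 2" for x
  proof -
    have "(norm (sym_part (D x)))\<^sup>2 = D x \<bullet> sym_part (D x)"
      by (simp add: power2_norm_eq_inner sym_part_inner transpose_sym_part)
    also have "\<dots> = (D x \<bullet> D x) / 2 + (\<Sum>i\<in>UNIV. \<Sum>j\<in>UNIV. D x $ i $ j * D x $ j $ i) / 2"
      by (simp add: matrix_inner_eq_sum sym_part_nth sum_divide_distrib sum.distrib[symmetric] distrib_left add_divide_distrib)
    finally show ?thesis by (simp add: power2_norm_eq_inner)
  qed
  have ex: "(LINT x|\<mu>. D x $ i $ j * D x $ j $ i) = (LINT x|\<mu>. D x $ i $ i * D x $ j $ j)" for i j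
    using exchange_derivatives[of "\<lambda>x. p x $ i" "\<lambda>x. D x $ i" "\<lambda>x. p x $ j" "\<lambda>x. D x $ j" "axis j 1" "axis i 1"] D
    by (simp add: C1_field_def inner_axis)
  have "(LINT x|\<mu>. (\<Sum>i\<in>UNIV. \<Sum>j\<in>UNIV. D x $ i $ j * D x $ j $ i))
      = (LINT x|\<mu>. (\<Sum>i\<in>UNIV. \<Sum>j\<in>UNIV. D x $ i $ i * D x $ j $ j))"
    by (simp add: int ex)
  also have "\<dots> = (LINT x|\<mu>. (\<Sum>i\<in>UNIV. D x $ i $ i)\<^sup>2)"
    by (simp add: power2_eq_square sum_product)
  also have "\<dots> \<ge> 0" by simp
  finally have "(LINT x|\<mu>. (\<Sum>i\<in>UNIV. \<Sum>j\<in>UNIV. D x $ i $ j * D x $ j $ i)) \<ge> 0" .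
  moreover have "(LINT x|\<mu>. (norm (sym_part (D x)))\<^sup>2)
      = (LINT x|\<mu>. (norm (D x))\<^sup>2) / 2 + (LINT x|\<mu>. (\<Sum>i\<in>UNIV. \<Sum>j\<in>UNIV. D x $ i $ j * D x $ j $ i)) / 2"
    unfolding eq using sq_int_integrable_power2[OF C1_field_sq_int(2)[OF D]] int by simp
  ultimately show ?thesis by simp
qed

lemma poincare_field:
  obtains C where "C \<ge> 0" "\<And>p D. C1_field p D \<Longrightarrow> (LINT x|\<mu>. p x) = 0 \<Longrightarrow>
    (LINT x|\<mu>. (norm (p x))\<^sup>2) \<le> C * (LINT x|\<mu>. (norm (D x))\<^sup>2)"
proof -
  obtain C where C: "C \<ge> 0" "\<And>P D. C1_per P D \<Longrightarrow>
    (LINT x|\<mu>. (P x - (LINT y|\<mu>. P y))\<^sup>2) \<le> C * (LINT x|\<mu>. (norm (D x))\<^sup>2)"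
    using poincare by blast
  have "(LINT x|\<mu>. (norm (p x))\<^sup>2) \<le> C * (LINT x|\<mu>. (norm (D x))\<^sup>2)"
    if p: "C1_field p D" and m: "(LINT x|\<mu>. p x) = 0" for p D
  proof -
    have pint: "integrable \<mu> p"
      by (rule sq_int_integrable[OF cell.finite_measure_axioms C1_field_sq_int(1)[OF p]])
    have m': "(LINT x|\<mu>. p x $ i) = 0" for i
      using integral_bounded_linear[OF bounded_linear_vec_nth pint, of i] m by simp
    have "(LINT x|\<mu>. (norm (p x))\<^sup>2) = (\<Sum>i\<in>UNIV. LINT x|\<mu>. (p x $ i)\<^sup>2)"
      using sq_int_integrable_power2[OF sq_int_nth[OF C1_field_sq_int(1)[OF p]]] by (simp add: norm_vec_power2)
    also have "\<dots> \<le> (\<Sum>i\<in>UNIV. C * (LINT x|\<mu>. (norm (D x $ i))\<^sup>2))"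
    proof (rule sum_mono)
      fix i
      show "(LINT x|\<mu>. (p x $ i)\<^sup>2) \<le> C * (LINT x|\<mu>. (norm (D x $ i))\<^sup>2)"
        using C(2)[of "\<lambda>x. p x $ i" "\<lambda>x. D x $ i"] p by (simp add: C1_field_def m')
    qed
    also have "\<dots> = C * (LINT x|\<mu>. (norm (D x))\<^sup>2)"
      using sq_int_integrable_power2[OF sq_int_nth[OF C1_field_sq_int(2)[OF p]]]
      by (simp add: norm_vec_power2[of "D _"] sum_distrib_left)
    finally show ?thesis .
  qed
  with C(1) that show ?thesis by blast
qed

end

section \<open>Projection onto symmetrised gradients\<close>

context period_lattice
begin

text \<open>
  The displacements that test the divergence of a periodic field: the periodization of a test function
  in direction \<open>i\<close>.
\<close>

lemma C1_field_periodization: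
  assumes \<psi>: "\<psi> \<in> test_functions"
  shows "C1_field (\<lambda>x. axis i (periodization \<psi> x)) (\<lambda>x. axis i (\<chi> j. periodization (partial j \<psi>) x))"
proof -
  obtain R where R: "\<And>x. norm x > R \<Longrightarrow> \<psi> x = 0" "\<And>x j. norm x > R \<Longrightarrow> partial j \<psi> x = 0"
    using test_function_support[OF \<psi>] by metis
  have "continuous_on UNIV (\<lambda>x. \<chi> j. periodization (partial j \<psi>) x)"
    by (intro continuous_on_vec_lambda continuous_periodization[OF R(2)] test_function_partial_continuous[OF \<psi>])
  then have P: "C1_per (periodization \<psi>) (\<lambda>x. \<chi> j. periodization (partial j \<psi>) x)"
    using per_periodization periodization_has_derivative[OF \<psi>] by (simp add: C1_per_def)
  show ?thesis
    unfolding C1_field_def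
  proof
    fix k
    show "C1_per (\<lambda>x. axis i (periodization \<psi> x) $ k) (\<lambda>x. axis i (\<chi> j. periodization (partial j \<psi>) x) $ k)"
      using P C1_per_const[of 0] by (cases "k = i") (simp_all add: axis_def)
  qed
qed

lemma C1_field_weak_gradient:
  assumes p: "C1_field p D" and \<psi>: "\<psi> \<in> test_functions"
  shows "(LINT y|lborel. p y $ i * partial j \<psi> y) = - (LINT y|lborel. D y $ i $ j * \<psi> y)"
proof -
  have d: "((\<lambda>y. p y $ i) has_derivative (\<lambda>h. D x $ i \<bullet> h)) (at x)" for x
    using p by (simp add: C1_field_def C1_per_def)
  have c: "continuous_on UNIV (\<lambda>x. D x $ i \<bullet> axis j 1)"
    using p by (intro continuous_on_inner continuous_on_const) (simp add: C1_field_def C1_per_def)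
  show ?thesis using integration_by_parts[OF d c \<psi>] by (simp add: inner_axis)
qed

lemma per_integral_tendsto:
  fixes u :: "nat \<Rightarrow> real^3 \<Rightarrow> real"
  assumes u: "\<And>n. sq_int \<mu> (u n)" "\<And>n. per (u n)" and F: "sq_int \<mu> F" "per F"
    and lim: "(\<lambda>n. LINT x|\<mu>. (norm (u n x - F x))\<^sup>2) \<longlonglongrightarrow> 0"
    and \<psi>: "continuous_on UNIV \<psi>" and R: "\<And>y. norm y > R \<Longrightarrow> \<psi> y = 0"
  shows "(\<lambda>n. LINT y|lborel. u n y * \<psi> y) \<longlonglongrightarrow> (LINT y|lborel. F y * \<psi> y)"
proof -
  have fin: "finite_measure \<mu>" by (rule cell.finite_measure_axioms)
  have cp: "continuous_on UNIV (periodization \<psi>)" by (rule continuous_periodization[OF R \<psi>])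
  obtain B where "\<And>x. norm (periodization \<psi> x) \<le> B" using per_bounded[OF per_periodization cp] by blast
  then have sq: "sq_int \<mu> (periodization \<psi>)"
    using borel_measurable_continuous_onI[OF cp] by (intro sq_int_bounded fin) auto
  have eq: "(LINT y|lborel. h y * \<psi> y) = cell_vol * (LINT y|\<mu>. h y \<bullet> periodization \<psi> y)"
    if h: "sq_int \<mu> h" "per h" for h :: "real^3 \<Rightarrow> real"
  proof -
    have "h \<in> borel_measurable borel" using sq_int_measurable[OF h(1)] by simp
    from per_integral_unfold(2)[OF this h(2) sq_int_integrable[OF fin h(1)] \<psi> R]
    show ?thesis by (simp add: mult.commute)
  qed
  show ?thesis
    unfolding eq[OF u] eq[OF F] by (intro tendsto_mult_left integral_inner_tendsto u F sq lim)
qed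

text \<open>
  The orthogonal projection of \<open>f\<close> onto the closure of the symmetrised gradients of \<open>C\<^sup>1\<close> fields is
  again a symmetrised gradient, of a displacement in \<open>H\<^sup>1\<close>. Since
  \<open>f - sym H\<close> is symmetric, orthogonality to \<open>D\<close> and \<open>H\<close> is orthogonality to their symmetric parts.
\<close>

lemma projection_on_sym_gradients:
  fixes f :: "real^3 \<Rightarrow> real^3^3"
  assumes f: "sq_int \<mu> f" and fs: "\<And>y. transpose (f y) = f y"
  obtains \<phi> H where "sq_int \<mu> \<phi>" "per \<phi>" "sq_int \<mu> H" "per H"
    "has_weak_gradient \<phi> H"
    "\<And>p D. C1_field p D \<Longrightarrow> (LINT y|\<mu>. (f y - sym_part (H y)) \<bullet> D y) = 0"
    "(LINT y|\<mu>. (f y - sym_part (H y)) \<bullet> H y) = 0"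
proof -
  have fin: "finite_measure \<mu>" by (rule cell.finite_measure_axioms)
  note sqD = C1_field_sq_int(2)
  note sym_sq = sq_int_bounded_linear[OF bounded_linear_sym_part]
  define E where "E D = (LINT y|\<mu>. (norm (f y - sym_part (D y)))\<^sup>2)" for D :: "real^3 \<Rightarrow> real^3^3"
  define V where "V = {E D | D p. C1_field p D}"
  define d where "d = Inf V"
  have zero: "C1_field (\<lambda>x. 0) (\<lambda>x. 0)" using C1_per_const[of 0] by (simp add: C1_field_def)
  have Vne: "V \<noteq> {}" unfolding V_def using zero by blast
  have "bdd_below V" unfolding V_def by (rule bdd_belowI[of _ 0]) (auto simp: E_def)
  then have d_le: "d \<le> E D" if "C1_field p D" for p D
    unfolding d_def using that by (intro cInf_lower) (auto simp: V_def)
  have "\<exists>q. C1_field (fst q) (snd q) \<and> E (snd q) < d + 1 / real (Suc n) \<and> (LINT y|\<mu>. fst q y) = 0" for n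
  proof -
    have "Inf V < d + 1 / real (Suc n)" by (simp add: d_def)
    from cInf_lessD[OF Vne this] obtain p D where pD: "C1_field p D" "E D < d + 1 / real (Suc n)"
      unfolding V_def by blast
    have pint: "integrable \<mu> p" by (rule sq_int_integrable[OF fin C1_field_sq_int(1)[OF pD(1)]])
    (* subtracting the mean does not change the gradient and makes Poincare's inequality applicable *)
    define q where "q y = p y - (LINT y|\<mu>. p y)" for y
    have "C1_field q D"
      using pD(1) C1_per_add[OF _ C1_per_const[of "- (LINT y|\<mu>. p y) $ i" for i]]
      by (simp add: C1_field_def q_def)
    moreover have "(LINT y|\<mu>. q y) = 0" using pint by (simp add: q_def)
    ultimately show ?thesis using pD(2) by (intro exI[of _ "(q, D)"]) simp
  qed
  then have "\<forall>n. \<exists>q. C1_field (fst q) (snd q) \<and> E (snd q) < d + 1 / real (Suc n) \<and> (LINT y|\<mu>. fst q y) = 0"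
    by blast
  from choice[OF this] obtain q where q: "\<And>n. C1_field (fst (q n)) (snd (q n)) \<and>
      E (snd (q n)) < d + 1 / real (Suc n) \<and> (LINT y|\<mu>. fst (q n) y) = 0"
    by blast
  define p D where "p n = fst (q n)" and "D n = snd (q n)" for n
  have pD: "C1_field (p n) (D n)" "E (D n) < d + 1 / real (Suc n)"
    "(LINT y|\<mu>. p n y) = 0" for n
    using q[of n] by (simp_all add: p_def D_def)
  have Dsq: "sq_int \<mu> (D n)" and psq: "sq_int \<mu> (p n)" for n
    using C1_field_sq_int[OF pD(1)] by auto
  have diff: "C1_field (\<lambda>y. p m y - p n y) (\<lambda>y. D m y - D n y)" for m n
    using C1_field_combine[OF pD(1)[of m] pD(1)[of n], of 1 "-1"] by simp
  have sym_diff: "(LINT y|\<mu>. (norm (sym_part (D m y - D n y)))\<^sup>2) \<le> 2 / real (Suc m) + 2 / real (Suc n)" for m n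
  proof -
    (* the midpoint of two competitors is a competitor, so its energy is at least the infimum *)
    define M where "M y = (1/2) *\<^sub>R D m y + (1/2) *\<^sub>R D n y" for y
    have M: "C1_field (\<lambda>y. (1/2) *\<^sub>R p m y + (1/2) *\<^sub>R p n y) M"
      unfolding M_def by (rule C1_field_combine[OF pD(1) pD(1)])
    have "(norm (sym_part (D m y - D n y)))\<^sup>2 = 2 * (norm (f y - sym_part (D m y)))\<^sup>2
        + 2 * (norm (f y - sym_part (D n y)))\<^sup>2 - 4 * (norm (f y - sym_part (M y)))\<^sup>2" for y
    proof -
      have "sym_part (D m y - D n y) = (f y - sym_part (D n y)) - (f y - sym_part (D m y))"
        using sym_part_diff by simp
      moreover have "f y - sym_part (M y) = (1/2) *\<^sub>R ((f y - sym_part (D m y)) + (f y - sym_part (D n y)))"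
        by (simp add: M_def vec_eq_iff sym_part_nth field_simps)
      moreover have "(norm (b - a))\<^sup>2 = 2 * (norm a)\<^sup>2 + 2 * (norm b)\<^sup>2 - 4 * (norm ((1/2) *\<^sub>R (a + b)))\<^sup>2"
        for a b :: "real^3^3"
        by (simp add: power2_norm_eq_inner inner_add inner_diff inner_commute algebra_simps)
      ultimately show ?thesis by (simp only:)
    qed
    then have "(LINT y|\<mu>. (norm (sym_part (D m y - D n y)))\<^sup>2) = 2 * E (D m) + 2 * E (D n) - 4 * E M"
      unfolding E_def
      using sq_int_integrable_power2[OF sq_int_diff[OF f sym_sq[OF Dsq]]]
        sq_int_integrable_power2[OF sq_int_diff[OF f sym_sq[OF sqD[OF M]]]] by simp
    with d_le[OF M] pD(2)[of m] pD(2)[of n] show ?thesis by simp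
  qed
  have cauchyD: "(LINT y|\<mu>. (norm (D m y - D n y))\<^sup>2) \<le> 2 * (2 / real (Suc m) + 2 / real (Suc n))" for m n
    using korn[OF diff[of m n]] sym_diff[of m n] by simp
  obtain C where C: "C \<ge> 0" "\<And>p D. C1_field p D \<Longrightarrow> (LINT x|\<mu>. p x) = 0 \<Longrightarrow>
    (LINT x|\<mu>. (norm (p x))\<^sup>2) \<le> C * (LINT x|\<mu>. (norm (D x))\<^sup>2)"
    using poincare_field by blast
  have cauchyp: "(LINT y|\<mu>. (norm (p m y - p n y))\<^sup>2) \<le> C * (2 * (2 / real (Suc m) + 2 / real (Suc n)))" for m n
  proof -
    have "(LINT y|\<mu>. p m y - p n y) = 0"
      using sq_int_integrable[OF fin psq] pD(3) by simp
    from C(2)[OF diff this] mult_left_mono[OF cauchyD[of m n] C(1)] show ?thesis by linarith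
  qed
  have small: "\<exists>N. \<forall>m\<ge>N. \<forall>n\<ge>N. K * (2 * (2 / real (Suc m) + 2 / real (Suc n))) < \<epsilon>" if "K \<ge> 0" "\<epsilon> > 0" for K \<epsilon> :: real
  proof -
    obtain N :: nat where N: "8 * K / \<epsilon> < real N" using reals_Archimedean2 by blast
    have "K * (2 * (2 / real (Suc m) + 2 / real (Suc n))) < \<epsilon>" if "m \<ge> N" "n \<ge> N" for m n
    proof -
      have "1 / real (Suc m) \<le> 1 / real (Suc N)" "1 / real (Suc n) \<le> 1 / real (Suc N)"
        using that by (simp_all add: frac_le)
      then have "2 * (2 / real (Suc m) + 2 / real (Suc n)) \<le> 8 * (1 / real (Suc N))" by simp
      then have "K * (2 * (2 / real (Suc m) + 2 / real (Suc n))) \<le> K * (8 * (1 / real (Suc N)))"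
        using \<open>K \<ge> 0\<close> by (rule mult_left_mono)
      also have "\<dots> < \<epsilon>"
      proof -
        have "8 * K < real (Suc N) * \<epsilon>" using N \<open>\<epsilon> > 0\<close> by (simp add: field_simps)
        then show ?thesis by (simp add: field_simps)
      qed
      finally show ?thesis .
    qed
    then show ?thesis by blast
  qed
  have limD: "\<exists>N. \<forall>m\<ge>N. \<forall>n\<ge>N. (LINT y|\<mu>. (norm (D m y - D n y))\<^sup>2) < \<epsilon>" if pos: "\<epsilon> > 0" for \<epsilon>
  proof -
    obtain N where N: "\<forall>m\<ge>N. \<forall>n\<ge>N. 1 * (2 * (2 / real (Suc m) + 2 / real (Suc n))) < \<epsilon>"
      using small[OF zero_le_one pos] by blast
    have "(LINT y|\<mu>. (norm (D m y - D n y))\<^sup>2) < \<epsilon>" if "m \<ge> N" "n \<ge> N" for m n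
    proof -
      have "1 * (2 * (2 / real (Suc m) + 2 / real (Suc n))) < \<epsilon>" using N that by blast
      then show ?thesis using cauchyD[of m n] by linarith
    qed
    then show ?thesis by blast
  qed
  obtain r where r: "sq_int \<mu> (\<lambda>x. lim (\<lambda>n. D (r n) x))"
    "(\<lambda>n. LINT x|\<mu>. (norm (D n x - lim (\<lambda>k. D (r k) x)))\<^sup>2) \<longlonglongrightarrow> 0"
    by (rule L2_complete[where f=D, OF prob_space_cell_measure Dsq limD])
  have limp: "\<exists>N. \<forall>m\<ge>N. \<forall>n\<ge>N. (LINT y|\<mu>. (norm (p m y - p n y))\<^sup>2) < \<epsilon>" if pos: "\<epsilon> > 0" for \<epsilon>
  proof -
    obtain N where N: "\<forall>m\<ge>N. \<forall>n\<ge>N. C * (2 * (2 / real (Suc m) + 2 / real (Suc n))) < \<epsilon>"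
      using small[OF C(1) pos] by blast
    have "(LINT y|\<mu>. (norm (p m y - p n y))\<^sup>2) < \<epsilon>" if "m \<ge> N" "n \<ge> N" for m n
    proof -
      have "C * (2 * (2 / real (Suc m) + 2 / real (Suc n))) < \<epsilon>" using N that by blast
      then show ?thesis using cauchyp[of m n] by linarith
    qed
    then show ?thesis by blast
  qed
  obtain r' where r': "sq_int \<mu> (\<lambda>x. lim (\<lambda>n. p (r' n) x))"
    "(\<lambda>n. LINT x|\<mu>. (norm (p n x - lim (\<lambda>k. p (r' k) x)))\<^sup>2) \<longlonglongrightarrow> 0"
    by (rule L2_complete[where f=p, OF prob_space_cell_measure psq limp])
  define H where "H x = lim (\<lambda>n. D (r n) x)" for x
  define \<phi> where "\<phi> x = lim (\<lambda>n. p (r' n) x)" for x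
  have H: "sq_int \<mu> H" "per H"
    using r(1) C1_field_per(2)[OF pD(1)] by (simp_all add: H_def[abs_def] per_def)
  have \<phi>: "sq_int \<mu> \<phi>" "per \<phi>"
    using r'(1) C1_field_per(1)[OF pD(1)] by (simp_all add: \<phi>_def[abs_def] per_def)
  have limH: "(\<lambda>n. LINT x|\<mu>. (norm (D n x - H x))\<^sup>2) \<longlonglongrightarrow> 0" using r(2) by (simp add: H_def)
  have lim\<phi>: "(\<lambda>n. LINT x|\<mu>. (norm (p n x - \<phi> x))\<^sup>2) \<longlonglongrightarrow> 0" using r'(2) by (simp add: \<phi>_def)
  have component: "(\<lambda>n. LINT x|\<mu>. (norm (u n x $ i - F x $ i))\<^sup>2) \<longlonglongrightarrow> 0"
    if u: "\<And>n. sq_int \<mu> (u n)" "sq_int \<mu> F"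
      and l: "(\<lambda>n. LINT x|\<mu>. (norm (u n x - F x))\<^sup>2) \<longlonglongrightarrow> 0"
    for u :: "nat \<Rightarrow> real^3 \<Rightarrow> ('b::euclidean_space)^3" and F i
  proof (rule tendsto_sandwich[OF _ _ tendsto_const l])
    have "(LINT x|\<mu>. (norm (u n x $ i - F x $ i))\<^sup>2) \<le> (LINT x|\<mu>. (norm (u n x - F x))\<^sup>2)" for n
    proof (rule integral_mono)
      show "integrable \<mu> (\<lambda>x. (norm (u n x $ i - F x $ i))\<^sup>2)"
        using sq_int_integrable_power2[OF sq_int_diff[OF sq_int_nth[OF u(1)] sq_int_nth[OF u(2)]]] .
      show "integrable \<mu> (\<lambda>x. (norm (u n x - F x))\<^sup>2)"
        using sq_int_integrable_power2[OF sq_int_diff[OF u(1) u(2)]] .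
      show "(norm (u n x $ i - F x $ i))\<^sup>2 \<le> (norm (u n x - F x))\<^sup>2" for x
        using Finite_Cartesian_Product.norm_nth_le[of "u n x - F x" i] by (intro power_mono) auto
    qed
    then show "\<forall>\<^sub>F n in sequentially. (LINT x|\<mu>. (norm (u n x $ i - F x $ i))\<^sup>2)
      \<le> (LINT x|\<mu>. (norm (u n x - F x))\<^sup>2)" by simp
  qed simp
  have grad: "(LINT y|lborel. \<phi> y $ i * partial j \<psi> y) = - (LINT y|lborel. H y $ i $ j * \<psi> y)"
    if \<psi>: "\<psi> \<in> test_functions" for \<psi> i j
  proof -
    obtain R where R: "\<And>x. norm x > R \<Longrightarrow> \<psi> x = 0" "\<And>x j. norm x > R \<Longrightarrow> partial j \<psi> x = 0"
      using test_function_support[OF \<psi>] by metis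
    have "(\<lambda>n. LINT y|lborel. p n y $ i * partial j \<psi> y) \<longlonglongrightarrow> (LINT y|lborel. \<phi> y $ i * partial j \<psi> y)"
      by (rule per_integral_tendsto[OF sq_int_nth[OF psq] _ sq_int_nth[OF \<phi>(1)] _ component[OF psq \<phi>(1) lim\<phi>]
            test_function_partial_continuous[OF \<psi>] R(2)])
        (use C1_field_per(1)[OF pD(1)] \<phi>(2) in \<open>auto simp: per_def\<close>)
    moreover have "(\<lambda>n. LINT y|lborel. D n y $ i $ j * \<psi> y) \<longlonglongrightarrow> (LINT y|lborel. H y $ i $ j * \<psi> y)"
      by (rule per_integral_tendsto[OF sq_int_nth[OF sq_int_nth[OF Dsq]] _ sq_int_nth[OF sq_int_nth[OF H(1)]] _
            component[OF sq_int_nth[OF Dsq] sq_int_nth[OF H(1)] component[OF Dsq H(1) limH]]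
            test_function_continuous[OF \<psi>] R(1)])
        (use C1_field_per(2)[OF pD(1)] H(2) in \<open>auto simp: per_def\<close>)
    then have "(\<lambda>n. - (LINT y|lborel. D n y $ i $ j * \<psi> y)) \<longlonglongrightarrow> - (LINT y|lborel. H y $ i $ j * \<psi> y)"
      by (rule tendsto_minus)
    ultimately show ?thesis
      unfolding C1_field_weak_gradient[OF pD(1) \<psi>] by (rule LIMSEQ_unique)
  qed
  have sym_move: "A \<bullet> sym_part B = A \<bullet> B" if "transpose A = A" for A B
    using sym_part_inner[OF that, of B] by (simp add: inner_commute)
  have orth: "(LINT y|\<mu>. (f y - sym_part (H y)) \<bullet> D' y) = 0" if D': "C1_field p' D'" for p' D'
  proof -
    have D'sq: "sq_int \<mu> D'" by (rule sqD[OF D'])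
    define c where "c = (LINT y|\<mu>. (norm (sym_part (D' y)))\<^sup>2)"
    define b where "b n = (LINT y|\<mu>. (f y - sym_part (D n y)) \<bullet> sym_part (D' y))" for n
    define \<beta> where "\<beta> = (LINT y|\<mu>. (f y - sym_part (H y)) \<bullet> sym_part (D' y))"
    have c0: "c \<ge> 0" by (simp add: c_def)
    have blim: "b \<longlonglongrightarrow> \<beta>"
    proof -
      have e: "(f y - sym_part A) \<bullet> sym_part (D' y) = f y \<bullet> sym_part (D' y) - A \<bullet> sym_part (D' y)" for y A
        by (simp add: inner_diff_left sym_part_inner[OF transpose_sym_part])
      have "(\<lambda>n. (LINT y|\<mu>. f y \<bullet> sym_part (D' y)) - (LINT y|\<mu>. D n y \<bullet> sym_part (D' y)))
          \<longlonglongrightarrow> (LINT y|\<mu>. f y \<bullet> sym_part (D' y)) - (LINT y|\<mu>. H y \<bullet> sym_part (D' y))"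
        by (intro tendsto_diff tendsto_const integral_inner_tendsto Dsq H(1) sym_sq D'sq limH)
      then show ?thesis
        unfolding b_def[abs_def] \<beta>_def e
        using sq_int_inner[OF f sym_sq[OF D'sq]] sq_int_inner[OF Dsq sym_sq[OF D'sq]] sq_int_inner[OF H(1) sym_sq[OF D'sq]]
        by simp
    qed
    (* first variation: perturb the minimising sequence by \<tau> times the competitor and let n grow *)
    have var: "0 \<le> - 2 * \<tau> * \<beta> + \<tau>\<^sup>2 * c" for \<tau>
    proof -
      have "0 \<le> 1 / real (Suc n) - 2 * \<tau> * b n + \<tau>\<^sup>2 * c" for n
      proof -
        have "C1_field (\<lambda>y. 1 *\<^sub>R p n y + \<tau> *\<^sub>R p' y) (\<lambda>y. 1 *\<^sub>R D n y + \<tau> *\<^sub>R D' y)"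
          by (rule C1_field_combine[OF pD(1) D'])
        from d_le[OF this] have "d \<le> E (\<lambda>y. 1 *\<^sub>R D n y + \<tau> *\<^sub>R D' y)" .
        also have "\<dots> = (LINT y|\<mu>. (norm ((f y - sym_part (D n y)) - \<tau> *\<^sub>R sym_part (D' y)))\<^sup>2)"
        proof -
          have "f y - sym_part (1 *\<^sub>R D n y + \<tau> *\<^sub>R D' y) = (f y - sym_part (D n y)) - \<tau> *\<^sub>R sym_part (D' y)" for y
            by (simp add: sym_part_add
                sym_part_scaleR)
          then show ?thesis by (simp only: E_def)
        qed
        also have "\<dots> = E (D n) - 2 * \<tau> * b n + \<tau>\<^sup>2 * c"
          unfolding integral_norm_power2_diff[OF sq_int_diff[OF f sym_sq[OF Dsq]] sq_int_scaleR[OF sym_sq[OF D'sq]]]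
          by (simp add: E_def b_def c_def power_mult_distrib)
        finally show ?thesis using pD(2)[of n] by linarith
      qed
      moreover have "(\<lambda>n. 1 / real (Suc n) - 2 * \<tau> * b n + \<tau>\<^sup>2 * c) \<longlonglongrightarrow> 0 - 2 * \<tau> * \<beta> + \<tau>\<^sup>2 * c"
        by (intro tendsto_intros blim LIMSEQ_Suc[OF lim_1_over_n])
      ultimately have "0 \<le> 0 - 2 * \<tau> * \<beta> + \<tau>\<^sup>2 * c"
        by (intro tendsto_lowerbound[where F=sequentially]) auto
      then show ?thesis by simp
    qed
    have "\<beta> = 0"
    proof (rule ccontr)
      assume "\<beta> \<noteq> 0"
      (* a quadratic polynomial in \<tau> without constant term that is nonnegative has no linear term;
         adding 1 to c avoids a division by zero *)
      have "0 \<le> - 2 * (\<beta> / (c + 1)) * \<beta> + (\<beta> / (c + 1))\<^sup>2 * c" by (rule var)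
      also have "\<dots> = \<beta>\<^sup>2 / (c + 1) * (c / (c + 1) - 2)"
        by (simp add: power2_eq_square right_diff_distrib)
      also have "\<dots> < 0"
      proof (rule mult_pos_neg)
        show "\<beta>\<^sup>2 / (c + 1) > 0" using \<open>\<beta> \<noteq> 0\<close> c0 by simp
        have "c / (c + 1) < 1" using c0 by simp
        then show "c / (c + 1) - 2 < 0" by linarith
      qed
      finally show False by simp
    qed
    then show ?thesis by (simp add: \<beta>_def sym_move[OF transpose_diff_sym_part[OF fs]])
  qed
  have "(\<lambda>n. LINT y|\<mu>. D n y \<bullet> (f y - sym_part (H y))) \<longlonglongrightarrow> (LINT y|\<mu>. H y \<bullet> (f y - sym_part (H y)))"
    by (intro integral_inner_tendsto Dsq H(1) sq_int_diff f sym_sq limH)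
  then have "(LINT y|\<mu>. (f y - sym_part (H y)) \<bullet> H y) = 0"
    using orth[OF pD(1)] by (simp add: inner_commute LIMSEQ_const_iff)
  moreover have "has_weak_gradient \<phi> H"
    using sq_int_measurable[OF \<phi>(1)] sq_int_measurable[OF H(1)]
    by (intro has_weak_gradient_borelI L2_loc_of_sq_int \<phi> H grad) simp_all
  ultimately show ?thesis using orth by (intro that[OF \<phi> H]) blast+
qed

lemma AE_zero_of_cell:
  fixes r :: "real^3 \<Rightarrow> 'b::real_normed_vector"
  assumes "per r" "AE y in \<mu>. r y = 0"
  shows "AE y in lborel. r y = 0"
proof -
  have "AE y in lborel. y \<in> cell0 \<longrightarrow> r y = 0" using assms(2) by (simp add: AE_cell_measure)
  then have "AE y in lborel. \<forall>t\<in>\<Lambda>. y + t \<in> cell0 \<longrightarrow> r (y + t) = 0"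
    by (intro AE_ball_countable' countable_lattice AE_lborel_translate)
  then show ?thesis
  proof eventually_elim
    case (elim y)
    have "r (wrap y) = 0"
      using bspec[OF elim, of "- floor_pt y"] wrap_in_cell0[of y] by (simp add: wrap_def)
    then show ?case by (simp add: per_wrap[OF assms(1)])
  qed
qed

text \<open>
  The residual \<open>r\<close> of the projection is divergence-free, so the hypothesis applies to it and makes it
  orthogonal to \<open>f\<close>; it is also orthogonal to the projection, hence to itself.
\<close>

lemma compatibility_imp_sym_gradient:
  assumes e: "e \<in> L2_per_sym g"
    and orth: "\<And>s. s \<in> L2_per_sym g \<Longrightarrow> div_free s \<Longrightarrow>
       cell_mean g (\<lambda>y. e y \<bullet> s y) = cell_mean g e \<bullet> cell_mean g s"
  shows "\<exists>v\<in>LP g. has_sym_gradient v e"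
proof -
  have fin: "finite_measure \<mu>" by (rule cell.finite_measure_axioms)
  obtain e1 where e1: "sq_int \<mu> e1" "per e1" "\<And>y. transpose (e1 y) = e1 y" "AE y in lborel. e y = e1 y"
    using L2_per_sym_representative[OF e] by blast
  have em: "e \<in> borel_measurable lebesgue" using e by (simp add: L2_per_sym_def L2_loc_def)
  have e1int: "integrable \<mu> e1" by (rule sq_int_integrable[OF fin e1(1)])
  define A where "A = (LINT y|\<mu>. e1 y)"
  have As: "transpose A = A" unfolding A_def by (rule transpose_integral[OF e1int e1(3)])
  define f where "f y = e1 y - A" for y
  have f: "sq_int \<mu> f"
    unfolding f_def by (rule sq_int_diff[OF e1(1) sq_int_const[OF fin]])
  have fs: "transpose (f y) = f y" for y
    using e1(3)[of y] As by (simp add: f_def vec_eq_iff transpose_def)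
  obtain \<phi> H where \<phi>: "sq_int \<mu> \<phi>" "per \<phi>" and H: "sq_int \<mu> H" "per H"
    and grad: "has_weak_gradient \<phi> H"
    and ortho: "\<And>p D. C1_field p D \<Longrightarrow> (LINT y|\<mu>. (f y - sym_part (H y)) \<bullet> D y) = 0"
    and orthoH: "(LINT y|\<mu>. (f y - sym_part (H y)) \<bullet> H y) = 0"
    using projection_on_sym_gradients[OF f fs] by blast
  define r where "r y = f y - sym_part (H y)" for y
  have symH: "sq_int \<mu> (\<lambda>y. sym_part (H y))"
    by (rule sq_int_bounded_linear[OF bounded_linear_sym_part H(1)])
  have r: "sq_int \<mu> r" "per r" "\<And>y. transpose (r y) = r y"
  proof -
    show "sq_int \<mu> r" unfolding r_def by (rule sq_int_diff[OF f symH])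
    show "per r" using e1(2) H(2) by (simp add: per_def r_def f_def)
    show "transpose (r y) = r y" for y unfolding r_def by (rule transpose_diff_sym_part[OF fs])
  qed
  have rm [measurable]: "r \<in> borel_measurable borel" using sq_int_measurable[OF r(1)] by simp
  have rint: "integrable \<mu> r" by (rule sq_int_integrable[OF fin r(1)])
  have "div_free r"
    unfolding div_free_def
  proof (rule ballI)
    fix \<psi> assume \<psi>: "\<psi> \<in> test_functions"
    obtain R where R: "\<And>x. norm x > R \<Longrightarrow> \<psi> x = 0" "\<And>x j. norm x > R \<Longrightarrow> partial j \<psi> x = 0"
      using test_function_support[OF \<psi>] by metis
    have "distr_div r \<psi> $ i = 0" for i
    proof -
      have unf: "(LINT y|lebesgue. r y $ i $ j * partial j \<psi> y) = cell_vol * (LINT y|\<mu>. r y $ i $ j * periodization (partial j \<psi>) y)" for j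
      proof -
        have [measurable]: "partial j \<psi> \<in> borel_measurable borel"
          by (rule borel_measurable_continuous_onI[OF test_function_partial_continuous[OF \<psi>]])
        have "(LINT y|lebesgue. r y $ i $ j * partial j \<psi> y) = (LINT y|lborel. partial j \<psi> y *\<^sub>R r y $ i $ j)"
          by (subst integral_completion) (auto simp: mult.commute)
        also have "\<dots> = cell_vol *\<^sub>R (LINT y|\<mu>. periodization (partial j \<psi>) y *\<^sub>R r y $ i $ j)"
          by (rule per_integral_unfold(2)[OF _ _ sq_int_integrable[OF fin sq_int_nth[OF sq_int_nth[OF r(1)]]]
                test_function_partial_continuous[OF \<psi>] R(2)])
            (use r(2) in \<open>auto simp: per_def\<close>)
        finally show ?thesis by (simp add: mult.commute)
      qed
      (* the i-th component of div r, tested with \<psi>, is a pairing of r with a periodic gradient *)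
      have field: "C1_field (\<lambda>x. axis i (periodization \<psi> x)) (\<lambda>x. axis i (\<chi> j. periodization (partial j \<psi>) x))"
        by (rule C1_field_periodization[OF \<psi>])
      have int: "integrable \<mu> (\<lambda>y. r y $ i $ j * periodization (partial j \<psi>) y)" for j
        using sq_int_inner[OF sq_int_nth[OF sq_int_nth[OF r(1)]] sq_int_nth[OF sq_int_nth[OF C1_field_sq_int(2)[OF field]]], of i j i j]
        by simp
      have "(\<Sum>j\<in>UNIV. LINT y|\<mu>. r y $ i $ j * periodization (partial j \<psi>) y)
          = (LINT y|\<mu>. (\<Sum>j\<in>UNIV. r y $ i $ j * periodization (partial j \<psi>) y))"
        using int by simp
      also have "\<dots> = (LINT y|\<mu>. r y \<bullet> axis i (\<chi> j. periodization (partial j \<psi>) y))"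
        by (simp add: inner_axis) (simp add: inner_vec_def)
      also have "\<dots> = 0" using ortho[OF field] by (simp add: r_def)
      finally have "(\<Sum>j\<in>UNIV. LINT y|lebesgue. r y $ i $ j * partial j \<psi> y) = 0"
        by (simp add: unf flip: sum_distrib_left)
      then show ?thesis by (simp add: distr_div_def distr_partial_def sum_negf)
    qed
    then show "distr_div r \<psi> = 0" by (simp add: vec_eq_iff)
  qed
  moreover have "r \<in> L2_per_sym g"
    using L2_loc_of_sq_int[OF r(1,2)] per_imp_periodic[OF r(2)] r(3) by (simp add: L2_per_sym_def)
  ultimately have "cell_mean g (\<lambda>y. e y \<bullet> r y) = cell_mean g e \<bullet> cell_mean g r" by (intro orth)
  moreover have "r \<in> borel_measurable lebesgue" by (auto intro: measurable_completion)
  ultimately have "(LINT y|\<mu>. e1 y \<bullet> r y) = A \<bullet> (LINT y|\<mu>. r y)"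
    using cell_mean_inner_eq[OF em _ e1(1) r(1) e1(4), of r] cell_mean_eq[OF em _ e1(4)] cell_mean_eq[of r r]
      sq_int_measurable[OF e1(1)] by (simp add: A_def)
  then have "(LINT y|\<mu>. f y \<bullet> r y) = 0"
    using sq_int_inner[OF e1(1) r(1)] rint by (simp add: f_def inner_diff_left)
  moreover have "(LINT y|\<mu>. sym_part (H y) \<bullet> r y) = 0"
    unfolding sym_part_inner[OF r(3)] using orthoH by (simp add: r_def[symmetric] inner_commute)
  moreover have "(LINT y|\<mu>. (norm (r y))\<^sup>2) = (LINT y|\<mu>. f y \<bullet> r y - sym_part (H y) \<bullet> r y)"
    by (simp add: power2_norm_eq_inner r_def[symmetric] inner_diff_left[symmetric])
  ultimately have "(LINT y|\<mu>. (norm (r y))\<^sup>2) = 0"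
    using sq_int_inner[OF f r(1)] sq_int_inner[OF symH r(1)] by simp
  then have "AE y in \<mu>. r y = 0"
    using integral_nonneg_eq_0_iff_AE[OF sq_int_integrable_power2[OF r(1)]] by simp
  then have r0: "AE y in lborel. r y = 0" by (rule AE_zero_of_cell[OF r(2)])
  define v where "v y = A *v y + \<phi> y" for y
  have "v \<in> LP g"
  proof -
    have "\<phi> \<in> H1_per g" using grad per_imp_periodic[OF \<phi>(2)] by (auto simp: H1_per_def H1_loc_def)
    then show ?thesis unfolding LP_def v_def[abs_def] using As by blast
  qed
  moreover have "has_weak_gradient v (\<lambda>y. A + H y)"
    using has_weak_gradient_add_scaleR[OF has_weak_gradient_linear grad, of A 1] by (simp add: v_def[abs_def])
  moreover have "AE y in lebesgue. e y = (1/2) *\<^sub>R ((A + H y) + transpose (A + H y))"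
    unfolding AE_completion_iff using r0 e1(4)
  proof eventually_elim
    case (elim y)
    have "e y = A + sym_part (H y)" using elim by (simp add: r_def f_def algebra_simps)
    also have "\<dots> = sym_part (A + H y)"
      using sym_part_add[of A "H y"] sym_part_eq[OF As] by simp
    finally show ?case by (simp add: sym_part_def)
  qed
  ultimately show ?thesis by (auto simp: has_sym_gradient_def)
qed

text \<open>
  The weak gradient of \<open>v\<close> minus \<open>A\<close> is a weak gradient of the periodic part, and its symmetric part is
  \<open>e - A\<close>. Here \<open>A\<close> turns out to be the mean of \<open>e\<close>.
\<close>

lemma sym_gradient_imp_compatibility:
  assumes e: "e \<in> L2_per_sym g" and v: "v \<in> LP g" "has_sym_gradient v e"
    and s: "s \<in> L2_per_sym g" "div_free s"
  shows "cell_mean g (\<lambda>y. e y \<bullet> s y) = cell_mean g e \<bullet> cell_mean g s"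
proof -
  have fin: "finite_measure \<mu>" by (rule cell.finite_measure_axioms)
  obtain e1 where e1: "sq_int \<mu> e1" "per e1" "\<And>y. transpose (e1 y) = e1 y" "AE y in lborel. e y = e1 y"
    using L2_per_sym_representative[OF e] by blast
  obtain s1 where s1: "sq_int \<mu> s1" "per s1" "\<And>y. transpose (s1 y) = s1 y" "AE y in lborel. s y = s1 y"
    using L2_per_sym_representative[OF s(1)] by blast
  have em: "e \<in> borel_measurable lebesgue" and sm: "s \<in> borel_measurable lebesgue"
    using e s(1) by (simp_all add: L2_per_sym_def L2_loc_def)
  have e1m [measurable]: "e1 \<in> borel_measurable borel" and s1m [measurable]: "s1 \<in> borel_measurable borel"
    using sq_int_measurable[OF e1(1)] sq_int_measurable[OF s1(1)] by simp_all
  have "s1 \<in> borel_measurable lebesgue" by (auto intro: measurable_completion)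
  then have s1div: "div_free s1"
    using s(2) div_free_AE_cong[OF sm] s1(4) by (simp add: AE_completion_iff)
  obtain A \<phi>0 where A: "v = (\<lambda>y. A *v y + \<phi>0 y)" "transpose A = A" "\<phi>0 \<in> H1_per g"
    using v(1) by (auto simp: LP_def)
  obtain G where G: "has_weak_gradient v G" "AE y in lebesgue. e y = (1/2) *\<^sub>R (G y + transpose (G y))"
    using v(2) by (auto simp: has_sym_gradient_def)
  have \<phi>0L: "\<phi>0 \<in> L2_loc" and \<phi>0p: "periodic g \<phi>0"
    using A(3) by (auto simp: H1_per_def H1_loc_def has_weak_gradient_def)
  have \<phi>0m: "\<phi>0 \<in> borel_measurable lebesgue" using \<phi>0L by (simp add: L2_loc_def)
  obtain \<phi> where \<phi>m [measurable]: "\<phi> \<in> borel_measurable borel" and \<phi>p: "per \<phi>" and \<phi>eq: "AE y in lborel. \<phi>0 y = \<phi> y"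
    using periodic_representative[OF \<phi>0m \<phi>0p] by blast
  have \<phi>: "sq_int \<mu> \<phi>" by (rule sq_int_of_L2_loc[OF \<phi>0L \<phi>m \<phi>eq])
  define H where "H y = G y - A" for y
  have "has_weak_gradient \<phi>0 H"
    using has_weak_gradient_add_scaleR[OF G(1) has_weak_gradient_linear, of "-1" A]
    by (simp add: A(1) H_def[abs_def])
  then have grad: "has_weak_gradient \<phi> H"
    using \<phi>eq by (intro has_weak_gradient_AE_cong[OF _ L2_loc_of_sq_int[OF \<phi> \<phi>p]]) (simp_all add: AE_completion_iff)
  define f where "f y = e1 y - A" for y
  have f: "sq_int \<mu> f" "per f" "\<And>y. transpose (f y) = f y"
  proof -
    show "sq_int \<mu> f" unfolding f_def by (rule sq_int_diff[OF e1(1) sq_int_const[OF fin]])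
    show "per f" using e1(2) by (simp add: per_def f_def)
    show "transpose (f y) = f y" for y
      using e1(3)[of y] A(2) by (simp add: f_def vec_eq_iff transpose_def)
  qed
  have fH: "AE y in lebesgue. f y = sym_part (H y)"
    using G(2) e1(4) unfolding AE_completion_iff
  proof eventually_elim
    case (elim y)
    have "f y = sym_part (G y) - sym_part A" using elim sym_part_eq[OF A(2)] by (simp add: f_def sym_part_def[of "G y"])
    then show ?case
      using sym_part_diff[of "G y" A] by (simp add: H_def)
  qed
  have f0: "(LINT y|\<mu>. f y) = 0"
    by (rule sym_gradient_mean_zero[OF f \<phi> \<phi>p grad fH])
  have fs: "(LINT y|\<mu>. f y \<bullet> s1 y) = 0"
    by (rule sym_gradient_orthogonal[OF f(1,2) s1(1-3) s1div \<phi> \<phi>p grad fH])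
  have e1f: "e1 y = f y + A" for y by (simp add: f_def)
  have fint: "integrable \<mu> f" and sint: "integrable \<mu> s1"
    using sq_int_integrable[OF fin] f(1) s1(1) by blast+
  have "(LINT y|\<mu>. e1 y) = A" unfolding e1f using fint f0 by simp
  moreover have "(LINT y|\<mu>. e1 y \<bullet> s1 y) = A \<bullet> (LINT y|\<mu>. s1 y)"
    unfolding e1f inner_add_left using sq_int_inner[OF f(1) s1(1)] sint fs by simp
  ultimately show ?thesis
    using cell_mean_inner_eq[OF em sm e1(1) s1(1) e1(4) s1(4)] cell_mean_eq[OF em e1m e1(4)] cell_mean_eq[OF sm s1m s1(4)]
    by simp
qed

end

section \<open>Characterisation of periodic symmetrised gradients\<close>

theorem theorem27:
  fixes g :: "3 \<Rightarrow> real^3"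
    and e :: "real^3 \<Rightarrow> real^3^3"
  assumes "inj g" and "independent (range g)"
    and "e \<in> L2_per_sym g"
  shows "(\<exists>v\<in>LP g. has_sym_gradient v e) \<longleftrightarrow>
    (\<forall>s\<in>L2_per_sym g. div_free s \<longrightarrow>
       cell_mean g (\<lambda>y. e y \<bullet> s y) = cell_mean g e \<bullet> cell_mean g s)"
proof -
  interpret period_lattice g using assms(1,2) by unfold_locales
  show ?thesis
    using compatibility_imp_sym_gradient[OF assms(3)] sym_gradient_imp_compatibility[OF assms(3)] by blast
qed

end
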